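(* Fix $0\le q<1$, $0<\sigma\le1$ and $\mathsf c>0$. For each $N$ let $\{X_k^{(N)}\}_{k\in\mathbb Z_{\ge0}}$ be the Markov chain on $\mathbb Z_{\ge 0}$ with transition probabilities $$\mathbb P(X_k=n+\delta\mid X_{k-1}=n)=\frac{1-q^{n+1}}{1+\sigma}\cdot\begin{cases}\frac{s_{n+1}}{2s_n},&\delta=1,\\ \sigma,&\delta=0,\\ \frac{s_{n-1}}{2s_n},&\delta=-1,\\0,&\text{otherwise},\end{cases}\qquad n=0,1,\dots,$$ and with the initial law $\mathbb P(X_0=n)=\frac1{C_0}\rho_0^ns_n$, $n=0,1,\dots$, that depends on $N$ through $\rho_0=e^{-\mathsf c/\sqrt N}$. Then, as $N\to\infty$, the finite-dimensional distributions of $$\frac1{\sqrt N}\left\{X^{(N)}_{\lfloor Nt\rfloor}\right\}_{t\ge0}$$ converge to those of $\{\xi_t^{(\mathsf c)}\}_{t\ge0}$, where $\{\xi^{(\mathsf c)}_t\}_{t\ge 0}$ is the (time-changed) 3-dimensional Bessel process, i.e. the Markov process with transition probabilities $$\mathbb P(\xi_t^{(\mathsf c)}=dy\mid\xi_0^{(\mathsf c)}=x)=\frac yx\,\mathsf q_{\frac t{1+\sigma}}(x,y)\,dy ,$$ where $$\mathsf q_t(x,y)=\frac1{\sqrt{2\pi t}}\left(\exp\left(-\tfrac{(y-x)^2}{2t}\right)-\exp\left(-\tfrac{(y+x)^2}{2t}\right)\right),\quad x,y>0,\ t>0,$$ is the transition kernel of Brownian motion killed at hitting zero, and with the initial distribution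 $$\mathbb P(\xi_0^{(\mathsf c)}=dx)=\mathsf c^2xe^{-\mathsf cx}\mathbf 1_{\{x>0\}}dx.$$
   Context: $q$-Pochhammer symbols: $(a;q)_n=\prod_{k=0}^{n-1}(1-aq^k)$, $(a;q)_\infty=\prod_{k=0}^\infty(1-aq^k)$. Given $q,\sigma$: $a=-q(\sigma+\mathrm i\sqrt{1-\sigma^2})$, $b=-q(\sigma-\mathrm i\sqrt{1-\sigma^2})$, $s_{-1}=0$ and $s_n=\sum_{k=0}^n\frac{(a;q)_k}{(q;q)_k}\frac{(b;q)_{n-k}}{(q;q)_{n-k}}$ for $n\ge0$. The normalizing constant is $C_0=\frac{(a\rho_0;q)_\infty(b\rho_0;q)_\infty}{(\rho_0;q)_\infty^2}$. The convention $0^0=1$ is used. *)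

theory Defs
  imports "HOL-Probability.Probability"
begin

definition qpoch :: "complex \<Rightarrow> real \<Rightarrow> nat \<Rightarrow> complex" where
  "qpoch a q n = (\<Prod>k<n. 1 - a * of_real q ^ k)"

definition qpoch_inf :: "complex \<Rightarrow> real \<Rightarrow> complex" where
  "qpoch_inf a q = (\<Prod>k. 1 - a * of_real q ^ k)"

definition par_a :: "real \<Rightarrow> real \<Rightarrow> complex" where
  "par_a q \<sigma> = - of_real q * (of_real \<sigma> + \<i> * of_real (sqrt (1 - \<sigma>\<^sup>2)))"

definition par_b :: "real \<Rightarrow> real \<Rightarrow> complex" where
  "par_b q \<sigma> = - of_real q * (of_real \<sigma> - \<i> * of_real (sqrt (1 - \<sigma>\<^sup>2)))"

text \<open>The index is an integer so that the convention \<open>s (-1) = 0\<close> can be expressed.\<close>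

definition s_cplx :: "real \<Rightarrow> real \<Rightarrow> int \<Rightarrow> complex" where
  "s_cplx q \<sigma> n = (if n < 0 then 0 else
     (\<Sum>k\<le>nat n. qpoch (par_a q \<sigma>) q k / qpoch (of_real q) q k *
        (qpoch (par_b q \<sigma>) q (nat n - k) / qpoch (of_real q) q (nat n - k))))"

definition C0_cplx :: "real \<Rightarrow> real \<Rightarrow> real \<Rightarrow> complex" where
  "C0_cplx q \<sigma> \<rho> =
     qpoch_inf (par_a q \<sigma> * of_real \<rho>) q * qpoch_inf (par_b q \<sigma> * of_real \<rho>) q
       / (qpoch_inf (of_real \<rho>) q)\<^sup>2"

text \<open>Both quantities are real because the two parameters are complex conjugates of each other;
  lemmas \<open>s_seq_of_real\<close> and \<open>C0_of_real\<close> below show that taking real parts loses nothing.\<close>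

definition s_seq :: "real \<Rightarrow> real \<Rightarrow> int \<Rightarrow> real" where
  "s_seq q \<sigma> n = Re (s_cplx q \<sigma> n)"

definition C0 :: "real \<Rightarrow> real \<Rightarrow> real \<Rightarrow> real" where
  "C0 q \<sigma> \<rho> = Re (C0_cplx q \<sigma> \<rho>)"

lemma cnj_par_a: "cnj (par_a q \<sigma>) = par_b q \<sigma>"
  and cnj_par_b: "cnj (par_b q \<sigma>) = par_a q \<sigma>"
  by (simp_all add: par_a_def par_b_def)

lemma cnj_qpoch: "cnj (qpoch a q n) = qpoch (cnj a) q n"
  by (simp add: qpoch_def)

lemma s_seq_of_real: "complex_of_real (s_seq q \<sigma> n) = s_cplx q \<sigma> n"
proof -
  let ?f = "\<lambda>k. qpoch (par_a q \<sigma>) q k / qpoch (of_real q) q k *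
        (qpoch (par_b q \<sigma>) q (nat n - k) / qpoch (of_real q) q (nat n - k))"
  have "cnj (\<Sum>k\<le>nat n. ?f k) = (\<Sum>k\<le>nat n. ?f (nat n - k))"
    by (simp add: cnj_qpoch cnj_par_a cnj_par_b mult.commute)
  also have "\<dots> = (\<Sum>k\<le>nat n. ?f k)"
    by (rule sum.nat_diff_reindex [where n = "Suc (nat n)" and g = ?f,
          unfolded lessThan_Suc_atMost diff_Suc_Suc])
  finally have "cnj (s_cplx q \<sigma> n) = s_cplx q \<sigma> n"
    by (simp add: s_cplx_def)
  then show ?thesis
    by (metis Reals_cnj_iff of_real_Re s_seq_def)
qed

lemma qpoch_inf_LIMSEQ:
  assumes "\<bar>q\<bar> < 1"
  shows "(\<lambda>n. qpoch a q (Suc n)) \<longlonglongrightarrow> qpoch_inf a q"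
proof -
  have "summable (\<lambda>k. norm ((1 - a * complex_of_real q ^ k) - 1))"
    using assms by (simp add: norm_mult norm_power)
  then have "convergent_prod (\<lambda>k. 1 - a * complex_of_real q ^ k)"
    by (intro abs_convergent_prod_imp_convergent_prod summable_imp_abs_convergent_prod)
  from convergent_prod_LIMSEQ[OF this] show ?thesis
    by (simp add: qpoch_def qpoch_inf_def lessThan_Suc_atMost)
qed

lemma cnj_qpoch_inf:
  assumes "\<bar>q\<bar> < 1"
  shows "cnj (qpoch_inf a q) = qpoch_inf (cnj a) q"
proof (rule LIMSEQ_unique)
  show "(\<lambda>n. qpoch (cnj a) q (Suc n)) \<longlonglongrightarrow> cnj (qpoch_inf a q)"
    using tendsto_cnj[OF qpoch_inf_LIMSEQ[OF assms, of a]] by (simp add: cnj_qpoch)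
qed (rule qpoch_inf_LIMSEQ[OF assms])

lemma C0_of_real:
  assumes "\<bar>q\<bar> < 1"
  shows "complex_of_real (C0 q \<sigma> \<rho>) = C0_cplx q \<sigma> \<rho>"
proof -
  have "cnj (C0_cplx q \<sigma> \<rho>) = C0_cplx q \<sigma> \<rho>"
    by (simp add: C0_cplx_def cnj_qpoch_inf[OF assms] cnj_par_a cnj_par_b mult.commute)
  then show ?thesis
    by (metis C0_def Reals_cnj_iff of_real_Re)
qed

definition step_prob :: "real \<Rightarrow> real \<Rightarrow> nat \<Rightarrow> int \<Rightarrow> real" where
  "step_prob q \<sigma> n \<delta> = (1 - q ^ (n + 1)) / (1 + \<sigma>) *
     (if \<delta> = 1 then s_seq q \<sigma> (int n + 1) / (2 * s_seq q \<sigma> (int n))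
      else if \<delta> = 0 then \<sigma>
      else if \<delta> = -1 then s_seq q \<sigma> (int n - 1) / (2 * s_seq q \<sigma> (int n))
      else 0)"

definition trans_prob :: "real \<Rightarrow> real \<Rightarrow> nat \<Rightarrow> nat \<Rightarrow> real" where
  "trans_prob q \<sigma> n m = step_prob q \<sigma> n (int m - int n)"

definition init_prob :: "real \<Rightarrow> real \<Rightarrow> real \<Rightarrow> nat \<Rightarrow> real" where
  "init_prob q \<sigma> \<rho> n = 1 / C0 q \<sigma> \<rho> * \<rho> ^ n * s_seq q \<sigma> (int n)"

text \<open>\<open>cond_prob\<close> divides by zero when the conditioning event is null, hence the positivity guard.\<close>

definition markov_chain ::
  "'a measure \<Rightarrow> (nat \<Rightarrow> 'a \<Rightarrow> nat) \<Rightarrow> (nat \<Rightarrow> real) \<Rightarrow> (nat \<Rightarrow> nat \<Rightarrow> real) \<Rightarrow> bool" where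
  "markov_chain M X \<mu> P \<longleftrightarrow>
     prob_space M \<and>
     (\<forall>k. X k \<in> measurable M (count_space UNIV)) \<and>
     (\<forall>n. \<P>(\<omega> in M. X 0 \<omega> = n) = \<mu> n) \<and>
     (\<forall>k x m. \<P>(\<omega> in M. \<forall>i\<le>k. X i \<omega> = x i) > 0 \<longrightarrow>
        cond_prob M (\<lambda>\<omega>. X (Suc k) \<omega> = m) (\<lambda>\<omega>. \<forall>i\<le>k. X i \<omega> = x i) = P (x k) m)"

definition killed_bm_kernel :: "real \<Rightarrow> real \<Rightarrow> real \<Rightarrow> real" where
  "killed_bm_kernel t x y =
     1 / sqrt (2 * pi * t) * (exp (- ((y - x)\<^sup>2 / (2 * t))) - exp (- ((y + x)\<^sup>2 / (2 * t))))"

text \<open>The state space is the open half-line, embedded in the reals.  The kernel is meaningful for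
  \<open>x > 0\<close> and \<open>t > 0\<close> only; by the initial law and the support of the kernel, the process is
  almost surely positive at every fixed time, so other values of \<open>x\<close> do not matter.\<close>

definition bessel_trans :: "real \<Rightarrow> real \<Rightarrow> real \<Rightarrow> real measure" where
  "bessel_trans \<sigma> t x = density lborel
     (\<lambda>y. ennreal (y / x * killed_bm_kernel (t / (1 + \<sigma>)) x y) * indicator {0<..} y)"

definition bessel_init :: "real \<Rightarrow> real measure" where
  "bessel_init c = density lborel (\<lambda>x. ennreal (c\<^sup>2 * x * exp (- c * x)) * indicator {0<..} x)"

definition past :: "'a measure \<Rightarrow> (real \<Rightarrow> 'a \<Rightarrow> real) \<Rightarrow> real \<Rightarrow> 'a measure" where
  "past M \<xi> s = sigma (space M)
     {\<xi> u -` A \<inter> space M | u A. 0 \<le> u \<and> u \<le> s \<and> A \<in> sets borel}"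

text \<open>A time-homogeneous Markov process (with respect to its own past) indexed by \<open>t \<ge> 0\<close>, with
  initial law \<open>\<mu>\<close> and transition probabilities \<open>K t x\<close> for \<open>t > 0\<close>.\<close>

definition markov_process ::
  "'a measure \<Rightarrow> (real \<Rightarrow> 'a \<Rightarrow> real) \<Rightarrow> real measure \<Rightarrow> (real \<Rightarrow> real \<Rightarrow> real measure) \<Rightarrow> bool" where
  "markov_process M \<xi> \<mu> K \<longleftrightarrow>
     prob_space M \<and>
     (\<forall>t\<ge>0. \<xi> t \<in> borel_measurable M) \<and>
     distr M borel (\<xi> 0) = \<mu> \<and>
     (\<forall>s\<ge>0. \<forall>t>0. \<forall>A\<in>sets borel.
        AE \<omega> in M. real_cond_exp M (past M \<xi> s) (\<lambda>\<omega>. indicator A (\<xi> (s + t) \<omega>)) \<omega>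
          = measure (K t (\<xi> s \<omega>)) A)"

definition weakly_converges ::
  "(nat \<Rightarrow> 'a::topological_space measure) \<Rightarrow> 'a measure \<Rightarrow> bool" where
  "weakly_converges \<mu> \<nu> \<longleftrightarrow>
     (\<forall>f::'a \<Rightarrow> real. continuous_on UNIV f \<and> bounded (range f) \<longrightarrow>
        (\<lambda>N. integral\<^sup>L (\<mu> N) f) \<longlonglongrightarrow> integral\<^sup>L \<nu> f)"

end

(* A Gaussian g_b(x) = exp (- b x^2 / 2) is mapped by the Bessel semigroup at time t to
   (1 + b t)^(-3/2) g_{b/(1 + b t)}, and products of Gaussians are Gaussians.  Hence joint
   expectations of Gaussians at finitely many times can be computed on both sides by peeling off
   the last time, and they determine weak convergence by Stone-Weierstrass applied to
   w = exp (- x^2 / 2) in a cube.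

   The walk is the h-transform, by s_n, of a reversible killed walk.  The recurrence for s_n gives
   s_n ~ K n, so one step of the walk acts on Gaussians as the Bessel semigroup at time
   1 / (N (1 + sigma)), up to an error e(n) / N with e(n) -> 0 as the position n tends to infinity.
   The initial law is at most 1 / C_0 times the reversible measure, and so are all later
   one-dimensional marginals.  As C_0 grows like N, the walk is at a bounded position with
   vanishing probability, uniformly in time, so the accumulated error tends to 0. *)

theory Submission
  imports Defs
begin

text \<open>The generator f''/2 + f'/x of the limit is singular at 0, and the walk matches it only
  far from 0, so the one-step comparison is not uniform in the starting point. It is therefore made
  in expectation, and the bad region is controlled by the occupation bound. Since b / (1 + b t) <=
  b, one Taylor constant serves for all the steps that are peeled off, whose number is of order N.
  The normalizer is reached through the total mass of the initial law: \<open>init_prob\<close> sums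
  to 1, so C_0 is the sum of rho_0^n s_n, a Riemann sum of mesh h = 1 / sqrt N, which gives C_0 ~ K
  N / c^2. The same sum with a test function inserted gives the initial limit law, and K cancels in
  the quotient. Stone-Weierstrass acts on a compact cube, whereas weak convergence tests bounded
  continuous functions that need no limit at infinity. The faces w_i = 0 are therefore cut off, and
  the tightness that this takes is itself read off from expectations of continuous functions of
  w.\<close>

section \<open>Recurrence and growth of \<open>s_seq\<close>\<close>

text \<open>By the q-binomial theorem this is the expansion of (a z; q)_inf / (z; q)_inf. The
  product of the series for the two parameters generates \<open>s_cplx\<close>; formal series make
  convergence a non-issue.\<close>

definition qbin_fps :: "complex \<Rightarrow> real \<Rightarrow> complex fps" where
  "qbin_fps a q = Abs_fps (\<lambda>k. qpoch a q k / qpoch (of_real q) q k)"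

lemma qpoch_self_nonzero:
  assumes "0 \<le> q" "q < 1"
  shows "qpoch (of_real q) q n \<noteq> 0"
proof -
  have "1 - complex_of_real q * of_real q ^ k \<noteq> 0" for k
  proof -
    have "q ^ Suc k < 1"
      using mult_left_le[of "q ^ k" q] power_le_one[of q k] assms by simp
    then have "of_real (q ^ Suc k) \<noteq> (1::complex)"
      by (metis less_irrefl of_real_eq_1_iff)
    then show ?thesis by simp
  qed
  then show ?thesis
    by (simp add: qpoch_def)
qed

text \<open>The formal version of F(z) = (1 - a z) / (1 - z) F(q z), where the first factor of each
  infinite product is split off. On coefficients it is c_{m+1} (1 - q^{m+1}) = c_m (1 - a
  q^m).\<close>

lemma qbin_fps_functional_equation:
  assumes "0 \<le> q" "q < 1"
  shows "(1 - fps_X) * qbin_fps a q =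
    (1 - fps_const a * fps_X) * (qbin_fps a q oo (fps_const (of_real q) * fps_X))"
proof (rule fps_ext)
  fix n
  show "fps_nth ((1 - fps_X) * qbin_fps a q) n =
    fps_nth ((1 - fps_const a * fps_X) * (qbin_fps a q oo (fps_const (of_real q) * fps_X))) n"
  proof (cases n)
    case 0
    then show ?thesis
      by (simp add: qbin_fps_def fps_compose_linear qpoch_def)
  next
    case (Suc m)
    let ?A = "qpoch a q m" and ?B = "qpoch (of_real q) q m"
    have nz: "?B \<noteq> 0" "1 - of_real q * of_real q ^ m \<noteq> (0::complex)"
      using qpoch_self_nonzero[OF assms, of m] qpoch_self_nonzero[OF assms, of "Suc m"]
      by (auto simp: qpoch_def)
    have eq: "?A * (1 - a * of_real q ^ m) / (?B * (1 - of_real q * of_real q ^ m)) - ?A / ?B =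
      of_real q ^ Suc m * (?A * (1 - a * of_real q ^ m) / (?B * (1 - of_real q * of_real q ^ m)))
       - a * (of_real q ^ m * (?A / ?B))"
      using nz by (simp add: divide_simps) (simp add: algebra_simps)
    have "qpoch a q (Suc m) = ?A * (1 - a * of_real q ^ m)"
      "qpoch (of_real q) q (Suc m) = ?B * (1 - of_real q * of_real q ^ m)"
      by (simp_all add: qpoch_def)
    with eq show ?thesis
      unfolding Suc
      by (simp add: qbin_fps_def fps_compose_linear left_diff_distrib mult.assoc)
  qed
qed

lemma qbin_fps_product_nth:
  "fps_nth (qbin_fps (par_a q \<sigma>) q * qbin_fps (par_b q \<sigma>) q) n = s_cplx q \<sigma> (int n)"
  by (simp add: fps_mult_nth qbin_fps_def s_cplx_def atLeast0AtMost)

locale chain_params =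
  fixes q \<sigma> :: real
  assumes q_nonneg: "0 \<le> q" and q_less_1: "q < 1"
    and sigma_pos: "0 < \<sigma>" and sigma_le_1: "\<sigma> \<le> 1"
begin

abbreviation s :: "int \<Rightarrow> real" where "s \<equiv> s_seq q \<sigma>"

lemma q_power_less_1: "q ^ Suc n < 1"
  using mult_left_le[of "q ^ n" q] power_le_one[of q n] q_nonneg q_less_1 by simp

text \<open>Multiplying the functional equations for a and b gives (1 - z)^2 G(z) = (1 - (a + b) z +
  a b z^2) G(q z), with a + b = -2 q sigma and a b = q^2; the coefficients of z^{n+1} are compared.
  This one identity makes the transition probabilities sum to 1 and governs the growth of
  s_n.\<close>

lemma s_recurrence:
  "(1 - q ^ (n + 1)) * (s (int n + 1) + s (int n - 1)) = 2 * (1 + \<sigma> * q ^ (n + 1)) * s (int n)"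
proof -
  let ?a = "par_a q \<sigma>" and ?b = "par_b q \<sigma>" and ?qX = "fps_const (complex_of_real q) * fps_X"
  let ?G = "qbin_fps ?a q * qbin_fps ?b q"
  have sum: "?a + ?b = of_real (- 2 * q * \<sigma>)"
    by (simp add: par_a_def par_b_def algebra_simps)
  have "?a * ?b = (of_real q)\<^sup>2 * ((of_real \<sigma>)\<^sup>2 - (\<i> * of_real (sqrt (1 - \<sigma>\<^sup>2)))\<^sup>2)"
    by (simp add: par_a_def par_b_def algebra_simps power2_eq_square)
  also have "\<dots> = (of_real q)\<^sup>2 * ((of_real \<sigma>)\<^sup>2 + of_real ((sqrt (1 - \<sigma>\<^sup>2))\<^sup>2))"
    by (simp add: power_mult_distrib)
  also have "(sqrt (1 - \<sigma>\<^sup>2))\<^sup>2 = 1 - \<sigma>\<^sup>2"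
    using sigma_pos sigma_le_1 by (simp add: power_le_one)
  finally have prod: "?a * ?b = of_real (q\<^sup>2)"
    by simp
  have "(1 - fps_X) * (1 - fps_X) * ?G =
      ((1 - fps_const ?a * fps_X) * (qbin_fps ?a q oo ?qX)) * ((1 - fps_const ?b * fps_X) * (qbin_fps ?b q oo ?qX))"
    unfolding qbin_fps_functional_equation[OF q_nonneg q_less_1, symmetric] by (simp add: mult_ac)
  also have "\<dots> = (1 - fps_const ?a * fps_X) * (1 - fps_const ?b * fps_X) * (?G oo ?qX)"
    by (subst fps_compose_mult_distrib) (auto simp: mult_ac)
  also have "(1 - fps_const ?a * fps_X) * (1 - fps_const ?b * fps_X)
      = 1 - fps_const (?a + ?b) * fps_X + fps_const (?a * ?b) * fps_X * fps_X"
    by (simp add: algebra_simps flip: fps_const_add fps_const_mult)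
  finally have eq: "?G - fps_X * ?G - fps_X * ?G + fps_X * (fps_X * ?G) = (?G oo ?qX)
      - fps_const (of_real (- 2 * q * \<sigma>)) * (fps_X * (?G oo ?qX))
      + fps_const (of_real (q\<^sup>2)) * (fps_X * (fps_X * (?G oo ?qX)))"
    unfolding sum prod by (simp add: algebra_simps)
  define G where "G = ?G"
  define H where "H = ?G oo ?qX"
  have G: "fps_nth G k = of_real (s (int k))" for k
    by (simp only: G_def qbin_fps_product_nth s_seq_of_real)
  have H: "fps_nth H k = of_real (q ^ k * s (int k))" for k
    by (simp only: H_def fps_compose_linear fps_nth_Abs_fps qbin_fps_product_nth s_seq_of_real
        of_real_mult of_real_power)
  note eq = eq[folded H_def, folded G_def]
  have neg: "s (- 1) = 0"
    by (simp add: s_seq_def s_cplx_def)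
  have pr: "fps_nth (fps_X * (fps_X * F)) (Suc n) = (case n of 0 \<Rightarrow> 0 | Suc k \<Rightarrow> fps_nth F k)"
    for F :: "complex fps"
    by (cases n) auto
  have gen: "x - 2 * y + z = Q * x + 2 * \<sigma> * Q * y + Q * z \<Longrightarrow>
      (1 - Q) * (x + z) = 2 * (1 + \<sigma> * Q) * y" for x y z Q :: real
    by algebra
  have G2: "fps_nth (G * 2) k = 2 * fps_nth G k" for k
    by (simp add: mult_2_right)
  \<comment> \<open>Coefficient of \<open>fps_X\<close> to the power n + 1. For n = 0 the twice
    shifted series has no such coefficient, hence the \<open>if\<close>; afterwards s_{-1} = 0
    absorbs it.\<close>
  have "complex_of_real (s (int n + 1) - 2 * s (int n) + s (int n - 1)) =
     of_real (q ^ Suc n * s (int n + 1) + 2 * q * \<sigma> * q ^ n * s (int n)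
       + (q\<^sup>2 * (if n = 0 then 0 else q ^ (n - 1) * s (int n - 1))))"
    using arg_cong[OF eq, of "\<lambda>F. fps_nth F (Suc n)"] neg
    by (cases n) (simp_all add: pr G2 G H algebra_simps)
  then have "s (int n + 1) - 2 * s (int n) + s (int n - 1) =
     q ^ Suc n * s (int n + 1) + 2 * q * \<sigma> * q ^ n * s (int n)
       + (q\<^sup>2 * (if n = 0 then 0 else q ^ (n - 1) * s (int n - 1)))"
    by (simp only: of_real_eq_iff)
  also have "\<dots> = q ^ (n + 1) * s (int n + 1) + 2 * \<sigma> * q ^ (n + 1) * s (int n)
       + q ^ (n + 1) * s (int n - 1)"
    using neg by (cases n) (simp_all add: power2_eq_square)
  finally show ?thesis
    using gen by blast
qed

section \<open>Increments of s_n: positive, increasing and bounded, hence linear growth\<close>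

definition d :: "nat \<Rightarrow> real" where
  "d n = s (int n) - s (int n - 1)"

lemma s_neg: "s (- 1) = 0" and s_0: "s 0 = 1"
  by (simp_all add: s_seq_def s_cplx_def qpoch_def)

lemma s_eq_sum: "s (int n) = (\<Sum>k\<le>n. d k)"
  by (induction n) (simp_all add: d_def s_neg algebra_simps)

text \<open>The recurrence read as a formula for the second difference of s: it is positive, so s is
  convex, and of size s_n q^n, so s is nearly linear.\<close>

lemma d_Suc: "d (Suc n) = d n + 2 * s (int n) * q ^ Suc n * (1 + \<sigma>) / (1 - q ^ Suc n)"
  using s_recurrence[of n] q_power_less_1[of n]
  by (simp add: d_def field_simps)

lemma d_ge_1: "d n \<ge> 1" and s_ge: "s (int n) \<ge> real n + 1"
proof -
  have "d n \<ge> 1 \<and> s (int n) \<ge> real n + 1"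
  proof (induction n)
    case 0
    then show ?case by (simp add: d_def s_neg s_0)
  next
    case (Suc n)
    have "2 * s (int n) * q ^ Suc n * (1 + \<sigma>) / (1 - q ^ Suc n) \<ge> 0"
      using Suc q_power_less_1[of n] q_nonneg sigma_pos
      by (intro divide_nonneg_pos mult_nonneg_nonneg zero_le_power) auto
    then have "d (Suc n) \<ge> 1"
      using Suc unfolding d_Suc by linarith
    moreover have "s (int (Suc n)) = s (int n) + d (Suc n)"
      by (simp add: d_def)
    ultimately show ?case using Suc by simp
  qed
  then show "d n \<ge> 1" "s (int n) \<ge> real n + 1" by auto
qed

lemma s_pos: "s (int n) > 0"
  using s_ge[of n] by linarith

lemma s_nonneg: "s i \<ge> 0"
proof (cases "i < 0")
  case True
  then show ?thesis by (simp add: s_seq_def s_cplx_def)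
next
  case False
  then show ?thesis using s_pos[of "nat i"] by simp
qed

lemma d_mono: "d n \<le> d (Suc n)"
proof -
  have "2 * s (int n) * q ^ Suc n * (1 + \<sigma>) / (1 - q ^ Suc n) \<ge> 0"
    using s_pos[of n] q_power_less_1[of n] q_nonneg sigma_pos
    by (intro divide_nonneg_pos mult_nonneg_nonneg zero_le_power) auto
  then show ?thesis by (simp only: d_Suc)
qed

lemma incseq_d: "incseq d"
  using d_mono by (rule incseq_SucI)

lemma s_le: "s (int n) \<le> (real n + 1) * d n"
proof -
  have "(\<Sum>k\<le>n. d k) \<le> (\<Sum>k\<le>n. d n)"
    using incseq_d by (intro sum_mono) (auto simp: incseq_def)
  then show ?thesis by (simp add: s_eq_sum algebra_simps)
qed

text \<open>A discrete Gronwall argument: s_n <= (n + 1) d_n turns the second difference into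
  d_{n+1} <= d_n (1 + b_n) with b_n a multiple of (n + 1) q^n. As b is summable, d stays below exp
  (sum b), and it is monotone.\<close>

lemma convergent_d: "convergent d"
proof -
  define b where "b n = 2 * (1 + \<sigma>) / (1 - q) * q * (real (Suc n) * q ^ n)" for n
  have b_nonneg: "b n \<ge> 0" for n
    using q_nonneg q_less_1 sigma_pos by (simp add: b_def)
  have sb: "summable b"
    unfolding b_def using geometric_deriv_sums[of q] q_nonneg q_less_1
    by (intro summable_mult) (simp add: sums_iff)
  have step: "d (Suc n) \<le> d n * (1 + b n)" for n
  proof -
    have "1 - q \<le> 1 - q ^ Suc n"
      using power_le_one[OF q_nonneg, of n] q_less_1 q_nonneg mult_left_le[of "q ^ n" q] by simp
    then have "2 * s (int n) * q ^ Suc n * (1 + \<sigma>) / (1 - q ^ Suc n)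
        \<le> 2 * ((real n + 1) * d n) * q ^ Suc n * (1 + \<sigma>) / (1 - q)"
      using s_le[of n] s_pos[of n] q_nonneg q_less_1 sigma_pos d_ge_1[of n]
      by (intro frac_le mult_right_mono mult_left_mono mult_nonneg_nonneg) auto
    also have "\<dots> = d n * b n"
      by (simp add: b_def algebra_simps)
    finally show ?thesis
      by (simp only: d_Suc) (simp add: algebra_simps)
  qed
  have bound: "d n \<le> exp (\<Sum>k<n. b k)" for n
  proof (induction n)
    case 0
    then show ?case by (simp add: d_def s_neg s_0)
  next
    case (Suc n)
    have "d (Suc n) \<le> d n * exp (b n)"
      using step[of n] exp_ge_add_one_self[of "b n"] d_ge_1[of n]
      by (meson mult_left_mono order_trans le_numeral_extra(4) zero_le_one)
    also have "\<dots> \<le> exp (\<Sum>k<n. b k) * exp (b n)"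
      using Suc by (intro mult_right_mono) auto
    finally show ?case by (simp add: exp_add)
  qed
  have "d n \<le> exp (suminf b)" for n
    using bound[of n] sum_le_suminf[OF sb, of "{..<n}"] b_nonneg by (smt (verit) exp_le_cancel_iff finite_lessThan)
  then obtain L where "d \<longlonglongrightarrow> L"
    using incseq_convergent[OF incseq_d] by metis
  then show ?thesis by (rule convergentI)
qed

text \<open>The asymptotic slope of s; it cancels from the drift and from the normalized initial
  law.\<close>

definition K :: real where "K = lim d"

lemma d_tendsto: "d \<longlonglongrightarrow> K"
  using convergent_d by (simp add: K_def convergent_LIMSEQ_iff)

lemma d_le_K: "d n \<le> K"
  using incseq_le[OF incseq_d d_tendsto] .

lemma K_ge_1: "K \<ge> 1"
  using d_le_K[of 0] d_ge_1[of 0] by simp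

lemma s_le_K: "s (int n) \<le> K * (real n + 1)"
proof -
  have "s (int n) \<le> (real n + 1) * d n" by (rule s_le)
  also have "\<dots> \<le> (real n + 1) * K" using d_le_K by (intro mult_left_mono) auto
  finally show ?thesis by (simp add: mult.commute)
qed

text \<open>A Cesaro mean: s_n is the sum of the n + 1 increments d_0, ..., d_n, which converge to
  K.\<close>

lemma s_over_n_tendsto: "(\<lambda>n. s (int n) / (real n + 1)) \<longlonglongrightarrow> K"
proof (rule LIMSEQ_I)
  fix e :: real assume e: "0 < e"
  from d_tendsto obtain m where m: "\<And>n. n \<ge> m \<Longrightarrow> norm (d n - K) < e / 2"
    using e by (meson LIMSEQ_D half_gt_zero)
  obtain m' :: nat where m': "real m' > 2 * K * real m / e"
    using reals_Archimedean2 by blast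
  show "\<exists>no. \<forall>n\<ge>no. norm (s (int n) / (real n + 1) - K) < e"
  proof (intro exI allI impI)
    fix n assume n: "n \<ge> max m m'"
    have split: "{..n} = {..<m} \<union> {m..n}" using n by auto
    have "K * (real n + 1) - s (int n) = (\<Sum>k\<le>n. K - d k)"
      by (simp add: s_eq_sum sum_subtractf algebra_simps)
    also have "\<dots> = (\<Sum>k<m. K - d k) + (\<Sum>k=m..n. K - d k)"
      unfolding split by (rule sum.union_disjoint) auto
    also have "\<dots> \<le> (\<Sum>k<m. K) + (\<Sum>k=m..n. e / 2)"
    proof (intro add_mono sum_mono)
      fix k
      show "K - d k \<le> K" using d_ge_1[of k] by simp
      assume "k \<in> {m..n}"
      then show "K - d k \<le> e / 2" using m[of k, unfolded real_norm_def abs_less_iff] by force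
    qed
    also have "\<dots> \<le> K * real m + (real n + 1) * (e / 2)"
      using n e by (simp add: mult_right_mono)
    also have "K * real m < (real n + 1) * (e / 2)"
    proof -
      have "2 * K * real m / e < real n + 1" using m' n by linarith
      then show ?thesis using e by (simp add: field_simps)
    qed
    finally have "K * (real n + 1) - s (int n) < (real n + 1) * e" by (simp add: mult.commute)
    then have "\<bar>s (int n) - K * (real n + 1)\<bar> < (real n + 1) * e"
      using s_le_K[of n] by linarith
    then have "\<bar>(s (int n) - K * (real n + 1)) / (real n + 1)\<bar> < e"
      by (simp add: abs_divide field_simps)
    then show "norm (s (int n) / (real n + 1) - K) < e"
      by (simp add: diff_divide_distrib)
  qed
qed

end

section \<open>Gaussian test functions\<close>

definition gauss :: "real \<Rightarrow> real \<Rightarrow> real" where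
  "gauss b x = exp (- (b * x\<^sup>2 / 2))"

text \<open>The image of \<open>gauss b\<close> under the 3-dimensional Bessel semigroup at time t.
  The factor (1 + b t)^(-3/2) is written through \<open>ln\<close>, so that the semigroup law and
  the time derivatives become statements about logarithms.\<close>

definition bgauss :: "real \<Rightarrow> real \<Rightarrow> real \<Rightarrow> real" where
  "bgauss b t x = exp (- (3 / 2 * ln (1 + b * t))) * gauss (b / (1 + b * t)) x"

lemma gauss_pos: "gauss b x > 0"
  by (simp add: gauss_def)

lemma gauss_le_1: "b \<ge> 0 \<Longrightarrow> gauss b x \<le> 1"
  by (simp add: gauss_def)

lemma gauss_mult: "gauss a x * gauss b x = gauss (a + b) x"
  by (simp add: gauss_def distrib_right add_divide_distrib flip: exp_add)

lemma gauss_measurable [measurable]: "gauss b \<in> borel_measurable borel"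
  unfolding gauss_def by measurable

lemma bgauss_measurable [measurable]: "bgauss b t \<in> borel_measurable borel"
  unfolding bgauss_def by measurable

lemma bgauss_0 [simp]: "bgauss b 0 x = gauss b x"
  by (simp add: bgauss_def)

lemma bgauss_nonneg: "bgauss b t x \<ge> 0"
  by (simp add: bgauss_def less_imp_le[OF gauss_pos])

text \<open>The semigroup law on Gaussians: with b' = b / (1 + b s) one has 1 + b (s + t) = (1 + b
  s) (1 + b' t). It lets many small steps be merged into one \<open>bgauss\<close>.\<close>

lemma bgauss_add:
  assumes "b \<ge> 0" "s \<ge> 0" "t \<ge> 0"
  shows "bgauss b (s + t) x = exp (- (3 / 2 * ln (1 + b * s))) * bgauss (b / (1 + b * s)) t x"
proof -
  have pos: "1 + b * s > 0" "1 + b / (1 + b * s) * t > 0"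
    using assms by (auto intro!: add_pos_nonneg)
  have eq: "1 + b * (s + t) = (1 + b * s) * (1 + b / (1 + b * s) * t)"
    using pos(1) by (simp add: field_simps)
  have "ln (1 + b * (s + t)) = ln (1 + b * s) + ln (1 + b / (1 + b * s) * t)"
    unfolding eq using pos by (rule ln_mult_pos)
  moreover have "b / (1 + b * (s + t)) = b / (1 + b * s) / (1 + b / (1 + b * s) * t)"
    unfolding eq by simp
  ultimately show ?thesis
    unfolding bgauss_def by (simp only: distrib_left minus_add_distrib exp_add mult.assoc)
qed

lemma mult_exp_minus_le_1: "y * exp (- y) \<le> (1::real)"
proof -
  have "y \<le> exp y" using exp_ge_add_one_self[of y] by linarith
  then show ?thesis by (simp add: exp_minus field_simps)
qed

lemma divide_one_plus_le:
  "b \<ge> 0 \<Longrightarrow> t \<ge> 0 \<Longrightarrow> b / (1 + b * t) \<le> (b :: real)"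
  using frac_le[of b b 1 "1 + b * t"] by simp

lemma square_mult_exp_minus_le_2:
  assumes "y \<ge> 0"
  shows "y\<^sup>2 * exp (- y) \<le> (2::real)"
  using exp_lower_Taylor_quadratic[OF assms] assms by (simp add: exp_minus field_simps)

lemma bgauss_le_1:
  assumes "b \<ge> 0" "t \<ge> 0"
  shows "bgauss b t x \<le> 1"
  unfolding bgauss_def using assms by (intro mult_le_one gauss_le_1) (auto simp: gauss_def)

lemma bgauss_le_exp:
  assumes "b \<ge> 0" "t \<ge> 0"
  shows "bgauss b t x \<le> exp (- (b / (1 + b * t) * x\<^sup>2 / 2))"
  unfolding bgauss_def gauss_def using assms by (intro mult_left_le_one_le) auto

text \<open>With R = b / (1 + b t) both derivatives follow from R' = -R^2 and (ln (1 + b t))' = R.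
  At t = 0 the first one is the Bessel generator f''/2 + f'/x applied to
  \<open>gauss b\<close>.\<close>

lemma bgauss_has_derivative_time:
  assumes "b \<ge> 0" "t \<ge> 0"
  shows "((\<lambda>t. bgauss b t x) has_real_derivative
      bgauss b t x * (b / (1 + b * t) * (b / (1 + b * t) * x\<^sup>2 / 2 - 3 / 2))) (at t)"
    and "((\<lambda>t. bgauss b t x * (b / (1 + b * t) * (b / (1 + b * t) * x\<^sup>2 / 2 - 3 / 2)))
      has_real_derivative
      bgauss b t x * ((b / (1 + b * t))\<^sup>2 * ((b / (1 + b * t) * x\<^sup>2 / 2)\<^sup>2
        - 5 * (b / (1 + b * t) * x\<^sup>2 / 2) + 15 / 4))) (at t)"
proof -
  have pos: "1 + b * t > 0"
    using assms by (auto intro!: add_pos_nonneg)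
  define D where "D = 1 + b * t"
  have D: "D > 0" using pos by (simp add: D_def)
  have r: "((\<lambda>t. b / (1 + b * t)) has_real_derivative - (b / D)\<^sup>2) (at t)"
    using D unfolding D_def
    by (auto intro!: derivative_eq_intros simp: power2_eq_square)
  have l: "((\<lambda>t. ln (1 + b * t)) has_real_derivative b / D) (at t)"
    using D unfolding D_def
    by (auto intro!: derivative_eq_intros)
  define R where "R u = b / (1 + b * u)" for u
  define L where "L u = ln (1 + b * u)" for u
  define X where "X = x\<^sup>2 / 2"
  have bg: "bgauss b u x = exp (- (3 / 2 * L u)) * exp (- (R u * X))" for u
    by (simp add: bgauss_def gauss_def R_def L_def X_def)
  have RD: "R t = b / D" by (simp add: R_def D_def)
  note r = r[folded R_def, folded RD] and l = l[folded L_def, folded RD]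
  have 1: "((\<lambda>t. bgauss b t x) has_real_derivative
      bgauss b t x * (R t * (R t * X - 3 / 2))) (at t)"
    unfolding bg
    by (rule derivative_eq_intros l r refl)+ (simp add: algebra_simps power2_eq_square)
  then show "((\<lambda>t. bgauss b t x) has_real_derivative
      bgauss b t x * (b / (1 + b * t) * (b / (1 + b * t) * x\<^sup>2 / 2 - 3 / 2))) (at t)"
    by (simp add: R_def X_def)
  have "((\<lambda>t. bgauss b t x * (R t * (R t * X - 3 / 2))) has_real_derivative
      bgauss b t x * ((R t)\<^sup>2 * ((R t * X)\<^sup>2 - 5 * (R t * X) + 15 / 4))) (at t)"
    by (rule derivative_eq_intros 1 r refl)+ (simp add: algebra_simps power2_eq_square)
  then show "((\<lambda>t. bgauss b t x * (b / (1 + b * t) * (b / (1 + b * t) * x\<^sup>2 / 2 - 3 / 2)))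
      has_real_derivative
      bgauss b t x * ((b / (1 + b * t))\<^sup>2 * ((b / (1 + b * t) * x\<^sup>2 / 2)\<^sup>2
        - 5 * (b / (1 + b * t) * x\<^sup>2 / 2) + 15 / 4))) (at t)"
    by (simp add: R_def X_def)
qed

text \<open>Compensates the rounding of time to whole steps. With y = R x^2 / 2 the derivative is at
  most b (y + 3/2) exp (-y), and y exp (-y) <= 1 gives 5/2 = 1 + 3/2, uniformly in x.\<close>

lemma bgauss_lipschitz_time:
  assumes "b \<ge> 0" "s \<ge> 0" "t \<ge> 0"
  shows "\<bar>bgauss b t x - bgauss b s x\<bar> \<le> 5 / 2 * b * \<bar>t - s\<bar>"
proof -
  have bound: "\<bar>bgauss b u x * (b / (1 + b * u) * (b / (1 + b * u) * x\<^sup>2 / 2 - 3 / 2))\<bar> \<le> 5 / 2 * b"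
    if u: "u \<ge> 0" for u
  proof -
    define r where "r = b / (1 + b * u)"
    define y where "y = r * x\<^sup>2 / 2"
    have r: "0 \<le> r" "r \<le> b"
      using assms u divide_one_plus_le[of b u] by (auto simp: r_def)
    have y: "y \<ge> 0" using r by (simp add: y_def)
    have "bgauss b u x * \<bar>y - 3 / 2\<bar> \<le> bgauss b u x * (y + 3 / 2)"
      using y bgauss_nonneg[of b u x] by (intro mult_left_mono) auto
    also have "\<dots> \<le> exp (- y) * (y + 3 / 2)"
      using bgauss_le_exp[OF assms(1) u, of x] y by (intro mult_right_mono) (auto simp: y_def r_def)
    also have "\<dots> = y * exp (- y) + 3 / 2 * exp (- y)" by (simp add: algebra_simps)
    also have "\<dots> \<le> 1 + 3 / 2 * 1"
      using y mult_exp_minus_le_1[of y] by (intro add_mono mult_left_mono) auto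
    finally have "r * (bgauss b u x * \<bar>y - 3 / 2\<bar>) \<le> b * (5 / 2)"
      using r y bgauss_nonneg[of b u x] by (intro mult_mono) auto
    moreover have "\<bar>bgauss b u x * (r * (y - 3 / 2))\<bar> = r * (bgauss b u x * \<bar>y - 3 / 2\<bar>)"
      unfolding abs_mult using r bgauss_nonneg[of b u x] by simp
    ultimately show ?thesis
      unfolding r_def[symmetric] y_def[symmetric] by linarith
  qed
  define f' where "f' u = bgauss b u x * (b / (1 + b * u) * (b / (1 + b * u) * x\<^sup>2 / 2 - 3 / 2))" for u
  have "norm (bgauss b t x - bgauss b s x) \<le> 5 / 2 * b * norm (t - s)"
  proof (rule field_differentiable_bound[where S = "{0..}" and f = "\<lambda>u. bgauss b u x" and f' = f'])
    show "((\<lambda>t. bgauss b t x) has_field_derivative f' u) (at u within {0..})" if "u \<in> {0..}" for u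
      using has_field_derivative_at_within[OF bgauss_has_derivative_time(1)[OF assms(1), of u x]] that
      unfolding f'_def by blast
    show "norm (f' u) \<le> 5 / 2 * b" if "u \<in> {0..}" for u
      using bound[of u] that by (simp add: f'_def)
  qed (simp_all add: assms)
  then show ?thesis by (simp only: real_norm_def)
qed

text \<open>Second-order Taylor in time around the generator term. The second derivative is at most
  b^2 (y^2 + 5 y + 15/4) exp (-y) <= (2 + 5 + 15/4) b^2 <= 11 b^2.\<close>

lemma bgauss_taylor_time:
  assumes "b \<ge> 0" "t \<ge> 0"
  shows "\<bar>bgauss b t x - gauss b x - t * (gauss b x * (b * (b * x\<^sup>2 / 2 - 3 / 2)))\<bar> \<le> 11 / 2 * b\<^sup>2 * t\<^sup>2"
proof (cases "t = 0")
  case True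
  then show ?thesis by simp
next
  case False
  then have t: "t > 0" using assms by simp
  define diff where "diff m u = (if m = 0 then bgauss b u x
    else if m = 1 then bgauss b u x * (b / (1 + b * u) * (b / (1 + b * u) * x\<^sup>2 / 2 - 3 / 2))
    else bgauss b u x * ((b / (1 + b * u))\<^sup>2 * ((b / (1 + b * u) * x\<^sup>2 / 2)\<^sup>2
        - 5 * (b / (1 + b * u) * x\<^sup>2 / 2) + 15 / 4)))" for m :: nat and u
  have "\<exists>u. 0 < u \<and> u \<le> t \<and> bgauss b t x = (\<Sum>m<2. diff m 0 / fact m * t ^ m) + diff 2 u / fact 2 * t ^ 2"
  proof (rule Maclaurin2[OF t])
    show "diff 0 = (\<lambda>t. bgauss b t x)" by (simp add: diff_def fun_eq_iff)
    show "\<forall>m u. m < 2 \<and> 0 \<le> u \<and> u \<le> t \<longrightarrow> (diff m has_real_derivative diff (Suc m) u) (at u)"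
    proof (intro allI impI)
      fix m :: nat and u assume "m < 2 \<and> 0 \<le> u \<and> u \<le> t"
      then consider "m = 0" "u \<ge> 0" | "m = 1" "u \<ge> 0" by linarith
      then show "(diff m has_real_derivative diff (Suc m) u) (at u)"
        by cases (use bgauss_has_derivative_time[OF assms(1)] in \<open>simp_all add: diff_def[abs_def]\<close>)
    qed
  qed
  then obtain u where u: "0 < u" "bgauss b t x = (\<Sum>m<2. diff m 0 / fact m * t ^ m) + diff 2 u / fact 2 * t ^ 2"
    by blast
  have eq: "bgauss b t x - gauss b x - t * (gauss b x * (b * (b * x\<^sup>2 / 2 - 3 / 2))) = diff 2 u / 2 * t\<^sup>2"
    using u(2) by (simp add: diff_def lessThan_nat_numeral lessThan_Suc numeral_2_eq_2)
  have "\<bar>diff 2 u\<bar> \<le> 11 * b\<^sup>2"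
  proof -
    define r where "r = b / (1 + b * u)"
    define y where "y = r * x\<^sup>2 / 2"
    have r: "0 \<le> r" "r \<le> b"
      using assms u divide_one_plus_le[of b u] by (auto simp: r_def)
    have y: "y \<ge> 0" using r by (simp add: y_def)
    have "bgauss b u x * \<bar>y\<^sup>2 - 5 * y + 15 / 4\<bar> \<le> bgauss b u x * (y\<^sup>2 + 5 * y + 15 / 4)"
      using y bgauss_nonneg[of b u x] by (intro mult_left_mono) (auto simp: abs_if)
    also have "\<dots> \<le> exp (- y) * (y\<^sup>2 + 5 * y + 15 / 4)"
      using bgauss_le_exp[OF assms(1), of u x] u y by (intro mult_right_mono) (auto simp: y_def r_def)
    also have "\<dots> = y\<^sup>2 * exp (- y) + 5 * (y * exp (- y)) + 15 / 4 * exp (- y)" by (simp add: algebra_simps)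
    also have "\<dots> \<le> 2 + 5 * 1 + 15 / 4 * 1"
      using y mult_exp_minus_le_1[of y] square_mult_exp_minus_le_2[of y]
      by (intro add_mono mult_left_mono) auto
    finally have "r\<^sup>2 * (bgauss b u x * \<bar>y\<^sup>2 - 5 * y + 15 / 4\<bar>) \<le> b\<^sup>2 * 11"
      using r y bgauss_nonneg[of b u x] by (intro mult_mono power_mono) auto
    moreover have "\<bar>bgauss b u x * (r\<^sup>2 * (y\<^sup>2 - 5 * y + 15 / 4))\<bar>
        = r\<^sup>2 * (bgauss b u x * \<bar>y\<^sup>2 - 5 * y + 15 / 4\<bar>)"
      unfolding abs_mult using r bgauss_nonneg[of b u x] by simp
    moreover have "diff 2 u = bgauss b u x * (r\<^sup>2 * (y\<^sup>2 - 5 * y + 15 / 4))"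
      by (simp add: diff_def r_def y_def)
    ultimately show ?thesis
      by (metis mult.commute)
  qed
  then have "\<bar>diff 2 u / 2 * t\<^sup>2\<bar> \<le> 11 * b\<^sup>2 / 2 * t\<^sup>2"
    unfolding abs_mult by (intro mult_mono) auto
  then show ?thesis unfolding eq by simp
qed

section \<open>Taylor expansion in space and comparison of a single step\<close>

definition taylor_const :: "real \<Rightarrow> real" where
  "taylor_const B = 3 * B\<^sup>2 + 14 * B + B ^ 3"

text \<open>The bound is uniform in x because the Gaussian absorbs the polynomial in the third
  derivative. It is stated for all b <= B since peeling off steps keeps lowering b.\<close>

lemma gauss_taylor:
  assumes "b \<ge> 0" "b \<le> B"
  shows "\<bar>gauss b (x + h) - gauss b x + h * (b * x * gauss b x) - h\<^sup>2 / 2 * ((b\<^sup>2 * x\<^sup>2 - b) * gauss b x)\<bar>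
    \<le> taylor_const B * \<bar>h\<bar> ^ 3"
proof -
  define diff where "diff m u = gauss b (x + u) * (if m = 0 then 1 else if m = 1 then - (b * (x + u))
    else if m = 2 then b\<^sup>2 * (x + u)\<^sup>2 - b else 3 * b\<^sup>2 * (x + u) - b ^ 3 * (x + u) ^ 3)"
    for m :: nat and u
  have g: "((\<lambda>u. gauss b (x + u)) has_real_derivative gauss b (x + u) * (- (b * (x + u)))) (at u)" for u
    unfolding gauss_def by (auto intro!: derivative_eq_intros simp: algebra_simps)
  have "\<exists>u. \<bar>u\<bar> \<le> \<bar>h\<bar> \<and> gauss b (x + h) = (\<Sum>m<3. diff m 0 / fact m * h ^ m) + diff 3 u / fact 3 * h ^ 3"
  proof (rule Maclaurin_bi_le)
    show "diff 0 = (\<lambda>u. gauss b (x + u))" by (simp add: diff_def fun_eq_iff)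
    show "\<forall>m u. m < 3 \<and> \<bar>u\<bar> \<le> \<bar>h\<bar> \<longrightarrow> (diff m has_real_derivative diff (Suc m) u) (at u)"
    proof (intro allI impI)
      fix m :: nat and u assume "m < 3 \<and> \<bar>u\<bar> \<le> \<bar>h\<bar>"
      then consider "m = 0" | "m = 1" | "m = 2" by linarith
      then show "(diff m has_real_derivative diff (Suc m) u) (at u)"
      proof cases
        case 1
        then show ?thesis using g by (simp add: diff_def[abs_def])
      next
        case 2
        have "((\<lambda>u. gauss b (x + u) * - (b * (x + u))) has_real_derivative
            gauss b (x + u) * (b\<^sup>2 * (x + u)\<^sup>2 - b)) (at u)"
          by (rule derivative_eq_intros g refl)+ (simp add: algebra_simps power2_eq_square)
        with 2 show ?thesis by (simp add: diff_def[abs_def])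
      next
        case 3
        have "((\<lambda>u. gauss b (x + u) * (b\<^sup>2 * (x + u)\<^sup>2 - b)) has_real_derivative
            gauss b (x + u) * (3 * b\<^sup>2 * (x + u) - b ^ 3 * (x + u) ^ 3)) (at u)"
          by (rule derivative_eq_intros g refl)+ (simp add: algebra_simps power2_eq_square power3_eq_cube)
        with 3 show ?thesis by (simp add: diff_def[abs_def])
      qed
    qed
  qed
  then obtain u where u: "gauss b (x + h) = (\<Sum>m<3. diff m 0 / fact m * h ^ m) + diff 3 u / fact 3 * h ^ 3"
    by blast
  have eq: "gauss b (x + h) - gauss b x + h * (b * x * gauss b x) - h\<^sup>2 / 2 * ((b\<^sup>2 * x\<^sup>2 - b) * gauss b x)
      = diff 3 u / 6 * h ^ 3"
    using u by (simp add: diff_def lessThan_nat_numeral lessThan_Suc numeral_3_eq_3 fact_numeral power2_eq_square)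
  define z where "z = x + u"
  define y where "y = b * z\<^sup>2 / 2"
  have y: "y \<ge> 0" "gauss b z = exp (- y)" using assms by (auto simp: y_def gauss_def)
  have z1: "\<bar>z\<bar> \<le> 1 + z\<^sup>2"
    using zero_le_power2[of "\<bar>z\<bar> - 1 / 2"] by (simp add: power2_eq_square algebra_simps)
  have z3: "\<bar>z\<bar> ^ 3 \<le> 1 + z ^ 4"
  proof (cases "\<bar>z\<bar> \<le> 1")
    case True
    then have "\<bar>z\<bar> ^ 3 \<le> 1" by (simp add: power_le_one)
    then show ?thesis by (simp add: add_increasing2)
  next
    case False
    then have "\<bar>z\<bar> ^ 3 \<le> \<bar>z\<bar> ^ 4" by (intro power_increasing) auto
    then show ?thesis by simp
  qed
  have "\<bar>diff 3 u\<bar> \<le> gauss b z * (3 * b\<^sup>2 * \<bar>z\<bar> + b ^ 3 * \<bar>z\<bar> ^ 3)"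
  proof -
    have "\<bar>3 * b\<^sup>2 * z - b ^ 3 * z ^ 3\<bar> \<le> \<bar>3 * b\<^sup>2 * z\<bar> + \<bar>b ^ 3 * z ^ 3\<bar>"
      by (rule abs_triangle_ineq4)
    then have "\<bar>3 * b\<^sup>2 * z - b ^ 3 * z ^ 3\<bar> \<le> 3 * b\<^sup>2 * \<bar>z\<bar> + b ^ 3 * \<bar>z\<bar> ^ 3"
      using assms by (simp add: abs_mult power_abs)
    then show ?thesis
      using gauss_pos[of b z] by (simp add: diff_def z_def[symmetric] abs_mult)
  qed
  also have "\<dots> \<le> gauss b z * (3 * b\<^sup>2 * (1 + z\<^sup>2) + b ^ 3 * (1 + z ^ 4))"
    using assms z1 z3 gauss_pos[of b z] by (intro mult_left_mono add_mono) auto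
  \<comment> \<open>With y = b z^2 / 2 one has b^2 z^2 = 2 b y and b^3 z^4 = 4 b y^2. The bounds 1
    and 2 for y exp (-y) and y^2 exp (-y) then give 6 b + 8 b, the 14 of
    \<open>taylor_const\<close>.\<close>
  also have "\<dots> = 3 * b\<^sup>2 * exp (- y) + 6 * b * (y * exp (- y)) + b ^ 3 * exp (- y) + 4 * b * (y\<^sup>2 * exp (- y))"
    unfolding y(2) by (simp add: y_def algebra_simps eval_nat_numeral)
  also have "\<dots> \<le> 3 * b\<^sup>2 * 1 + 6 * b * 1 + b ^ 3 * 1 + 4 * b * 2"
    using assms y mult_exp_minus_le_1[of y] square_mult_exp_minus_le_2[of y]
    by (intro add_mono mult_left_mono) auto
  also have "\<dots> \<le> 3 * B\<^sup>2 * 1 + 6 * B * 1 + B ^ 3 * 1 + 4 * B * 2"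
    using assms by (intro add_mono mult_mono power_mono) auto
  also have "\<dots> = taylor_const B" by (simp add: taylor_const_def)
  finally have d: "\<bar>diff 3 u\<bar> \<le> taylor_const B" .
  have "\<bar>diff 3 u / 6 * h ^ 3\<bar> = \<bar>diff 3 u\<bar> / 6 * \<bar>h\<bar> ^ 3"
    by (simp add: abs_mult power_abs)
  also have "\<dots> \<le> taylor_const B * \<bar>h\<bar> ^ 3"
    using d by (intro mult_right_mono) auto
  finally show ?thesis unfolding eq .
qed

text \<open>Covers the cubic Taylor remainders and the second-order time remainder,
  \<open>taylor_const B + 6 * B\<^sup>2\<close>, as well as the factor 2 B of the drift and variance
  mismatches.\<close>

definition step_const :: "real \<Rightarrow> real" where
  "step_const B = taylor_const B + 6 * B\<^sup>2 + 2 * B"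

lemma taylor_const_nonneg: "B \<ge> 0 \<Longrightarrow> taylor_const B \<ge> 0"
  by (simp add: taylor_const_def)

lemma step_const_nonneg: "B \<ge> 0 \<Longrightarrow> step_const B \<ge> 0"
  by (simp add: step_const_def taylor_const_nonneg)

text \<open>At x = h n the first-order term h (p - p') f'(x) equals h^2 n (p - p') f'(x) / x. So the
  h^2 terms agree with \<open>\<tau>\<close> (f''/2 + f'/x) exactly when n (p - p') and p + p' both
  equal \<open>\<tau>\<close>; the two mismatches and the cubic remainder make up the bound. The
  position n is real, so n - 1 keeps its meaning at n = 0.\<close>

lemma gauss_one_step:
  fixes n :: real
  assumes b: "0 \<le> b" "b \<le> B" and h: "0 < h" "h \<le> 1" and \<tau>: "0 \<le> \<tau>" "\<tau> \<le> 1"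
    and p: "0 \<le> p" "0 \<le> p'" "p + p' \<le> 1"
  shows "\<bar>p * gauss b (h * (n + 1)) + (1 - p - p') * gauss b (h * n) + p' * gauss b (h * (n - 1))
        - bgauss b (\<tau> * h\<^sup>2) (h * n)\<bar>
    \<le> h\<^sup>2 * (step_const B * (\<bar>n * (p - p') - \<tau>\<bar> + \<bar>p + p' - \<tau>\<bar> + h))"
proof -
  define x where "x = h * n"
  define g where "g = gauss b x"
  define T where "T = taylor_const B"
  have g: "0 < g" "g \<le> 1" using b gauss_le_1 gauss_pos by (auto simp: g_def)
  have T: "T \<ge> 0" using b by (auto simp: T_def intro: taylor_const_nonneg)
  have B: "B \<ge> 0" using b by simp
  define E1 where "E1 = gauss b (x + h) - g + h * (b * x * g) - h\<^sup>2 / 2 * ((b\<^sup>2 * x\<^sup>2 - b) * g)"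
  define E2 where "E2 = gauss b (x - h) - g - h * (b * x * g) - h\<^sup>2 / 2 * ((b\<^sup>2 * x\<^sup>2 - b) * g)"
  define E3 where "E3 = bgauss b (\<tau> * h\<^sup>2) x - g - \<tau> * h\<^sup>2 * (g * (b * (b * x\<^sup>2 / 2 - 3 / 2)))"
  have E1: "\<bar>E1\<bar> \<le> T * h ^ 3"
    using gauss_taylor[OF b, of x h] h by (simp add: E1_def g_def T_def)
  have E2: "\<bar>E2\<bar> \<le> T * h ^ 3"
    using gauss_taylor[OF b, of x "- h"] h by (simp add: E2_def g_def T_def)
  have E3: "\<bar>E3\<bar> \<le> 6 * B\<^sup>2 * h ^ 3"
  proof -
    have "\<bar>E3\<bar> \<le> 11 / 2 * b\<^sup>2 * (\<tau> * h\<^sup>2)\<^sup>2"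
      using bgauss_taylor_time[OF b(1), of "\<tau> * h\<^sup>2" x] \<tau> by (simp add: E3_def g_def)
    also have "\<dots> \<le> 6 * B\<^sup>2 * (1 * h ^ 3)"
    proof (intro mult_mono power_mono)
      have "\<tau>\<^sup>2 * h ^ 4 \<le> 1 * h ^ 3"
        using \<tau> h by (intro mult_mono power_le_one power_decreasing) auto
      then show "(\<tau> * h\<^sup>2)\<^sup>2 \<le> 1 * h ^ 3"
        by (simp add: power_mult_distrib flip: power_mult)
    qed (use b \<tau> h in auto)
    finally show ?thesis by simp
  qed
  \<comment> \<open>Substituting the expansions, V = (b^2 x^2 - b) g is f'' and W = b g is -f'/x, so
    the generator term is V/2 - W; what survives are the remainders and the two mismatches.\<close>
  have key: "p * gauss b (h * (n + 1)) + (1 - p - p') * gauss b (h * n) + p' * gauss b (h * (n - 1))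
        - bgauss b (\<tau> * h\<^sup>2) (h * n)
      = p * E1 + p' * E2 - E3 - h\<^sup>2 * (b * g * (n * (p - p') - \<tau>))
        + h\<^sup>2 * (((b\<^sup>2 * x\<^sup>2 - b) * g) / 2 * (p + p' - \<tau>))"
  proof -
    have xs: "h * (n + 1) = x + h" "h * (n - 1) = x - h" "h * n = x"
      by (simp_all add: x_def algebra_simps)
    have "h * (b * x * g) = h\<^sup>2 * (b * g * n)" by (simp add: x_def power2_eq_square)
    then have gs: "gauss b (x + h) = E1 + g - h\<^sup>2 * (b * g * n) + h\<^sup>2 / 2 * ((b\<^sup>2 * x\<^sup>2 - b) * g)"
      "gauss b (x - h) = E2 + g + h\<^sup>2 * (b * g * n) + h\<^sup>2 / 2 * ((b\<^sup>2 * x\<^sup>2 - b) * g)"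
      "gauss b x = g"
      by (simp_all only: E1_def E2_def g_def)
    have "g * (b * (b * x\<^sup>2 / 2 - 3 / 2)) = ((b\<^sup>2 * x\<^sup>2 - b) * g) / 2 - b * g"
      by (simp add: algebra_simps power2_eq_square)
    then have bg: "bgauss b (\<tau> * h\<^sup>2) x = E3 + g + \<tau> * h\<^sup>2 * (((b\<^sup>2 * x\<^sup>2 - b) * g) / 2 - b * g)"
      by (simp add: E3_def)
    have "p * (E1 + g - H * (W * n) + H / 2 * V) + (1 - p - p') * g + p' * (E2 + g + H * (W * n) + H / 2 * V)
        - (E3 + g + \<tau> * H * (V / 2 - W))
      = p * E1 + p' * E2 - E3 - H * (W * (n * (p - p') - \<tau>)) + H * (V / 2 * (p + p' - \<tau>))" for H V W
      by (simp add: field_simps)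
    then show ?thesis
      unfolding xs gs bg by blast
  qed
  have "\<bar>(b\<^sup>2 * x\<^sup>2 - b) * g\<bar> \<le> 3 * B"
  proof -
    define y where "y = b * x\<^sup>2 / 2"
    have y: "y \<ge> 0" "g = exp (- y)" using b by (simp_all add: y_def g_def gauss_def)
    have "(b\<^sup>2 * x\<^sup>2 - b) * g = b * (2 * (y * exp (- y)) - exp (- y))"
      unfolding y(2) by (simp add: y_def algebra_simps power2_eq_square)
    moreover have "\<bar>2 * (y * exp (- y)) - exp (- y)\<bar> \<le> 3"
    proof -
      have "exp (- y) \<le> 1" "exp (- y) > 0" "y * exp (- y) \<ge> 0" using y by auto
      then show ?thesis using mult_exp_minus_le_1[of y] by linarith
    qed
    ultimately have "\<bar>(b\<^sup>2 * x\<^sup>2 - b) * g\<bar> = b * \<bar>2 * (y * exp (- y)) - exp (- y)\<bar>"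
      using b by (simp add: abs_mult)
    also have "\<dots> \<le> B * 3"
      using b \<open>\<bar>2 * (y * exp (- y)) - exp (- y)\<bar> \<le> 3\<close> by (intro mult_mono) auto
    finally show ?thesis by simp
  qed
  then have t4: "\<bar>h\<^sup>2 * (((b\<^sup>2 * x\<^sup>2 - b) * g) / 2 * (p + p' - \<tau>))\<bar> \<le> h\<^sup>2 * (2 * B * \<bar>p + p' - \<tau>\<bar>)"
    unfolding abs_mult using B by (intro mult_mono) (auto simp: abs_mult)
  have "b * g \<le> B * 1" using b g B by (intro mult_mono) auto
  then have t3: "\<bar>h\<^sup>2 * (b * g * (n * (p - p') - \<tau>))\<bar> \<le> h\<^sup>2 * (2 * B * \<bar>n * (p - p') - \<tau>\<bar>)"
    using b g by (subst abs_mult, subst abs_mult[of "b * g"], intro mult_mono) auto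
  have t12: "\<bar>p * E1 + p' * E2\<bar> \<le> T * h ^ 3"
  proof -
    have "\<bar>p * E1 + p' * E2\<bar> \<le> p * \<bar>E1\<bar> + p' * \<bar>E2\<bar>"
      using abs_triangle_ineq[of "p * E1" "p' * E2"] p by (simp add: abs_mult)
    also have "\<dots> \<le> p * (T * h ^ 3) + p' * (T * h ^ 3)"
      using E1 E2 p by (intro add_mono mult_left_mono) auto
    also have "\<dots> = (p + p') * (T * h ^ 3)" by (simp add: algebra_simps)
    also have "\<dots> \<le> 1 * (T * h ^ 3)"
      using p T h by (intro mult_right_mono) auto
    finally show ?thesis by simp
  qed
  define F1 where "F1 = \<bar>n * (p - p') - \<tau>\<bar>"
  define F2 where "F2 = \<bar>p + p' - \<tau>\<bar>"
  have tri: "\<bar>A - C - D + E\<bar> \<le> A' + C' + D' + E'"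
    if "\<bar>A\<bar> \<le> A'" "\<bar>C\<bar> \<le> C'" "\<bar>D\<bar> \<le> D'" "\<bar>E\<bar> \<le> E'" for A C D E A' C' D' E' :: real
    using that by linarith
  have "\<bar>p * E1 + p' * E2 - E3 - h\<^sup>2 * (b * g * (n * (p - p') - \<tau>))
        + h\<^sup>2 * (((b\<^sup>2 * x\<^sup>2 - b) * g) / 2 * (p + p' - \<tau>))\<bar>
     \<le> T * h ^ 3 + 6 * B\<^sup>2 * h ^ 3 + h\<^sup>2 * (2 * B * F1) + h\<^sup>2 * (2 * B * F2)"
    unfolding F1_def F2_def using t12 E3 t3 t4 by (rule tri)
  also have "\<dots> = h\<^sup>2 * ((T + 6 * B\<^sup>2) * h + 2 * B * F1 + 2 * B * F2)"
    by (simp add: algebra_simps power2_eq_square power3_eq_cube)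
  also have "\<dots> \<le> h\<^sup>2 * (step_const B * h + step_const B * F1 + step_const B * F2)"
  proof -
    have "T + 6 * B\<^sup>2 \<le> step_const B" "2 * B \<le> step_const B"
      using T B by (auto simp: step_const_def T_def)
    then show ?thesis
      using h by (intro mult_left_mono add_mono mult_right_mono) (auto simp: F1_def F2_def)
  qed
  also have "\<dots> = h\<^sup>2 * (step_const B * (F1 + F2 + h))"
    by (simp add: algebra_simps)
  finally show ?thesis
    unfolding key F1_def F2_def .
qed

section \<open>The Bessel process on Gaussian test functions\<close>

lemma exp_three_halves_ln:
  assumes "(D::real) > 0"
  shows "exp (- (3 / 2 * ln D)) = 1 / (D * sqrt D)"
proof -
  have "exp (3 / 2 * ln D) = exp (ln D) * exp (ln D / 2)"
    by (simp flip: exp_add)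
  also have "exp (ln D / 2) = sqrt D"
    using assms by (simp add: ln_sqrt[symmetric])
  finally show ?thesis
    using assms by (simp add: exp_minus inverse_eq_divide)
qed

text \<open>Completing the square turns the product of the two exponentials into a normal density of
  mean m = x / D and variance v = t / D, with D = 1 + b t. The exponent 3/2 splits into 1/2 from the
  change of normalization and 1 from the mean, m / x = 1 / D.\<close>

lemma has_bochner_integral_gauss_normal:
  fixes x t b :: real
  assumes x: "x > 0" and t: "t > 0" and b: "b \<ge> 0"
  shows "has_bochner_integral lborel
    (\<lambda>y. y / x * (1 / sqrt (2 * pi * t) * exp (- ((y - x)\<^sup>2 / (2 * t)))) * gauss b y) (bgauss b t x)"
proof -
  define D where "D = 1 + b * t"
  have D: "D > 0" using b t by (auto simp: D_def intro!: add_pos_nonneg)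
  define m where "m = x / D"
  define v where "v = t / D"
  have v: "v > 0" using t D by (simp add: v_def)
  define E where "E = exp (- (b / D * x\<^sup>2 / 2)) / (x * sqrt D)"
  have expeq: "exp (- ((y - x)\<^sup>2 / (2 * t))) * gauss b y
      = exp (- ((y - m)\<^sup>2 / (2 * v))) * exp (- (b / D * x\<^sup>2 / 2))" for y
  proof -
    have "(y - x)\<^sup>2 + b * t * y\<^sup>2 = D * (y - m)\<^sup>2 + b * t / D * x\<^sup>2"
    proof -
      have "D * (y - m)\<^sup>2 = D * y\<^sup>2 - 2 * x * y + x\<^sup>2 / D"
        using D by (simp add: m_def power2_eq_square field_simps)
      moreover have "x\<^sup>2 / D + b * t / D * x\<^sup>2 = x\<^sup>2"
      proof -
        have "x\<^sup>2 / D + b * t / D * x\<^sup>2 = D * x\<^sup>2 / D"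
          by (simp add: D_def add_divide_distrib distrib_right)
        then show ?thesis using D by simp
      qed
      ultimately show ?thesis
        by (simp add: D_def power2_eq_square algebra_simps)
    qed
    then have "((y - x)\<^sup>2 + b * t * y\<^sup>2) / (2 * t) = (D * (y - m)\<^sup>2 + b * t / D * x\<^sup>2) / (2 * t)"
      by simp
    then have "(y - x)\<^sup>2 / (2 * t) + b * y\<^sup>2 / 2 = (y - m)\<^sup>2 / (2 * v) + b / D * x\<^sup>2 / 2"
      using t D by (simp add: v_def add_divide_distrib mult.commute mult.left_commute)
    then have "- ((y - x)\<^sup>2 / (2 * t)) + - (b * y\<^sup>2 / 2) = - ((y - m)\<^sup>2 / (2 * v)) + - (b / D * x\<^sup>2 / 2)"
      by linarith
    then show ?thesis
      unfolding gauss_def by (simp only: exp_add[symmetric])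
  qed
  have sq: "1 / sqrt (2 * pi * t) = 1 / sqrt (2 * pi * v) * (1 / sqrt D)"
  proof -
    have "2 * pi * t = 2 * pi * v * D" using D by (simp add: v_def)
    then show ?thesis by (simp add: real_sqrt_mult)
  qed
  \<comment> \<open>Writing y = (y - m) + m separates the vanishing first central moment from m
    times the total mass; \<open>2 * 0 + 1\<close> is the exponent in the form of the library's odd
    moments.\<close>
  have F: "y / x * (1 / sqrt (2 * pi * t) * exp (- ((y - x)\<^sup>2 / (2 * t)))) * gauss b y
      = E * (normal_density m (sqrt v) y * (y - m) ^ (2 * 0 + 1) + m * normal_density m (sqrt v) y)" for y
  proof -
    have nd: "normal_density m (sqrt v) y = 1 / sqrt (2 * pi * v) * exp (- ((y - m)\<^sup>2 / (2 * v)))"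
      using v by (simp add: normal_density_def)
    have "y / x * (1 / sqrt (2 * pi * t) * exp (- ((y - x)\<^sup>2 / (2 * t)))) * gauss b y
      = y / x * (1 / sqrt (2 * pi * t)) * (exp (- ((y - x)\<^sup>2 / (2 * t))) * gauss b y)"
      by simp
    also have "\<dots> = E * y * normal_density m (sqrt v) y"
      unfolding expeq sq nd E_def by (simp add: mult_ac)
    finally show ?thesis by (simp add: algebra_simps)
  qed
  have "has_bochner_integral lborel (\<lambda>y. normal_density m (sqrt v) y * (y - m) ^ (2 * 0 + 1)) 0"
    using normal_moment_odd[of "sqrt v" m 0] v by simp
  moreover have "has_bochner_integral lborel (normal_density m (sqrt v)) 1"
    using integrable_normal_density[of "sqrt v" m] integral_normal_density[of "sqrt v" m] v
    by (simp add: has_bochner_integral_iff)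
  ultimately have "has_bochner_integral lborel (\<lambda>y. E * (normal_density m (sqrt v) y * (y - m) ^ (2 * 0 + 1)
      + m * normal_density m (sqrt v) y)) (E * (0 + m * 1))"
    by (intro has_bochner_integral_mult_right has_bochner_integral_add)
  moreover have "E * (0 + m * 1) = bgauss b t x"
    unfolding bgauss_def D_def[symmetric] exp_three_halves_ln[OF D]
    using x D by (simp add: E_def m_def gauss_def)
  ultimately show ?thesis unfolding F by simp
qed

text \<open>Folding the negative half-line onto the positive one; this is how the reflected term of
  the killed kernel is absorbed.\<close>

lemma integral_halfline_fold:
  fixes F :: "real \<Rightarrow> real"
  assumes F: "has_bochner_integral lborel F I"
  shows "has_bochner_integral lborel (\<lambda>y. (F y + F (- y)) * indicator {0<..} y) I"
proof -
  have i: "integrable lborel F" "integral\<^sup>L lborel F = I" using F by (auto simp: has_bochner_integral_iff)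
  have i1: "integrable lborel (\<lambda>y. F y * indicator {0<..} y)" "integrable lborel (\<lambda>y. F y * indicator {..<0} y)"
    by (auto intro: integrable_real_mult_indicator[OF _ i(1)])
  have "has_bochner_integral lborel (\<lambda>y. F y * indicator {..<0} y) (integral\<^sup>L lborel (\<lambda>y. F y * indicator {..<0} y))"
    using i1(2) by (simp add: has_bochner_integral_iff)
  then have "has_bochner_integral lborel (\<lambda>y. F (0 + (-1) * y) * indicator {..<0} (0 + (-1) * y))
      (integral\<^sup>L lborel (\<lambda>y. F y * indicator {..<0} y) /\<^sub>R \<bar>- 1\<bar>)"
    by (subst (asm) lborel_has_bochner_integral_real_affine_iff[of "-1" _ _ 0]) auto
  then have neg: "has_bochner_integral lborel (\<lambda>y. F (- y) * indicator {0<..} y)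
      (integral\<^sup>L lborel (\<lambda>y. F y * indicator {..<0} y))"
    by (simp add: indicator_def)
  have "integral\<^sup>L lborel (\<lambda>y. F y * indicator {0<..} y) + integral\<^sup>L lborel (\<lambda>y. F y * indicator {..<0} y)
      = integral\<^sup>L lborel (\<lambda>y. F y * indicator {0<..} y + F y * indicator {..<0} y)"
    using i1 by simp
  also have "\<dots> = integral\<^sup>L lborel F"
  proof (rule integral_cong_AE)
    show "AE y in lborel. F y * indicator {0<..} y + F y * indicator {..<0} y = F y"
      using AE_lborel_singleton[of 0] by eventually_elim (auto simp: indicator_def)
  qed (use i1 i(1) in auto)
  finally have eq: "integral\<^sup>L lborel (\<lambda>y. F y * indicator {0<..} y)
      + integral\<^sup>L lborel (\<lambda>y. F y * indicator {..<0} y) = I" using i by simp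
  have "has_bochner_integral lborel (\<lambda>y. F y * indicator {0<..} y + F (- y) * indicator {0<..} y) I"
    using has_bochner_integral_add[OF _ neg, of "\<lambda>y. F y * indicator {0<..} y"
        "integral\<^sup>L lborel (\<lambda>y. F y * indicator {0<..} y)"] i1(1)
    unfolding eq by (simp add: has_bochner_integral_iff)
  then show ?thesis by (simp add: distrib_right)
qed

lemma killed_bm_kernel_nonneg:
  assumes "x > 0" "y > 0" "t > 0"
  shows "killed_bm_kernel t x y \<ge> 0"
proof -
  have "(y - x)\<^sup>2 \<le> (y + x)\<^sup>2"
    using mult_pos_pos[OF assms(1,2)] by (simp add: power2_eq_square algebra_simps)
  then have "(y - x)\<^sup>2 / (2 * t) \<le> (y + x)\<^sup>2 / (2 * t)"
    using assms by (intro divide_right_mono) auto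
  then show ?thesis
    using assms by (simp add: killed_bm_kernel_def)
qed

text \<open>Method of images: under y -> -y the factor y / x changes sign while
  \<open>gauss b\<close> does not, so F(y) + F(-y) is the killed kernel times y / x. The half-line
  integral becomes the whole-line one against the free Gaussian kernel.\<close>

lemma nn_integral_bessel_gauss:
  assumes x: "x > 0" and t: "t > 0" and b: "b \<ge> 0"
  shows "(\<integral>\<^sup>+ y. ennreal (y / x * killed_bm_kernel t x y) * indicator {0<..} y * ennreal (gauss b y) \<partial>lborel)
    = ennreal (bgauss b t x)"
proof -
  define F where "F y = y / x * (1 / sqrt (2 * pi * t) * exp (- ((y - x)\<^sup>2 / (2 * t)))) * gauss b y" for y
  have h: "has_bochner_integral lborel (\<lambda>y. (F y + F (- y)) * indicator {0<..} y) (bgauss b t x)"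
    unfolding F_def by (rule integral_halfline_fold[OF has_bochner_integral_gauss_normal[OF assms]])
  have FF: "F y + F (- y) = y / x * killed_bm_kernel t x y * gauss b y" for y
  proof -
    have "(- y - x)\<^sup>2 = (y + x)\<^sup>2" by (simp add: power2_eq_square algebra_simps)
    moreover have "gauss b (- y) = gauss b y" by (simp add: gauss_def)
    ultimately show ?thesis
      by (simp add: F_def killed_bm_kernel_def algebra_simps diff_divide_distrib)
  qed
  have nn: "(F y + F (- y)) * indicator {0<..} y \<ge> 0" for y
    unfolding FF using x t killed_bm_kernel_nonneg[of x y t] gauss_pos[of b y]
    by (auto simp: indicator_def)
  have "(\<integral>\<^sup>+ y. ennreal ((F y + F (- y)) * indicator {0<..} y) \<partial>lborel) = ennreal (bgauss b t x)"
    using h nn by (subst nn_integral_eq_integral) (auto simp: has_bochner_integral_iff)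
  also have "(\<integral>\<^sup>+ y. ennreal ((F y + F (- y)) * indicator {0<..} y) \<partial>lborel)
    = (\<integral>\<^sup>+ y. ennreal (y / x * killed_bm_kernel t x y) * indicator {0<..} y * ennreal (gauss b y) \<partial>lborel)"
  proof (rule nn_integral_cong)
    fix y
    show "ennreal ((F y + F (- y)) * indicator {0<..} y)
      = ennreal (y / x * killed_bm_kernel t x y) * indicator {0<..} y * ennreal (gauss b y)"
      unfolding FF using gauss_pos[of b y]
      by (cases "y > 0") (simp_all add: ennreal_mult''[symmetric] less_imp_le)
  qed
  finally show ?thesis .
qed

lemma killed_bm_kernel_measurable [measurable]:
  "(\<lambda>z. killed_bm_kernel t (fst z) (snd z)) \<in> borel_measurable (borel \<Otimes>\<^sub>M borel)"
  unfolding killed_bm_kernel_def by measurable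

section \<open>The past of the process and its Markov property\<close>

lemma subalgebra_past:
  assumes "\<And>u. u \<ge> 0 \<Longrightarrow> \<xi> u \<in> borel_measurable M"
  shows "subalgebra M (past M \<xi> s)"
proof -
  let ?G = "{\<xi> u -` A \<inter> space M | u A. 0 \<le> u \<and> u \<le> s \<and> A \<in> sets borel}"
  have "?G \<subseteq> sets M"
    using assms by (auto intro: measurable_sets)
  then have "sigma_sets (space M) ?G \<subseteq> sets M"
    by (rule sets.sigma_sets_subset)
  moreover have "?G \<subseteq> Pow (space M)" by auto
  ultimately show ?thesis
    unfolding subalgebra_def past_def by (simp add: space_measure_of_conv sets_measure_of)
qed

lemma measurable_past:
  assumes "0 \<le> u" "u \<le> s"
  shows "\<xi> u \<in> borel_measurable (past M \<xi> s)"
proof (rule measurableI)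
  let ?G = "{\<xi> u -` A \<inter> space M | u A. 0 \<le> u \<and> u \<le> s \<and> A \<in> sets borel}"
  have G: "?G \<subseteq> Pow (space M)" by auto
  fix A :: "real set" assume "A \<in> sets borel"
  then have "\<xi> u -` A \<inter> space M \<in> ?G" using assms by blast
  then show "\<xi> u -` A \<inter> space (past M \<xi> s) \<in> sets (past M \<xi> s)"
    unfolding past_def by (simp add: space_measure_of_conv sets_measure_of[OF G] sigma_sets.Basic)
qed auto

locale bessel_process =
  fixes M :: "'b measure" and \<xi> :: "real \<Rightarrow> 'b \<Rightarrow> real" and c \<sigma> :: real
  assumes markov: "markov_process M \<xi> (bessel_init c) (bessel_trans \<sigma>)"
    and sigma_pos: "0 < \<sigma>"
begin

sublocale prob_space M
  using markov by (simp add: markov_process_def)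

lemma xi_measurable: "s \<ge> 0 \<Longrightarrow> \<xi> s \<in> borel_measurable M"
  using markov by (simp add: markov_process_def)

lemma distr_xi_0: "distr M borel (\<xi> 0) = bessel_init c"
  using markov by (simp add: markov_process_def)

text \<open>The almost sure identity for conditional expectations, tested against a bounded variable
  Z of the past. It is put in terms of \<open>nn_integral\<close> so that it can be read as an
  equality of measures in A.\<close>

lemma nn_integral_indicator_future:
  assumes s: "s \<ge> 0" and t: "t > 0" and A: "A \<in> sets borel"
    and Z: "Z \<in> borel_measurable (past M \<xi> s)" and Z01: "\<And>\<omega>. 0 \<le> Z \<omega>" "\<And>\<omega>. Z \<omega> \<le> 1"
  shows "(\<integral>\<^sup>+ \<omega>. ennreal (Z \<omega>) * indicator A (\<xi> (s + t) \<omega>) \<partial>M)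
    = (\<integral>\<^sup>+ \<omega>. ennreal (Z \<omega>) * ennreal (measure (bessel_trans \<sigma> t (\<xi> s \<omega>)) A) \<partial>M)"
proof -
  interpret F: finite_measure_subalgebra M "past M \<xi> s"
    by unfold_locales (rule subalgebra_past[OF xi_measurable])
  have [measurable]: "\<xi> (s + t) \<in> borel_measurable M" using s t by (intro xi_measurable) auto
  have [measurable]: "A \<in> sets borel" by fact
  have ZM [measurable]: "Z \<in> borel_measurable M"
    by (rule measurable_from_subalg[OF F.subalg Z])
  have g [measurable]: "(\<lambda>\<omega>. indicator A (\<xi> (s + t) \<omega>) :: real) \<in> borel_measurable M" by measurable
  have int: "integrable M (\<lambda>\<omega>. Z \<omega> * indicator A (\<xi> (s + t) \<omega>))"
    by (rule integrable_const_bound[where B = 1])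
       (use Z01 in \<open>auto simp: indicator_def abs_mult\<close>)
  let ?r = "real_cond_exp M (past M \<xi> s) (\<lambda>\<omega>. indicator A (\<xi> (s + t) \<omega>))"
  have ae: "AE \<omega> in M. ?r \<omega> = measure (bessel_trans \<sigma> t (\<xi> s \<omega>)) A"
    using markov s t A by (simp add: markov_process_def)
  have "(\<integral>\<^sup>+ \<omega>. ennreal (Z \<omega>) * indicator A (\<xi> (s + t) \<omega>) \<partial>M)
      = (\<integral>\<^sup>+ \<omega>. ennreal (Z \<omega> * indicator A (\<xi> (s + t) \<omega>)) \<partial>M)"
    by (intro nn_integral_cong) (auto simp: indicator_def)
  also have "\<dots> = ennreal (\<integral> \<omega>. Z \<omega> * indicator A (\<xi> (s + t) \<omega>) \<partial>M)"
    using Z01 by (intro nn_integral_eq_integral int) auto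
  also have "\<dots> = ennreal (\<integral> \<omega>. Z \<omega> * ?r \<omega> \<partial>M)"
    by (subst F.real_cond_exp_intg(2)[OF int Z g]) simp
  also have "\<dots> = (\<integral>\<^sup>+ \<omega>. ennreal (Z \<omega> * ?r \<omega>) \<partial>M)"
  proof (rule nn_integral_eq_integral[symmetric])
    show "integrable M (\<lambda>\<omega>. Z \<omega> * ?r \<omega>)" by (rule F.real_cond_exp_intg(1)[OF int Z g])
    show "AE \<omega> in M. 0 \<le> Z \<omega> * ?r \<omega>" using ae by eventually_elim (simp add: Z01)
  qed
  also have "\<dots> = (\<integral>\<^sup>+ \<omega>. ennreal (Z \<omega>) * ennreal (measure (bessel_trans \<sigma> t (\<xi> s \<omega>)) A) \<partial>M)"
    using ae by (intro nn_integral_cong_AE) (auto simp: ennreal_mult Z01)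
  finally show ?thesis .
qed

text \<open>The integral formulas for the kernel hold for positive starting points, so positivity is
  needed at each time. For s > 0 the transition law gives no mass to the closed negative half-line
  from any starting point, and the Markov property from time 0 with Z = 1 transfers this to the
  process.\<close>

lemma AE_xi_pos:
  assumes "s \<ge> 0"
  shows "AE \<omega> in M. \<xi> s \<omega> > 0"
proof (cases "s = 0")
  case True
  have "AE x in distr M borel (\<xi> 0). x > 0"
    unfolding distr_xi_0 bessel_init_def by (subst AE_density) (auto simp: indicator_def)
  then show ?thesis
    unfolding True using xi_measurable[of 0] by (subst (asm) AE_distr_iff) auto
next
  case False
  then have s: "s > 0" using assms by simp
  have [measurable]: "\<xi> s \<in> borel_measurable M" using assms by (rule xi_measurable)
  have "measure (bessel_trans \<sigma> s x) {..0} = 0" for x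
  proof -
    have "emeasure (bessel_trans \<sigma> s x) {..0} = 0"
      unfolding bessel_trans_def
      by (subst emeasure_density) (auto simp: killed_bm_kernel_def indicator_def intro!: nn_integral_zero' AE_I2)
    then show ?thesis by (simp add: measure_def)
  qed
  then have "(\<integral>\<^sup>+ \<omega>. indicator {..0} (\<xi> s \<omega>) \<partial>M) = 0"
    using nn_integral_indicator_future[of 0 s "{..0}" "\<lambda>_. 1"] s by simp
  then have "AE \<omega> in M. indicator {..0} (\<xi> s \<omega>) = (0::ennreal)"
    by (subst (asm) nn_integral_0_iff_AE) auto
  then show ?thesis
    by eventually_elim (auto simp: indicator_def split: if_splits)
qed

text \<open>The step from indicators to Gaussians is an identification of measures: the law of
  \<open>\<xi> (s + t)\<close> under Z dM and the mixture \<open>\<nu>\<close> of transition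
  densities agree on Borel sets, so they integrate every test function alike.\<close>

lemma expectation_gauss_future:
  assumes s: "s \<ge> 0" and t: "t > 0" and b: "b \<ge> 0"
    and Z: "Z \<in> borel_measurable (past M \<xi> s)" and Z01: "\<And>\<omega>. 0 \<le> Z \<omega>" "\<And>\<omega>. Z \<omega> \<le> 1"
  shows "(\<integral> \<omega>. Z \<omega> * gauss b (\<xi> (s + t) \<omega>) \<partial>M) = (\<integral> \<omega>. Z \<omega> * bgauss b (t / (1 + \<sigma>)) (\<xi> s \<omega>) \<partial>M)"
proof -
  have ZM [measurable]: "Z \<in> borel_measurable M"
    by (rule measurable_from_subalg[OF subalgebra_past[OF xi_measurable] Z])
  have [measurable]: "\<xi> (s + t) \<in> borel_measurable M" "\<xi> s \<in> borel_measurable M"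
    using s t by (auto intro!: xi_measurable)
  define \<tau> where "\<tau> = t / (1 + \<sigma>)"
  have tau: "\<tau> > 0" using t sigma_pos by (simp add: \<tau>_def)
  define k where "k x y = ennreal (y / x * killed_bm_kernel \<tau> x y) * indicator {0<..} y" for x y :: real
  have k_meas [measurable]: "(\<lambda>z. k (fst z) (snd z)) \<in> borel_measurable (borel \<Otimes>\<^sub>M borel)"
    unfolding k_def by measurable
  have trans: "bessel_trans \<sigma> t x = density lborel (k x)" for x
    by (simp add: bessel_trans_def k_def[abs_def] \<tau>_def)
  have kx [measurable]: "k x \<in> borel_measurable borel" for x
    unfolding k_def killed_bm_kernel_def by measurable
  define \<nu> where "\<nu> = density lborel (\<lambda>y. \<integral>\<^sup>+ \<omega>. ennreal (Z \<omega>) * k (\<xi> s \<omega>) y \<partial>M)"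
  have k2 [measurable]: "(\<lambda>z. k (\<xi> s (snd z)) (fst z)) \<in> borel_measurable (lborel \<Otimes>\<^sub>M M)"
    using measurable_compose[OF _ k_meas, of "\<lambda>z. (\<xi> s (snd z), fst z)" "lborel \<Otimes>\<^sub>M M"] by simp
  have k3: "(\<lambda>(y, \<omega>). ennreal (Z \<omega>) * k (\<xi> s \<omega>) y * f y) \<in> borel_measurable (lborel \<Otimes>\<^sub>M M)"
    if [measurable]: "f \<in> borel_measurable borel" for f
    unfolding split_beta by measurable
  have k4 [measurable]: "(\<lambda>y. \<integral>\<^sup>+ \<omega>. ennreal (Z \<omega>) * k (\<xi> s \<omega>) y \<partial>M) \<in> borel_measurable lborel"
    using k3[of "\<lambda>_. 1"] by (intro borel_measurable_nn_integral) (simp add: split_beta)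
  interpret P: pair_sigma_finite lborel M ..
  have tonelli: "(\<integral>\<^sup>+ y. f y \<partial>\<nu>) = (\<integral>\<^sup>+ \<omega>. ennreal (Z \<omega>) * (\<integral>\<^sup>+ y. k (\<xi> s \<omega>) y * f y \<partial>lborel) \<partial>M)"
    if f [measurable]: "f \<in> borel_measurable borel" for f
  proof -
    have "(\<integral>\<^sup>+ y. f y \<partial>\<nu>) = (\<integral>\<^sup>+ y. (\<integral>\<^sup>+ \<omega>. ennreal (Z \<omega>) * k (\<xi> s \<omega>) y \<partial>M) * f y \<partial>lborel)"
      unfolding \<nu>_def by (subst nn_integral_density) auto
    also have "\<dots> = (\<integral>\<^sup>+ y. \<integral>\<^sup>+ \<omega>. ennreal (Z \<omega>) * k (\<xi> s \<omega>) y * f y \<partial>M \<partial>lborel)"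
      using measurable_compose[OF measurable_Pair1' k2]
      by (intro nn_integral_cong nn_integral_multc[symmetric]) auto
    also have "\<dots> = (\<integral>\<^sup>+ \<omega>. \<integral>\<^sup>+ y. ennreal (Z \<omega>) * k (\<xi> s \<omega>) y * f y \<partial>lborel \<partial>M)"
      using P.Fubini'[OF k3[OF f]] by simp
    also have "\<dots> = (\<integral>\<^sup>+ \<omega>. ennreal (Z \<omega>) * (\<integral>\<^sup>+ y. k (\<xi> s \<omega>) y * f y \<partial>lborel) \<partial>M)"
      by (intro nn_integral_cong) (simp add: mult.assoc nn_integral_cmult)
    finally show ?thesis .
  qed
  have total: "(\<integral>\<^sup>+ y. k x y * ennreal (gauss b' y) \<partial>lborel) = ennreal (bgauss b' \<tau> x)"
    if "x > 0" "b' \<ge> 0" for x b'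
    unfolding k_def using nn_integral_bessel_gauss[OF that(1) tau that(2)] .
  \<comment> \<open>The Gaussian formula at b = 0 says that the kernel has mass 1, so the
    real-valued \<open>measure\<close> of the Markov property loses nothing.\<close>
  have prob: "emeasure (bessel_trans \<sigma> t x) A = ennreal (measure (bessel_trans \<sigma> t x) A)"
    if "x > 0" for x A
  proof -
    have "emeasure (bessel_trans \<sigma> t x) UNIV = 1"
      unfolding trans using total[OF that, of 0]
      by (subst emeasure_density) (auto simp: gauss_def bgauss_def)
    then have "finite_measure (bessel_trans \<sigma> t x)"
      by (intro finite_measureI) (simp add: trans)
    then show ?thesis by (rule finite_measure.emeasure_eq_measure)
  qed
  have "distr (density M (\<lambda>\<omega>. ennreal (Z \<omega>))) borel (\<xi> (s + t)) = \<nu>"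
  proof (rule measure_eqI)
    show "sets (distr (density M (\<lambda>\<omega>. ennreal (Z \<omega>))) borel (\<xi> (s + t))) = sets \<nu>"
      by (simp add: \<nu>_def)
    fix A assume "A \<in> sets (distr (density M (\<lambda>\<omega>. ennreal (Z \<omega>))) borel (\<xi> (s + t)))"
    then have A [measurable]: "A \<in> sets borel" by simp
    have "emeasure (distr (density M (\<lambda>\<omega>. ennreal (Z \<omega>))) borel (\<xi> (s + t))) A
        = (\<integral>\<^sup>+ x. indicator A x \<partial>distr (density M (\<lambda>\<omega>. ennreal (Z \<omega>))) borel (\<xi> (s + t)))"
      by simp
    also have "\<dots> = (\<integral>\<^sup>+ \<omega>. ennreal (Z \<omega>) * indicator A (\<xi> (s + t) \<omega>) \<partial>M)"
      by (subst nn_integral_distr) (auto simp: nn_integral_density)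
    also have "\<dots> = (\<integral>\<^sup>+ \<omega>. ennreal (Z \<omega>) * ennreal (measure (bessel_trans \<sigma> t (\<xi> s \<omega>)) A) \<partial>M)"
      by (rule nn_integral_indicator_future[OF s t A Z Z01])
    also have "\<dots> = (\<integral>\<^sup>+ \<omega>. ennreal (Z \<omega>) * (\<integral>\<^sup>+ y. k (\<xi> s \<omega>) y * indicator A y \<partial>lborel) \<partial>M)"
    proof (rule nn_integral_cong_AE)
      show "AE \<omega> in M. ennreal (Z \<omega>) * ennreal (measure (bessel_trans \<sigma> t (\<xi> s \<omega>)) A)
          = ennreal (Z \<omega>) * (\<integral>\<^sup>+ y. k (\<xi> s \<omega>) y * indicator A y \<partial>lborel)"
        using AE_xi_pos[OF s]
      proof eventually_elim
        case (elim \<omega>)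
        have "ennreal (measure (bessel_trans \<sigma> t (\<xi> s \<omega>)) A) = emeasure (bessel_trans \<sigma> t (\<xi> s \<omega>)) A"
          by (rule prob[OF elim, symmetric])
        also have "\<dots> = (\<integral>\<^sup>+ y. k (\<xi> s \<omega>) y * indicator A y \<partial>lborel)"
          unfolding trans by (rule emeasure_density) auto
        finally show ?case by simp
      qed
    qed
    also have "\<dots> = (\<integral>\<^sup>+ y. indicator A y \<partial>\<nu>)"
      by (rule tonelli[symmetric]) measurable
    also have "\<dots> = emeasure \<nu> A"
      by (rule nn_integral_indicator) (simp add: \<nu>_def)
    finally show "emeasure (distr (density M (\<lambda>\<omega>. ennreal (Z \<omega>))) borel (\<xi> (s + t))) A = emeasure \<nu> A" .
  qed
  then have "(\<integral>\<^sup>+ y. ennreal (gauss b y) \<partial>distr (density M (\<lambda>\<omega>. ennreal (Z \<omega>))) borel (\<xi> (s + t)))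
      = (\<integral>\<^sup>+ y. ennreal (gauss b y) \<partial>\<nu>)" by simp
  also have "(\<integral>\<^sup>+ y. ennreal (gauss b y) \<partial>distr (density M (\<lambda>\<omega>. ennreal (Z \<omega>))) borel (\<xi> (s + t)))
      = (\<integral>\<^sup>+ \<omega>. ennreal (Z \<omega>) * ennreal (gauss b (\<xi> (s + t) \<omega>)) \<partial>M)"
    by (subst nn_integral_distr) (auto simp: nn_integral_density)
  also have "(\<integral>\<^sup>+ y. ennreal (gauss b y) \<partial>\<nu>)
      = (\<integral>\<^sup>+ \<omega>. ennreal (Z \<omega>) * (\<integral>\<^sup>+ y. k (\<xi> s \<omega>) y * ennreal (gauss b y) \<partial>lborel) \<partial>M)"
    by (rule tonelli) measurable
  also have "\<dots> = (\<integral>\<^sup>+ \<omega>. ennreal (Z \<omega>) * ennreal (bgauss b \<tau> (\<xi> s \<omega>)) \<partial>M)"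
    using AE_xi_pos[OF s] by (intro nn_integral_cong_AE, eventually_elim) (simp add: total b)
  finally have eq: "(\<integral>\<^sup>+ \<omega>. ennreal (Z \<omega> * gauss b (\<xi> (s + t) \<omega>)) \<partial>M)
      = (\<integral>\<^sup>+ \<omega>. ennreal (Z \<omega> * bgauss b \<tau> (\<xi> s \<omega>)) \<partial>M)"
    by (simp add: ennreal_mult Z01 bgauss_nonneg less_imp_le[OF gauss_pos])
  show ?thesis
    unfolding \<tau>_def[symmetric]
    by (subst (1 2) integral_eq_nn_integral)
       (auto simp: eq Z01 bgauss_nonneg less_imp_le[OF gauss_pos])
qed

end

section \<open>The walk on Gaussian test functions\<close>

context chain_params
begin

text \<open>Both the limiting probability of a move and the time change in
  \<open>bessel_trans\<close>, which is why the clocks agree.\<close>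

definition \<tau> :: real where "\<tau> = 1 / (1 + \<sigma>)"

definition up :: "nat \<Rightarrow> real" where "up n = trans_prob q \<sigma> n (Suc n)"

text \<open>Taken from \<open>step_prob\<close>, because at n = 0 the truncated n - 1 would turn a
  downward step into a stay.\<close>

definition down :: "nat \<Rightarrow> real" where "down n = step_prob q \<sigma> n (- 1)"

lemma tau_bounds: "0 < \<tau>" "\<tau> \<le> 1"
  using sigma_pos by (auto simp: \<tau>_def)

lemma up_eq: "up n = (1 - q ^ Suc n) * \<tau> * s (int n + 1) / (2 * s (int n))"
  and down_eq: "down n = (1 - q ^ Suc n) * \<tau> * s (int n - 1) / (2 * s (int n))"
  and stay_eq: "step_prob q \<sigma> n 0 = (1 - q ^ Suc n) * \<tau> * \<sigma>"
  by (simp_all add: up_def down_def trans_prob_def step_prob_def \<tau>_def)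

lemma up_nonneg: "up n \<ge> 0" and down_nonneg: "down n \<ge> 0" and stay_nonneg: "step_prob q \<sigma> n 0 \<ge> 0"
  unfolding up_eq down_eq stay_eq
  using s_nonneg q_power_less_1[of n] tau_bounds sigma_pos s_pos[of n]
  by (auto intro!: divide_nonneg_nonneg mult_nonneg_nonneg less_imp_le)

text \<open>This is \<open>s_recurrence\<close> divided by 2 s_n. Adding the stay probability gives
  (1 + sigma) \<open>\<tau>\<close> = 1, so the rows are probability vectors.\<close>

lemma up_plus_down: "up n + down n = (1 + \<sigma> * q ^ Suc n) * \<tau>"
proof -
  have "up n + down n = ((1 - q ^ Suc n) * (s (int n + 1) + s (int n - 1))) * \<tau> / (2 * s (int n))"
    by (simp only: up_eq down_eq add_divide_distrib[symmetric]) (simp add: algebra_simps)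
  also have "(1 - q ^ Suc n) * (s (int n + 1) + s (int n - 1)) = 2 * (1 + \<sigma> * q ^ Suc n) * s (int n)"
    using s_recurrence[of n] by simp
  also have "2 * (1 + \<sigma> * q ^ Suc n) * s (int n) * \<tau> / (2 * s (int n)) = (1 + \<sigma> * q ^ Suc n) * \<tau>"
  proof -
    have "2 * x * y * z / (2 * y) = x * z" if "y > 0" for x y z :: real
      using that by simp
    then show ?thesis using s_pos by blast
  qed
  finally show ?thesis .
qed

lemma stay_eq_up_down: "step_prob q \<sigma> n 0 = 1 - up n - down n"
proof -
  have "(1 + \<sigma> * q ^ Suc n) * \<tau> + (1 - q ^ Suc n) * \<tau> * \<sigma> = (1 + \<sigma>) * \<tau>"
    by (simp add: algebra_simps)
  also have "\<dots> = 1" using sigma_pos by (simp add: \<tau>_def)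
  finally show ?thesis using up_plus_down[of n] stay_eq[of n] by linarith
qed

lemma down_0: "down 0 = 0"
  by (simp add: down_eq s_neg)

lemma trans_prob_eq: "trans_prob q \<sigma> n m = (if m = Suc n then up n else if m = n then 1 - up n - down n
    else if Suc m = n then down n else 0)"
proof -
  have "up n = step_prob q \<sigma> n 1" by (simp add: up_def trans_prob_def)
  moreover have "step_prob q \<sigma> n \<delta> = 0" if "\<delta> \<noteq> 1" "\<delta> \<noteq> 0" "\<delta> \<noteq> - 1" for \<delta>
    using that by (simp add: step_prob_def)
  moreover have "int m - int n = 1 \<longleftrightarrow> m = Suc n" "int m - int n = 0 \<longleftrightarrow> m = n"
      "int m - int n = - 1 \<longleftrightarrow> Suc m = n"
    by auto
  ultimately show ?thesis
    unfolding stay_eq_up_down[symmetric] trans_prob_def using down_def by metis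
qed

lemma trans_prob_nonneg: "trans_prob q \<sigma> n m \<ge> 0"
  using up_nonneg[of n] down_nonneg[of n] stay_nonneg[of n]
  by (auto simp: trans_prob_eq stay_eq_up_down)

text \<open>At n = 0 the range is {0, 1} and the term at n - 1 = 0 is spurious, but
  \<open>down_0\<close> kills it.\<close>

lemma sum_trans_prob: "(\<Sum>m\<in>{n - 1..Suc n}. f m * trans_prob q \<sigma> n m) =
    up n * f (Suc n) + (1 - up n - down n) * f n + down n * f (n - 1)"
proof (cases n)
  case 0
  have "{n - 1..Suc n} = {0, 1}" using 0 by auto
  then show ?thesis using 0 by (simp add: trans_prob_eq down_0 algebra_simps)
next
  case (Suc k)
  have "{n - 1..Suc n} = {k, Suc k, Suc (Suc k)}" using Suc by auto
  then show ?thesis using Suc by (simp add: trans_prob_eq algebra_simps)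
qed

lemma trans_prob_support: "trans_prob q \<sigma> n m \<noteq> 0 \<Longrightarrow> m \<in> {n - 1..Suc n}"
  by (auto simp: trans_prob_eq split: if_splits)

definition kernel :: "nat \<Rightarrow> nat pmf" where
  "kernel n = embed_pmf (trans_prob q \<sigma> n)"

lemma pmf_kernel: "pmf (kernel n) m = trans_prob q \<sigma> n m"
  unfolding kernel_def
proof (rule pmf_embed_pmf[OF trans_prob_nonneg])
  have "(\<integral>\<^sup>+ m. ennreal (trans_prob q \<sigma> n m) \<partial>count_space UNIV)
      = (\<Sum>m\<in>{n - 1..Suc n}. ennreal (trans_prob q \<sigma> n m))"
  proof (rule nn_integral_count_space')
    show "ennreal (trans_prob q \<sigma> n m) = 0" if "m \<notin> {n - 1..Suc n}" for m
      using trans_prob_support[of n m] that by (metis ennreal_0)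
  qed auto
  also have "\<dots> = ennreal (\<Sum>m\<in>{n - 1..Suc n}. trans_prob q \<sigma> n m)"
    by (rule sum_ennreal) (rule trans_prob_nonneg)
  also have "(\<Sum>m\<in>{n - 1..Suc n}. trans_prob q \<sigma> n m) = 1"
    using sum_trans_prob[of "\<lambda>_. 1" n] by simp
  finally show "(\<integral>\<^sup>+ m. ennreal (trans_prob q \<sigma> n m) \<partial>count_space UNIV) = 1" by simp
qed

lemma integral_kernel:
  fixes f :: "nat \<Rightarrow> real"
  shows "(\<integral> m. f m \<partial>kernel n) = up n * f (Suc n) + (1 - up n - down n) * f n + down n * f (n - 1)"
proof -
  have "(\<integral> m. f m \<partial>kernel n) = (\<Sum>m\<in>{n - 1..Suc n}. f m * pmf (kernel n) m)"
    by (rule integral_measure_pmf_real)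
       (use trans_prob_support in \<open>auto simp: set_pmf_iff pmf_kernel\<close>)
  then show ?thesis by (simp only: pmf_kernel sum_trans_prob)
qed

text \<open>The killed walk with jump rates (1 - q^{n+1}) \<open>\<tau>\<close> / 2 is reversible
  for 1 / (1 - q^{n+1}), and an h-transform by s multiplies the reversible measure by s^2. Each edge
  then carries the symmetric flow \<open>\<tau>\<close> s_n s_{n+1} / 2.\<close>

definition weight :: "nat \<Rightarrow> real" where
  "weight n = (s (int n))\<^sup>2 / (1 - q ^ Suc n)"

text \<open>Because 1 - q^{n+1} <= 1 <= s_n; this is what dominates the initial law by the
  reversible measure.\<close>

lemma s_le_weight: "s (int n) \<le> weight n"
proof -
  have "1 - q ^ Suc n \<le> s (int n)"
    using s_ge[of n] zero_le_power[OF q_nonneg, of "Suc n"] of_nat_0_le_iff[of n] by linarith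
  then have "s (int n) * (1 - q ^ Suc n) \<le> s (int n) * s (int n)"
    using s_pos[of n] by (intro mult_left_mono) auto
  then show ?thesis
    using q_power_less_1[of n] by (simp add: weight_def field_simps power2_eq_square)
qed

lemma weight_up: "weight n * up n = \<tau> * s (int n) * s (int (Suc n)) / 2"
  using s_pos[of n] q_power_less_1[of n]
  by (simp add: weight_def up_eq power2_eq_square add.commute)

lemma weight_down: "weight (Suc n) * down (Suc n) = \<tau> * s (int n) * s (int (Suc n)) / 2"
  using s_pos[of "Suc n"] q_power_less_1[of "Suc n"]
  by (simp add: weight_def down_eq power2_eq_square add.commute)

lemma reversible: "weight n * trans_prob q \<sigma> n m = weight m * trans_prob q \<sigma> m n"
  using weight_up[of n] weight_up[of m] weight_down[of n] weight_down[of m]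
  by (auto simp: trans_prob_eq)

text \<open>The mean and the mean square of a step from \<open>n\<close> should be \<open>\<tau> / n\<close> and \<open>\<tau>\<close>, to match
  the generator \<open>\<tau> (f'' / 2 + f' / x)\<close> of the limit.\<close>

definition drift_error :: "nat \<Rightarrow> real" where
  "drift_error n = \<bar>real n * (up n - down n) - \<tau>\<bar> + \<bar>up n + down n - \<tau>\<bar>"

text \<open>The drift n (up - down) equals (1 - q^{n+1}) \<open>\<tau>\<close> n (d_{n+1} + d_n) /
  (2 s_n), and the increments tend to K while s_n ~ K n. The variance part is explicit from
  \<open>up_plus_down\<close>.\<close>

lemma drift_error_tendsto: "drift_error \<longlonglongrightarrow> 0"
proof -
  have q0: "(\<lambda>n. q ^ Suc n) \<longlonglongrightarrow> 0"
    using LIMSEQ_power_zero[of q] q_nonneg q_less_1 by (intro LIMSEQ_Suc) simp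
  have d2: "(\<lambda>n. d (Suc n) + d n) \<longlonglongrightarrow> K + K"
    by (intro tendsto_add d_tendsto LIMSEQ_Suc)
  have n1: "(\<lambda>n. real n / (real n + 1)) \<longlonglongrightarrow> 1"
    using LIMSEQ_n_over_Suc_n by (simp add: add.commute)
  have "(\<lambda>n. (1 - q ^ Suc n) * \<tau> * ((real n / (real n + 1)) * (d (Suc n) + d n) / (2 * (s (int n) / (real n + 1)))))
      \<longlonglongrightarrow> (1 - 0) * \<tau> * (1 * (K + K) / (2 * K))"
    using K_ge_1 by (intro tendsto_intros q0 d2 n1 s_over_n_tendsto) auto
  also have "(1 - 0) * \<tau> * (1 * (K + K) / (2 * K)) = \<tau>" using K_ge_1 by simp
  also have "(\<lambda>n. (1 - q ^ Suc n) * \<tau> * ((real n / (real n + 1)) * (d (Suc n) + d n) / (2 * (s (int n) / (real n + 1)))))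
      = (\<lambda>n. real n * (up n - down n))"
  proof
    fix n
    have dd: "d (Suc n) + d n = s (int n + 1) - s (int n - 1)"
      by (simp add: d_def add.commute)
    have "up n - down n = (1 - q ^ Suc n) * \<tau> * ((d (Suc n) + d n) / (2 * s (int n)))"
      unfolding dd by (simp only: up_eq down_eq diff_divide_distrib[symmetric]) (simp add: algebra_simps)
    then have "real n * (up n - down n) = (1 - q ^ Suc n) * \<tau> * (real n * ((d (Suc n) + d n) / (2 * s (int n))))"
      by simp
    also have "real n * ((d (Suc n) + d n) / (2 * s (int n)))
        = (real n / (real n + 1)) * (d (Suc n) + d n) / (2 * (s (int n) / (real n + 1)))"
      using s_pos[of n] by simp
    finally show "(1 - q ^ Suc n) * \<tau> * ((real n / (real n + 1)) * (d (Suc n) + d n) / (2 * (s (int n) / (real n + 1))))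
      = real n * (up n - down n)" ..
  qed
  finally have 1: "(\<lambda>n. real n * (up n - down n)) \<longlonglongrightarrow> \<tau>" .
  have 2: "(\<lambda>n. up n + down n) \<longlonglongrightarrow> (1 + \<sigma> * 0) * \<tau>"
    unfolding up_plus_down by (intro tendsto_intros q0)
  have "(\<lambda>n. \<bar>real n * (up n - down n) - \<tau>\<bar> + \<bar>up n + down n - \<tau>\<bar>) \<longlonglongrightarrow> \<bar>\<tau> - \<tau>\<bar> + \<bar>(1 + \<sigma> * 0) * \<tau> - \<tau>\<bar>"
    by (intro tendsto_intros 1 2)
  then show ?thesis by (simp add: drift_error_def[abs_def])
qed

lemma drift_error_nonneg: "drift_error n \<ge> 0"
  by (simp add: drift_error_def)

lemma drift_error_bounded: obtains E where "E > 0" "\<And>n. drift_error n \<le> E"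
proof -
  have "Bseq drift_error"
    by (rule convergent_imp_Bseq[OF convergentI[OF drift_error_tendsto]])
  then obtain E where "E > 0" "\<And>n. norm (drift_error n) \<le> E"
    unfolding Bseq_def by blast
  then show ?thesis using that[of E] drift_error_nonneg by simp
qed

lemma kernel_gauss:
  assumes b: "0 \<le> b" "b \<le> B" and h: "0 < h" "h \<le> 1"
  shows "\<bar>(\<integral> m. gauss b (h * real m) \<partial>kernel n) - bgauss b (\<tau> * h\<^sup>2) (h * real n)\<bar>
    \<le> h\<^sup>2 * (step_const B * (drift_error n + h))"
proof -
  \<comment> \<open>Truncated and real subtraction differ only at n = 0, where the factor
    \<open>down n\<close> vanishes.\<close>
  have eq: "down n * gauss b (h * real (n - 1)) = down n * gauss b (h * (real n - 1))"
    by (cases n) (simp_all add: down_0)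
  have "up n + down n \<le> 1"
    using stay_nonneg[of n] by (simp add: stay_eq_up_down)
  then show ?thesis
    using gauss_one_step[OF b h, of \<tau> "up n" "down n" "real n"] tau_bounds up_nonneg[of n] down_nonneg[of n]
    unfolding integral_kernel eq by (simp add: drift_error_def algebra_simps)
qed

end

section \<open>Expectations along the path of the walk\<close>

lemma nn_integral_countable_range:
  fixes Y :: "'a \<Rightarrow> 'b::countable"
  assumes Y: "Y \<in> measurable M (count_space UNIV)"
  shows "(\<integral>\<^sup>+ \<omega>. g (Y \<omega>) \<partial>M) = (\<integral>\<^sup>+ y. emeasure M {\<omega> \<in> space M. Y \<omega> = y} * g y \<partial>count_space UNIV)"
proof -
  have "distr M (count_space UNIV) Y = density (count_space UNIV) (\<lambda>y. emeasure M {\<omega> \<in> space M. Y \<omega> = y})"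
  proof (rule measure_eqI_countable[where A = UNIV])
    fix y :: 'b
    have "Y -` {y} \<inter> space M = {\<omega> \<in> space M. Y \<omega> = y}" by auto
    then show "emeasure (distr M (count_space UNIV) Y) {y}
        = emeasure (density (count_space UNIV) (\<lambda>y. emeasure M {\<omega> \<in> space M. Y \<omega> = y})) {y}"
      using Y by (simp add: emeasure_distr emeasure_density nn_integral_count_space_indicator[symmetric]
          nn_integral_indicator_singleton)
  qed auto
  then have "(\<integral>\<^sup>+ y. g y \<partial>distr M (count_space UNIV) Y)
      = (\<integral>\<^sup>+ y. g y \<partial>density (count_space UNIV) (\<lambda>y. emeasure M {\<omega> \<in> space M. Y \<omega> = y}))"
    by simp
  then show ?thesis
    using Y by (simp add: nn_integral_distr nn_integral_density)
qed

locale walk = chain_params +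
  fixes M :: "'a measure" and X :: "nat \<Rightarrow> 'a \<Rightarrow> nat" and \<rho> :: real
  assumes markov: "markov_chain M X (init_prob q \<sigma> \<rho>) (trans_prob q \<sigma>)"
    and rho: "0 \<le> \<rho>" "\<rho> \<le> 1"
begin

sublocale prob_space M
  using markov by (simp add: markov_chain_def)

lemma X_measurable [measurable]: "X k \<in> measurable M (count_space UNIV)"
  using markov by (simp add: markov_chain_def)

lemma prob_X_0: "prob {\<omega> \<in> space M. X 0 \<omega> = n} = init_prob q \<sigma> \<rho> n"
  using markov by (simp add: markov_chain_def)

text \<open>The masses are those of the random variable \<open>X 0\<close>. This normalization is
  the source of everything known about C_0.\<close>

lemma init_prob_sums: "init_prob q \<sigma> \<rho> sums 1"
proof -
  have "(\<lambda>n. prob {\<omega> \<in> space M. X 0 \<omega> = n}) sums prob (\<Union>n. {\<omega> \<in> space M. X 0 \<omega> = n})"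
    by (intro finite_measure_UNION) (auto simp: disjoint_family_on_def)
  also have "(\<Union>n. {\<omega> \<in> space M. X 0 \<omega> = n}) = space M" by auto
  finally show ?thesis by (simp add: prob_X_0 prob_space)
qed

text \<open>As s_0 = 1, the probability of starting at 0 is 1 / C_0, so C_0 is not negative. Were it
  0, division by zero would make all the masses 0, against total mass 1.\<close>

lemma C0_pos: "C0 q \<sigma> \<rho> > 0"
proof -
  have "1 / C0 q \<sigma> \<rho> \<ge> 0"
    using prob_X_0[of 0] measure_nonneg[of M "{\<omega> \<in> space M. X 0 \<omega> = 0}"]
    by (simp add: init_prob_def s_0)
  moreover have "C0 q \<sigma> \<rho> \<noteq> 0"
  proof
    assume "C0 q \<sigma> \<rho> = 0"
    then have "init_prob q \<sigma> \<rho> = (\<lambda>_. 0)" by (simp add: init_prob_def fun_eq_iff)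
    then show False using init_prob_sums by (simp add: sums_iff)
  qed
  ultimately show ?thesis by (simp add: zero_le_divide_1_iff)
qed

lemma X_compose_measurable [measurable]: "(\<lambda>\<omega>. g (X k \<omega>)) \<in> borel_measurable M"
  for g :: "nat \<Rightarrow> real"
  by (rule measurable_compose[OF X_measurable]) simp

text \<open>The history up to and including time k, so of length k + 1. Lists of naturals are
  countable, so conditioning on the whole past reduces to sums over histories.\<close>

definition path :: "nat \<Rightarrow> 'a \<Rightarrow> nat list" where
  "path k \<omega> = map (\<lambda>i. X i \<omega>) [0..<Suc k]"

lemma path_measurable [measurable]: "path k \<in> measurable M (count_space UNIV)"
proof -
  have "{\<omega> \<in> space M. path k \<omega> = l} \<in> sets M" for l
  proof -
    have "{\<omega> \<in> space M. path k \<omega> = l} = (if length l = Suc k then {\<omega> \<in> space M. \<forall>i\<le>k. X i \<omega> = l ! i} else {})"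
      by (auto simp: path_def list_eq_iff_nth_eq less_Suc_eq_le simp del: upt_Suc)
    then show ?thesis by auto
  qed
  then show ?thesis
    by (intro measurable_count_space_eq2_countable[THEN iffD2]) (auto simp: vimage_def Int_def conj_commute)
qed

lemma last_path: "last (path k \<omega>) = X k \<omega>"
  by (simp add: path_def)

lemma take_path: "i \<le> k \<Longrightarrow> take (Suc i) (path k \<omega>) = path i \<omega>"
  by (simp add: path_def take_map take_upt del: upt_Suc)

lemma nth_path: "i \<le> k \<Longrightarrow> path k \<omega> ! i = X i \<omega>"
  by (simp add: path_def del: upt_Suc)

text \<open>The Markov property in product form, free of conditioning: for a null history, where
  \<open>markov_chain\<close> says nothing, both sides are 0.\<close>

lemma prob_path_Suc:
  "emeasure M {\<omega> \<in> space M. path k \<omega> = l \<and> X (Suc k) \<omega> = m}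
    = emeasure M {\<omega> \<in> space M. path k \<omega> = l} * ennreal (pmf (kernel (last l)) m)"
proof (cases "length l = Suc k")
  case False
  then have "path k \<omega> \<noteq> l" for \<omega> by (auto simp: path_def)
  then show ?thesis by simp
next
  case True
  let ?Q = "\<lambda>\<omega>. \<forall>i\<le>k. X i \<omega> = l ! i"
  have path: "path k \<omega> = l \<longleftrightarrow> ?Q \<omega>" for \<omega>
    using True by (auto simp: path_def list_eq_iff_nth_eq less_Suc_eq_le simp del: upt_Suc)
  have last: "last l = l ! k" using True by (metis diff_Suc_1 last_conv_nth length_0_conv nat.distinct(1))
  have "prob {\<omega> \<in> space M. X (Suc k) \<omega> = m \<and> ?Q \<omega>} = prob {\<omega> \<in> space M. ?Q \<omega>} * trans_prob q \<sigma> (l ! k) m"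
  proof (cases "prob {\<omega> \<in> space M. ?Q \<omega>} > 0")
    case True
    then have "cond_prob M (\<lambda>\<omega>. X (Suc k) \<omega> = m) ?Q = trans_prob q \<sigma> (l ! k) m"
      using markov unfolding markov_chain_def by blast
    with True show ?thesis by (simp add: cond_prob_def field_simps)
  next
    case False
    then have "prob {\<omega> \<in> space M. ?Q \<omega>} = 0"
      using measure_nonneg[of M "{\<omega> \<in> space M. ?Q \<omega>}"] by linarith
    moreover have "prob {\<omega> \<in> space M. X (Suc k) \<omega> = m \<and> ?Q \<omega>} \<le> prob {\<omega> \<in> space M. ?Q \<omega>}"
      by (intro finite_measure_mono) auto
    ultimately show ?thesis
      using measure_nonneg[of M "{\<omega> \<in> space M. X (Suc k) \<omega> = m \<and> ?Q \<omega>}"] by simp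
  qed
  then show ?thesis
    unfolding path last pmf_kernel emeasure_eq_measure
    by (simp add: ennreal_mult[symmetric] trans_prob_nonneg conj_commute)
qed

lemma nn_integral_step:
  fixes z :: "nat list \<Rightarrow> ennreal" and f :: "nat \<Rightarrow> ennreal"
  shows "(\<integral>\<^sup>+ \<omega>. z (path k \<omega>) * f (X (Suc k) \<omega>) \<partial>M)
    = (\<integral>\<^sup>+ \<omega>. z (path k \<omega>) * (\<integral>\<^sup>+ m. f m \<partial>kernel (X k \<omega>)) \<partial>M)"
proof -
  have m: "(\<lambda>\<omega>. (path k \<omega>, X (Suc k) \<omega>)) \<in> measurable M (count_space UNIV)"
    by (intro measurable_count_space_eq2_countable[THEN iffD2]) (auto simp: vimage_def Int_def conj_commute)
  have "(\<integral>\<^sup>+ \<omega>. z (path k \<omega>) * f (X (Suc k) \<omega>) \<partial>M)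
      = (\<integral>\<^sup>+ y. emeasure M {\<omega> \<in> space M. (path k \<omega>, X (Suc k) \<omega>) = y} * (z (fst y) * f (snd y)) \<partial>count_space UNIV)"
    using nn_integral_countable_range[OF m, of "\<lambda>y. z (fst y) * f (snd y)"] by simp
  also have "\<dots> = (\<integral>\<^sup>+ l. \<integral>\<^sup>+ m. emeasure M {\<omega> \<in> space M. path k \<omega> = l \<and> X (Suc k) \<omega> = m} * (z l * f m)
      \<partial>count_space UNIV \<partial>count_space UNIV)"
    by (subst nn_integral_fst_count_space[symmetric]) simp
  also have "\<dots> = (\<integral>\<^sup>+ l. emeasure M {\<omega> \<in> space M. path k \<omega> = l} * (z l * (\<integral>\<^sup>+ m. f m \<partial>kernel (last l))) \<partial>count_space UNIV)"
  proof (rule nn_integral_cong)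
    fix l
    have "(\<integral>\<^sup>+ m. emeasure M {\<omega> \<in> space M. path k \<omega> = l \<and> X (Suc k) \<omega> = m} * (z l * f m) \<partial>count_space UNIV)
        = (\<integral>\<^sup>+ m. (emeasure M {\<omega> \<in> space M. path k \<omega> = l} * z l) * (ennreal (pmf (kernel (last l)) m) * f m) \<partial>count_space UNIV)"
      by (simp add: prob_path_Suc mult_ac)
    then show "(\<integral>\<^sup>+ m. emeasure M {\<omega> \<in> space M. path k \<omega> = l \<and> X (Suc k) \<omega> = m} * (z l * f m) \<partial>count_space UNIV)
        = emeasure M {\<omega> \<in> space M. path k \<omega> = l} * (z l * (\<integral>\<^sup>+ m. f m \<partial>kernel (last l)))"
      by (simp add: nn_integral_cmult nn_integral_measure_pmf mult.assoc)
  qed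
  also have "\<dots> = (\<integral>\<^sup>+ \<omega>. z (path k \<omega>) * (\<integral>\<^sup>+ m. f m \<partial>kernel (last (path k \<omega>))) \<partial>M)"
    by (rule nn_integral_countable_range[OF path_measurable, symmetric])
  finally show ?thesis by (simp only: last_path)
qed

lemma expectation_step:
  fixes z :: "nat list \<Rightarrow> real" and f :: "nat \<Rightarrow> real"
  assumes z: "\<And>l. 0 \<le> z l" and f: "\<And>m. 0 \<le> f m" "\<And>m. f m \<le> 1"
  shows "expectation (\<lambda>\<omega>. z (path k \<omega>) * f (X (Suc k) \<omega>))
    = expectation (\<lambda>\<omega>. z (path k \<omega>) * (\<integral> m. f m \<partial>kernel (X k \<omega>)))"
proof -
  have zm: "(\<lambda>\<omega>. z (path k \<omega>)) \<in> borel_measurable M"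
    by (rule measurable_compose[OF path_measurable]) simp
  have fm: "(\<lambda>\<omega>. g (X j \<omega>)) \<in> borel_measurable M" for g :: "nat \<Rightarrow> real" and j
    by (rule measurable_compose[OF X_measurable]) simp
  have ik: "ennreal (\<integral> m. f m \<partial>kernel n) = (\<integral>\<^sup>+ m. ennreal (f m) \<partial>kernel n)" for n
    using f by (intro nn_integral_eq_integral[symmetric] measure_pmf.integrable_const_bound[where B = 1]) auto
  have ik0: "(\<integral> m. f m \<partial>kernel n) \<ge> 0" for n
    using f by simp
  have "(\<integral>\<^sup>+ \<omega>. ennreal (z (path k \<omega>) * f (X (Suc k) \<omega>)) \<partial>M)
      = (\<integral>\<^sup>+ \<omega>. ennreal (z (path k \<omega>) * (\<integral> m. f m \<partial>kernel (X k \<omega>))) \<partial>M)"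
    using nn_integral_step[of "\<lambda>l. ennreal (z l)" k "\<lambda>m. ennreal (f m)"]
    by (simp only: ennreal_mult z f ik ik0)
  then show ?thesis
    using zm fm z f ik0 by (simp add: integral_eq_nn_integral)
qed

text \<open>Domination by a multiple of the reversible measure survives each step, since that
  measure is invariant; the bound is thus uniform in the time j.\<close>

lemma occupation_bound: "prob {\<omega> \<in> space M. X j \<omega> = n} \<le> weight n / C0 q \<sigma> \<rho>"
proof (induction j arbitrary: n)
  case 0
  have "\<rho> ^ n * s (int n) \<le> 1 * weight n"
    using s_le_weight[of n] s_pos[of n] rho by (intro mult_mono power_le_one) auto
  then show ?case
    using C0_pos unfolding prob_X_0 init_prob_def by (simp add: divide_right_mono)
next
  case (Suc j)
  let ?A = "{n - 1..Suc n}"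
  have supp: "trans_prob q \<sigma> k n \<noteq> 0 \<Longrightarrow> k \<in> ?A" for k
    by (auto simp: trans_prob_eq split: if_splits)
  have ind: "(\<lambda>\<omega>. indicator {k} (X i \<omega>) :: real) = indicator {\<omega>. X i \<omega> = k}" for i k
    by (auto simp: indicator_def)
  have E: "expectation (\<lambda>\<omega>. indicator {k} (X i \<omega>)) = prob {\<omega> \<in> space M. X i \<omega> = k}" for i k
    unfolding ind by (simp add: Int_def conj_commute)
  have int: "integrable M (\<lambda>\<omega>. indicator {k} (X i \<omega>) :: real)" for i k
    by (rule integrable_const_bound[where B = 1]) (auto intro: X_compose_measurable[of "indicator {k}"])
  have "prob {\<omega> \<in> space M. X (Suc j) \<omega> = n} = expectation (\<lambda>\<omega>. (\<lambda>_. 1) (path j \<omega>) * indicator {n} (X (Suc j) \<omega>))"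
    by (simp add: E)
  also have "\<dots> = expectation (\<lambda>\<omega>. (\<lambda>_. 1) (path j \<omega>) * (\<integral> m. indicator {n} m \<partial>kernel (X j \<omega>)))"
    by (rule expectation_step) (auto simp: indicator_def)
  also have "\<dots> = expectation (\<lambda>\<omega>. trans_prob q \<sigma> (X j \<omega>) n)"
    by (simp add: pmf_kernel[symmetric] pmf.rep_eq)
  also have "\<dots> = expectation (\<lambda>\<omega>. \<Sum>k\<in>?A. trans_prob q \<sigma> k n * indicator {k} (X j \<omega>))"
  proof (intro arg_cong[where f = expectation] ext)
    fix \<omega>
    show "trans_prob q \<sigma> (X j \<omega>) n = (\<Sum>k\<in>?A. trans_prob q \<sigma> k n * indicator {k} (X j \<omega>))"
    proof -
      have "(\<Sum>k\<in>?A. trans_prob q \<sigma> k n * indicator {k} (X j \<omega>))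
          = (\<Sum>k\<in>?A. if X j \<omega> = k then trans_prob q \<sigma> k n else 0)"
        by (intro sum.cong) (auto simp: indicator_def)
      also have "\<dots> = (if X j \<omega> \<in> ?A then trans_prob q \<sigma> (X j \<omega>) n else 0)"
        by (rule sum.delta') simp
      finally show ?thesis using supp[of "X j \<omega>"] by auto
    qed
  qed
  also have "\<dots> = (\<Sum>k\<in>?A. expectation (\<lambda>\<omega>. trans_prob q \<sigma> k n * indicator {k} (X j \<omega>)))"
    using int by (intro Bochner_Integration.integral_sum integrable_mult_right)
  also have "\<dots> = (\<Sum>k\<in>?A. trans_prob q \<sigma> k n * prob {\<omega> \<in> space M. X j \<omega> = k})"
    by (intro sum.cong refl) (simp only: integral_mult_right_zero E)
  also have "\<dots> \<le> (\<Sum>k\<in>?A. trans_prob q \<sigma> k n * (weight k / C0 q \<sigma> \<rho>))"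
    using Suc by (intro sum_mono mult_left_mono trans_prob_nonneg)
  \<comment> \<open>Detailed balance reverses the transition, so the sum over starting points k
    becomes the row sum from n, which is 1.\<close>
  also have "\<dots> = (\<Sum>k\<in>?A. (weight n / C0 q \<sigma> \<rho>) * trans_prob q \<sigma> n k)"
    using reversible[of n] by (intro sum.cong) (auto simp: mult.commute)
  also have "\<dots> = (weight n / C0 q \<sigma> \<rho>) * (\<Sum>k\<in>?A. 1 * trans_prob q \<sigma> n k)"
    by (simp only: sum_distrib_left mult_1_left)
  also have "\<dots> = weight n / C0 q \<sigma> \<rho>"
    by (subst sum_trans_prob) simp
  finally show ?case .
qed

text \<open>Positions from R on cost at most \<epsilon>; the finitely many below R cost at most E
  times their total probability, which the occupation bound makes of order 1 / C_0.\<close>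

lemma expectation_drift_error:
  assumes "\<And>n. n \<ge> R \<Longrightarrow> drift_error n \<le> \<epsilon>" "\<And>n. drift_error n \<le> E" "\<epsilon> \<ge> 0" "E \<ge> 0"
  shows "expectation (\<lambda>\<omega>. drift_error (X j \<omega>)) \<le> \<epsilon> + E * ((\<Sum>n<R. weight n) / C0 q \<sigma> \<rho>)"
proof -
  have int: "integrable M (\<lambda>\<omega>. indicator {k} (X i \<omega>) :: real)" for i k
    by (rule integrable_const_bound[where B = 1]) (auto intro: X_compose_measurable[of "indicator {k}"])
  have ind: "(\<lambda>\<omega>. indicator {k} (X i \<omega>) :: real) = indicator {\<omega>. X i \<omega> = k}" for i k
    by (auto simp: indicator_def)
  have Ei: "expectation (\<lambda>\<omega>. indicator {k} (X i \<omega>)) = prob {\<omega> \<in> space M. X i \<omega> = k}" for i k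
    unfolding ind by (simp add: Int_def conj_commute)
  have int2: "integrable M (\<lambda>\<omega>. drift_error (X j \<omega>))"
    using assms drift_error_nonneg
    by (intro integrable_const_bound[where B = E] measurable_compose[OF X_measurable]) auto
  have "expectation (\<lambda>\<omega>. drift_error (X j \<omega>)) \<le> expectation (\<lambda>\<omega>. \<epsilon> + E * (\<Sum>n<R. indicator {n} (X j \<omega>)))"
  proof (rule integral_mono[OF int2])
    show "integrable M (\<lambda>\<omega>. \<epsilon> + E * (\<Sum>n<R. indicator {n} (X j \<omega>)))"
      using int by auto
    fix \<omega>
    have "(\<Sum>n<R. indicator {n} (X j \<omega>)) = (if X j \<omega> < R then 1 else 0 :: real)"
      by (simp add: indicator_def sum.delta')
    then show "drift_error (X j \<omega>) \<le> \<epsilon> + E * (\<Sum>n<R. indicator {n} (X j \<omega>))"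
      using assms(1)[of "X j \<omega>"] assms(2)[of "X j \<omega>"] assms(3) by auto
  qed
  also have "\<dots> = \<epsilon> + E * (\<Sum>n<R. prob {\<omega> \<in> space M. X j \<omega> = n})"
    using int by (simp add: Ei Bochner_Integration.integral_sum prob_space)
  also have "\<dots> \<le> \<epsilon> + E * (\<Sum>n<R. weight n / C0 q \<sigma> \<rho>)"
    using assms occupation_bound by (intro add_left_mono mult_left_mono sum_mono) auto
  finally show ?thesis by (simp add: sum_divide_distrib)
qed

text \<open>The pointwise bound \<open>kernel_gauss\<close> averaged over the position at time k.
  The factor z, a function of the past with values in [0, 1], will hold the Gaussians at the earlier
  times.\<close>

lemma expectation_gauss_step:
  fixes z :: "nat list \<Rightarrow> real"
  assumes b: "0 \<le> b" "b \<le> B" and h: "0 < h" "h \<le> 1" and z: "\<And>l. 0 \<le> z l" "\<And>l. z l \<le> 1"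
    and \<eta>: "\<And>j. expectation (\<lambda>\<omega>. drift_error (X j \<omega>)) \<le> \<eta>"
  shows "\<bar>expectation (\<lambda>\<omega>. z (path k \<omega>) * gauss b (h * real (X (Suc k) \<omega>)))
      - expectation (\<lambda>\<omega>. z (path k \<omega>) * bgauss b (\<tau> * h\<^sup>2) (h * real (X k \<omega>)))\<bar>
    \<le> h\<^sup>2 * (step_const B * (\<eta> + h))"
proof -
  obtain E where E: "E > 0" "\<And>n. drift_error n \<le> E" using drift_error_bounded by blast
  let ?G = "\<lambda>n. \<integral> m. gauss b (h * real m) \<partial>kernel n" and ?H = "\<lambda>n. bgauss b (\<tau> * h\<^sup>2) (h * real n)"
  have zm [measurable]: "(\<lambda>\<omega>. z (path k \<omega>)) \<in> borel_measurable M"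
    by (rule measurable_compose[OF path_measurable]) simp
  have fm [measurable]: "(\<lambda>\<omega>. g (X j \<omega>)) \<in> borel_measurable M" for g :: "nat \<Rightarrow> real" and j
    by (rule measurable_compose[OF X_measurable]) simp
  have int2: "integrable M (\<lambda>\<omega>. drift_error (X j \<omega>))" for j
    using E drift_error_nonneg by (intro integrable_const_bound[where B = E]) auto
  have int: "integrable M (\<lambda>\<omega>. z (path k \<omega>) * g (X k \<omega>))"
    if "\<And>n. \<bar>g n\<bar> \<le> 1" for g :: "nat \<Rightarrow> real"
    using that z by (intro integrable_const_bound[where B = 1]) (auto simp: abs_mult intro!: mult_le_one)
  have G1: "\<bar>?G n\<bar> \<le> 1" for n
  proof -
    have "?G n \<le> (\<integral> m. 1 \<partial>kernel n)"
      using gauss_le_1[OF b(1)] less_imp_le[OF gauss_pos]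
      by (intro integral_mono measure_pmf.integrable_const_bound[where B = 1]) auto
    moreover have "?G n \<ge> 0" by (intro Bochner_Integration.integral_nonneg less_imp_le[OF gauss_pos])
    ultimately show ?thesis by simp
  qed
  have H1: "\<bar>?H n\<bar> \<le> 1" for n
    using bgauss_nonneg[of b "\<tau> * h\<^sup>2"] bgauss_le_1[OF b(1), of "\<tau> * h\<^sup>2"] tau_bounds by simp
  have "expectation (\<lambda>\<omega>. z (path k \<omega>) * gauss b (h * real (X (Suc k) \<omega>)))
      = expectation (\<lambda>\<omega>. z (path k \<omega>) * ?G (X k \<omega>))"
    using z b gauss_le_1 less_imp_le[OF gauss_pos]
    by (intro expectation_step[of z "\<lambda>m. gauss b (h * real m)"]) auto
  then have "\<bar>expectation (\<lambda>\<omega>. z (path k \<omega>) * gauss b (h * real (X (Suc k) \<omega>)))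
      - expectation (\<lambda>\<omega>. z (path k \<omega>) * ?H (X k \<omega>))\<bar>
    = \<bar>expectation (\<lambda>\<omega>. z (path k \<omega>) * ?G (X k \<omega>) - z (path k \<omega>) * ?H (X k \<omega>))\<bar>"
    using int[of ?G] int[of ?H] G1 H1 by simp
  also have "\<dots> \<le> expectation (\<lambda>\<omega>. \<bar>z (path k \<omega>) * ?G (X k \<omega>) - z (path k \<omega>) * ?H (X k \<omega>)\<bar>)"
    by (rule integral_abs_bound)
  also have "\<dots> \<le> expectation (\<lambda>\<omega>. h\<^sup>2 * (step_const B * (drift_error (X k \<omega>) + h)))"
  proof (rule integral_mono)
    show "integrable M (\<lambda>\<omega>. \<bar>z (path k \<omega>) * ?G (X k \<omega>) - z (path k \<omega>) * ?H (X k \<omega>)\<bar>)"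
      using int[of ?G] int[of ?H] G1 H1 by (intro integrable_abs Bochner_Integration.integrable_diff) auto
    show "integrable M (\<lambda>\<omega>. h\<^sup>2 * (step_const B * (drift_error (X k \<omega>) + h)))"
      using int2[of k] by auto
    fix \<omega>
    have "\<bar>z (path k \<omega>) * ?G (X k \<omega>) - z (path k \<omega>) * ?H (X k \<omega>)\<bar>
        = z (path k \<omega>) * \<bar>?G (X k \<omega>) - ?H (X k \<omega>)\<bar>"
      using z by (simp add: abs_mult flip: right_diff_distrib)
    also have "\<dots> \<le> 1 * (h\<^sup>2 * (step_const B * (drift_error (X k \<omega>) + h)))"
      using z kernel_gauss[OF b h] by (intro mult_mono) auto
    finally show "\<bar>z (path k \<omega>) * ?G (X k \<omega>) - z (path k \<omega>) * ?H (X k \<omega>)\<bar>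
        \<le> h\<^sup>2 * (step_const B * (drift_error (X k \<omega>) + h))" by simp
  qed
  also have "\<dots> = h\<^sup>2 * (step_const B * (expectation (\<lambda>\<omega>. drift_error (X k \<omega>)) + h))"
    using int2[of k] by (simp add: prob_space)
  also have "\<dots> \<le> h\<^sup>2 * (step_const B * (\<eta> + h))"
    using \<eta>[of k] step_const_nonneg[of B] b by (intro mult_left_mono) auto
  finally show ?thesis .
qed

text \<open>The last step turns \<open>gauss b\<close> into a \<open>gauss b'\<close> with a <= 1
  and b' <= b <= B, so the induction hypothesis applies to b' with the same constant and the errors
  simply add up. The \<open>bgauss\<close> factors merge by the semigroup law.\<close>

lemma expectation_gauss_steps:
  fixes z :: "nat list \<Rightarrow> real"
  assumes b: "0 \<le> b" "b \<le> B" and h: "0 < h" "h \<le> 1" and z: "\<And>l. 0 \<le> z l" "\<And>l. z l \<le> 1"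
    and \<eta>: "\<And>j. expectation (\<lambda>\<omega>. drift_error (X j \<omega>)) \<le> \<eta>"
  shows "\<bar>expectation (\<lambda>\<omega>. z (path i \<omega>) * gauss b (h * real (X (i + n) \<omega>)))
      - expectation (\<lambda>\<omega>. z (path i \<omega>) * bgauss b (real n * (\<tau> * h\<^sup>2)) (h * real (X i \<omega>)))\<bar>
    \<le> real n * (h\<^sup>2 * (step_const B * (\<eta> + h)))"
  using b
proof (induction n arbitrary: b)
  case 0
  then show ?case by simp
next
  case (Suc n)
  let ?\<delta> = "h\<^sup>2 * (step_const B * (\<eta> + h))" and ?t = "\<tau> * h\<^sup>2"
  have t: "?t \<ge> 0" using tau_bounds by simp
  define a where "a = exp (- (3 / 2 * ln (1 + b * ?t)))"
  define b' where "b' = b / (1 + b * ?t)"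
  have a: "0 \<le> a" "a \<le> 1" using Suc.prems t by (auto simp: a_def)
  have b': "0 \<le> b'" "b' \<le> B"
    using Suc.prems t divide_one_plus_le[of b ?t] by (auto simp: b'_def)
  have bg: "bgauss b (?t + u) x = a * bgauss b' u x" if "u \<ge> 0" for u x
    unfolding a_def b'_def using Suc.prems t that by (intro bgauss_add)
  \<comment> \<open>The one-step bound wants a function of the path up to i + n;
    \<open>take (Suc i)\<close> recovers the path up to i from it.\<close>
  have "\<bar>expectation (\<lambda>\<omega>. (z \<circ> take (Suc i)) (path (i + n) \<omega>) * gauss b (h * real (X (Suc (i + n)) \<omega>)))
      - expectation (\<lambda>\<omega>. (z \<circ> take (Suc i)) (path (i + n) \<omega>) * bgauss b ?t (h * real (X (i + n) \<omega>)))\<bar> \<le> ?\<delta>"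
    using z by (intro expectation_gauss_step[OF Suc.prems h _ _ \<eta>]) auto
  then have 1: "\<bar>expectation (\<lambda>\<omega>. z (path i \<omega>) * gauss b (h * real (X (i + Suc n) \<omega>)))
      - a * expectation (\<lambda>\<omega>. z (path i \<omega>) * gauss b' (h * real (X (i + n) \<omega>)))\<bar> \<le> ?\<delta>"
    using bg[of 0] by (simp add: take_path mult.left_commute)
  have "a * \<bar>expectation (\<lambda>\<omega>. z (path i \<omega>) * gauss b' (h * real (X (i + n) \<omega>)))
      - expectation (\<lambda>\<omega>. z (path i \<omega>) * bgauss b' (real n * ?t) (h * real (X i \<omega>)))\<bar>
    \<le> 1 * (real n * ?\<delta>)"
    using a Suc.IH[OF b'] by (intro mult_mono) auto
  then have 2: "\<bar>a * expectation (\<lambda>\<omega>. z (path i \<omega>) * gauss b' (h * real (X (i + n) \<omega>)))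
      - a * expectation (\<lambda>\<omega>. z (path i \<omega>) * bgauss b' (real n * ?t) (h * real (X i \<omega>)))\<bar> \<le> real n * ?\<delta>"
    using a by (simp add: abs_mult flip: right_diff_distrib)
  have "a * expectation (\<lambda>\<omega>. z (path i \<omega>) * bgauss b' (real n * ?t) (h * real (X i \<omega>)))
      = expectation (\<lambda>\<omega>. a * (z (path i \<omega>) * bgauss b' (real n * ?t) (h * real (X i \<omega>))))"
    by simp
  also have "\<dots> = expectation (\<lambda>\<omega>. z (path i \<omega>) * bgauss b (?t + real n * ?t) (h * real (X i \<omega>)))"
    unfolding bg[OF mult_nonneg_nonneg[OF of_nat_0_le_iff t]] by (simp only: mult.left_commute)
  also have "?t + real n * ?t = real (Suc n) * ?t" by (simp add: algebra_simps)
  finally have 3: "a * expectation (\<lambda>\<omega>. z (path i \<omega>) * bgauss b' (real n * ?t) (h * real (X i \<omega>)))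
      = expectation (\<lambda>\<omega>. z (path i \<omega>) * bgauss b (real (Suc n) * ?t) (h * real (X i \<omega>)))" .
  have "real (Suc n) * ?\<delta> = ?\<delta> + real n * ?\<delta>" by (simp add: algebra_simps)
  then show ?case using 1 2 unfolding 3 by linarith
qed

end

section \<open>The initial law\<close>

text \<open>The series is the integral of a step function of mesh h, which opens Riemann sums on a
  half-line to dominated convergence.\<close>

lemma nn_integral_floor:
  fixes F :: "nat \<Rightarrow> ennreal"
  assumes h: "h > 0"
  shows "(\<integral>\<^sup>+ x. F (nat \<lfloor>x / h\<rfloor>) * indicator {0..} x \<partial>lborel) = ennreal h * (\<Sum>n. F n)"
proof -
  let ?I = "\<lambda>n. {real n * h..<(real n + 1) * h}"
  have eq: "F (nat \<lfloor>x / h\<rfloor>) * indicator {0..} x = (\<Sum>n. F n * indicator (?I n) x)" for x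
  proof (cases "x \<ge> 0")
    case True
    define m where "m = nat \<lfloor>x / h\<rfloor>"
    have mem: "x \<in> ?I n \<longleftrightarrow> n = m" for n
    proof -
      have "x \<in> ?I n \<longleftrightarrow> real n \<le> x / h \<and> x / h < real n + 1"
        using h by (simp add: field_simps)
      also have "\<dots> \<longleftrightarrow> \<lfloor>x / h\<rfloor> = int n"
        by (simp add: floor_eq_iff)
      also have "\<dots> \<longleftrightarrow> n = m"
        using True h by (auto simp: m_def)
      finally show ?thesis .
    qed
    have ind: "indicator (?I n) x = (if n = m then 1 else 0 :: ennreal)" for n
      by (simp only: indicator_def mem of_bool_def)
    have "(\<Sum>n. F n * indicator (?I n) x) = (\<Sum>n\<in>{m}. F n * indicator (?I n) x)"
      unfolding ind by (rule suminf_finite) auto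
    also have "\<dots> = F m"
      unfolding ind by simp
    finally show ?thesis using True by (simp add: m_def)
  next
    case False
    then have "x \<notin> ?I n" for n
      using h by (auto simp: not_le intro: less_le_trans)
    then show ?thesis using False by simp
  qed
  have "(\<integral>\<^sup>+ x. F (nat \<lfloor>x / h\<rfloor>) * indicator {0..} x \<partial>lborel) = (\<Sum>n. \<integral>\<^sup>+ x. F n * indicator (?I n) x \<partial>lborel)"
    unfolding eq by (rule nn_integral_suminf) simp
  also have "\<dots> = (\<Sum>n. ennreal h * F n)"
  proof (rule suminf_cong)
    fix n
    have "(real n + 1) * h - real n * h = h" by (simp add: algebra_simps)
    then have "emeasure lborel (?I n) = ennreal h" using h by (simp add: mult_right_mono)
    then show "(\<integral>\<^sup>+ x. F n * indicator (?I n) x \<partial>lborel) = ennreal h * F n"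
      by (simp add: nn_integral_cmult_indicator mult.commute)
  qed
  finally show ?thesis by simp
qed

lemma integral_floor:
  fixes F :: "nat \<Rightarrow> real"
  assumes h: "h > 0" and F: "\<And>n. F n \<ge> 0" and sm: "summable F"
  shows "(\<integral> x. F (nat \<lfloor>x / h\<rfloor>) * indicator {0..} x \<partial>lborel) = h * (\<Sum>n. F n)"
proof -
  have "(\<integral> x. F (nat \<lfloor>x / h\<rfloor>) * indicator {0..} x \<partial>lborel)
      = enn2real (\<integral>\<^sup>+ x. ennreal (F (nat \<lfloor>x / h\<rfloor>) * indicator {0..} x) \<partial>lborel)"
  proof (rule integral_eq_nn_integral)
    have "(\<lambda>x. F (nat \<lfloor>x / h\<rfloor>)) \<in> borel_measurable borel"
      by (rule measurable_compose[of "\<lambda>x. nat \<lfloor>x / h\<rfloor>" borel "count_space UNIV" F]) auto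
    then show "(\<lambda>x. F (nat \<lfloor>x / h\<rfloor>) * indicator {0..} x) \<in> borel_measurable lborel" by simp
  qed (use F in simp)
  also have "(\<integral>\<^sup>+ x. ennreal (F (nat \<lfloor>x / h\<rfloor>) * indicator {0..} x) \<partial>lborel)
      = (\<integral>\<^sup>+ x. ennreal (F (nat \<lfloor>x / h\<rfloor>)) * indicator {0..} x \<partial>lborel)"
    by (intro nn_integral_cong) (auto simp: indicator_def)
  also have "\<dots> = ennreal h * ennreal (\<Sum>n. F n)"
    by (simp add: nn_integral_floor[OF h, of "\<lambda>n. ennreal (F n)"] suminf_ennreal2[OF F sm])
  also have "enn2real (ennreal h * ennreal (\<Sum>n. F n)) = h * (\<Sum>n. F n)"
    using h suminf_nonneg[OF sm F] by (simp add: enn2real_mult)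
  finally show ?thesis .
qed

lemma integrable_exp_halfline:
  assumes "a > 0"
  shows "integrable lborel (\<lambda>x. exp (- (a * x)) * indicator {0..} x :: real)"
proof -
  have "has_bochner_integral lborel (\<lambda>x. x ^ 0 * exp (- x) * indicator {0..} x :: real) (fact 0)"
    by (rule has_bochner_integral_I0i_power_exp_m')
  then have "integrable lborel (\<lambda>x. exp (- x) * indicator {0..} x :: real)"
    by (simp add: has_bochner_integral_iff)
  then have "integrable lborel (\<lambda>x. exp (- (0 + a * x)) * indicator {0..} (0 + a * x) :: real)"
    using assms by (subst (asm) lborel_integrable_real_affine_iff[of a _ 0, symmetric]) auto
  moreover have "(indicator {0..} (a * x) :: real) = indicator {0..} x" for x
    using assms by (auto simp: indicator_def zero_le_mult_iff)
  ultimately show ?thesis by simp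
qed

context chain_params
begin

text \<open>One factor h is the mesh and the other scales s_n: with n about x / h, h s_n tends to K
  x.\<close>

lemma weighted_riemann_sum:
  fixes h :: "nat \<Rightarrow> real" and g :: "real \<Rightarrow> real"
  assumes c: "c > 0" and h: "\<And>N. 0 < h N" "\<And>N. h N \<le> 1" "h \<longlonglongrightarrow> 0"
    and g: "continuous_on UNIV g" "\<And>x. 0 \<le> g x" "\<And>x. g x \<le> 1"
    and sm: "\<And>N. summable (\<lambda>n. s (int n) * (exp (- (c * (h N * real n))) * g (h N * real n)))"
  shows "(\<lambda>N. (h N)\<^sup>2 * (\<Sum>n. s (int n) * (exp (- (c * (h N * real n))) * g (h N * real n))))
    \<longlonglongrightarrow> K * (\<integral> x. x * exp (- (c * x)) * g x * indicator {0..} x \<partial>lborel)"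
proof -
  define F where "F N n = h N * (s (int n) * (exp (- (c * (h N * real n))) * g (h N * real n)))" for N n
  define m where "m N x = nat \<lfloor>x / h N\<rfloor>" for N x
  have m_bounds: "h N * real (m N x) \<le> x" "x - h N \<le> h N * real (m N x)" if "x \<ge> 0" for N x
  proof -
    have m: "real (m N x) = of_int \<lfloor>x / h N\<rfloor>" using that h(1)[of N] by (simp add: m_def)
    have "of_int \<lfloor>x / h N\<rfloor> * h N \<le> x"
      using of_int_floor_le[of "x / h N"] pos_le_divide_eq[OF h(1)] by blast
    then show "h N * real (m N x) \<le> x" by (simp add: m mult.commute)
    have "x / h N < of_int \<lfloor>x / h N\<rfloor> + 1" by linarith
    then have "x < (of_int \<lfloor>x / h N\<rfloor> + 1) * h N"
      using pos_divide_less_eq[OF h(1)] by blast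
    then show "x - h N \<le> h N * real (m N x)" by (simp add: m algebra_simps)
  qed
  have F0: "F N n \<ge> 0" for N n
    using h(1)[of N] s_pos[of n] g(2) by (simp add: F_def less_imp_le)
  have sF: "summable (F N)" for N
    unfolding F_def by (intro summable_mult sm)
  have int_eq: "(\<integral> x. F N (m N x) * indicator {0..} x \<partial>lborel)
      = (h N)\<^sup>2 * (\<Sum>n. s (int n) * (exp (- (c * (h N * real n))) * g (h N * real n)))" for N
    unfolding m_def integral_floor[OF h(1) F0 sF]
    unfolding F_def using sm[of N] by (subst suminf_mult) (auto simp: power2_eq_square)
  have [measurable]: "g \<in> borel_measurable borel" using g(1) by (rule borel_measurable_continuous_onI)
  have [measurable]: "(\<lambda>x. F N (m N x)) \<in> borel_measurable borel" for N
    unfolding m_def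
    by (rule measurable_compose[of "\<lambda>x. nat \<lfloor>x / h N\<rfloor>" borel "count_space UNIV" "F N"]) auto
  \<comment> \<open>Rounding moves x by at most h <= 1, costing exp c, and h s_n <= K (x + 1). Half
    of the exponential decay absorbs x + 1, as (x + 1) exp (-c x / 2) <= 2 / c + 1; the other half
    is the integrable majorant.\<close>
  define C where "C = K * exp c * (2 / c + 1)"
  have "(\<lambda>N. \<integral> x. F N (m N x) * indicator {0..} x \<partial>lborel)
      \<longlonglongrightarrow> (\<integral> x. K * (x * exp (- (c * x)) * g x) * indicator {0..} x \<partial>lborel)"
  proof (rule integral_dominated_convergence[where w = "\<lambda>x. C * (exp (- (c / 2 * x)) * indicator {0..} x)"])
    show "integrable lborel (\<lambda>x. C * (exp (- (c / 2 * x)) * indicator {0..} x))"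
      using c by (intro integrable_mult_right integrable_exp_halfline) auto
    show "AE x in lborel. (\<lambda>N. F N (m N x) * indicator {0..} x)
        \<longlonglongrightarrow> K * (x * exp (- (c * x)) * g x) * indicator {0..} x"
    proof (rule AE_I2)
      fix x :: real
      show "(\<lambda>N. F N (m N x) * indicator {0..} x)
        \<longlonglongrightarrow> K * (x * exp (- (c * x)) * g x) * indicator {0..} x"
      proof (cases "x \<ge> 0")
        case x: True
        have hm: "(\<lambda>N. h N * real (m N x)) \<longlonglongrightarrow> x"
        proof (rule tendsto_sandwich[OF _ _ _ tendsto_const])
          show "(\<lambda>N. x - h N) \<longlonglongrightarrow> x" using tendsto_diff[OF tendsto_const h(3), of x] by simp
        qed (use m_bounds[OF x] in auto)
        have gl: "(\<lambda>N. g (h N * real (m N x))) \<longlonglongrightarrow> g x"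
          using g(1) hm by (intro isCont_tendsto_compose[OF _ hm]) (simp add: continuous_on_eq_continuous_at)
        have "(\<lambda>N. h N * s (int (m N x))) \<longlonglongrightarrow> K * x"
        \<comment> \<open>At x = 0 the index stays 0 instead of tending to infinity, so the
          asymptotics of s do not apply and h s_0 -> 0 is used directly.\<close>
        proof (cases "x = 0")
          case True
          then have "m N x = 0" for N by (simp add: m_def)
          then show ?thesis using True h(3) by (simp add: s_0)
        next
          case False
          then have "x > 0" using x by simp
          have "filterlim (\<lambda>N. x / h N) at_top sequentially"
            unfolding divide_inverse using h
            by (intro filterlim_tendsto_pos_mult_at_top[OF tendsto_const \<open>x > 0\<close>] filterlim_inverse_at_top) auto
          then have "filterlim (\<lambda>N. m N x) sequentially sequentially"
            unfolding m_def
            by (intro filterlim_compose[OF filterlim_nat_sequentially]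
                filterlim_compose[OF filterlim_floor_sequentially])
          then have "(\<lambda>N. s (int (m N x)) / (real (m N x) + 1)) \<longlonglongrightarrow> K"
            by (rule filterlim_compose[OF s_over_n_tendsto])
          then have "(\<lambda>N. s (int (m N x)) / (real (m N x) + 1) * (h N * real (m N x) + h N)) \<longlonglongrightarrow> K * (x + 0)"
            by (intro tendsto_intros hm h(3))
          moreover have "s (int k) / (real k + 1) * (h N * real k + h N) = h N * s (int k)" for k N
            by (simp add: field_simps add_nonneg_eq_0_iff)
          ultimately show ?thesis by simp
        qed
        moreover have "(\<lambda>N. exp (- (c * (h N * real (m N x))))) \<longlonglongrightarrow> exp (- (c * x))"
          by (intro tendsto_intros hm)
        ultimately have "(\<lambda>N. (h N * s (int (m N x))) * (exp (- (c * (h N * real (m N x)))) * g (h N * real (m N x))))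
            \<longlonglongrightarrow> (K * x) * (exp (- (c * x)) * g x)"
          by (rule tendsto_mult[OF _ tendsto_mult[OF _ gl]])
        then show ?thesis using x by (simp add: F_def mult.assoc)
      qed simp
    qed
    show "AE x in lborel. norm (F N (m N x) * indicator {0..} x) \<le> C * (exp (- (c / 2 * x)) * indicator {0..} x)"
      for N
    proof (rule AE_I2)
      fix x :: real
      show "norm (F N (m N x) * indicator {0..} x) \<le> C * (exp (- (c / 2 * x)) * indicator {0..} x)"
      proof (cases "x \<ge> 0")
        case x: True
        let ?n = "m N x"
        have 1: "h N * s (int ?n) \<le> K * (x + 1)"
        proof -
          have "h N * s (int ?n) \<le> h N * (K * (real ?n + 1))"
            using h(1)[of N] s_le_K by (intro mult_left_mono) auto
          also have "\<dots> = K * (h N * real ?n + h N)" by (simp add: algebra_simps)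
          also have "\<dots> \<le> K * (x + 1)"
            using m_bounds(1)[OF x, of N] h(2)[of N] K_ge_1 by (intro mult_left_mono) auto
          finally show ?thesis .
        qed
        have 2: "exp (- (c * (h N * real ?n))) * g (h N * real ?n) \<le> exp (c - c * x)"
        proof -
          have "c * (x - 1) \<le> c * (h N * real ?n)"
            using m_bounds(2)[OF x, of N] h(2)[of N] c by (intro mult_left_mono) auto
          then have "exp (- (c * (h N * real ?n))) \<le> exp (c - c * x)" by (simp add: algebra_simps)
          then have "exp (- (c * (h N * real ?n))) * g (h N * real ?n) \<le> exp (c - c * x) * 1"
            using g by (intro mult_mono) auto
          then show ?thesis by simp
        qed
        have 3: "(x + 1) * exp (- (c / 2 * x)) \<le> 2 / c + 1"
        proof -
          have "c / 2 * x * exp (- (c / 2 * x)) \<le> 1" by (rule mult_exp_minus_le_1)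
          then have "x * exp (- (c / 2 * x)) \<le> 2 / c" using c by (simp add: field_simps)
          moreover have "exp (- (c / 2 * x)) \<le> 1" using c x by simp
          ultimately show ?thesis unfolding distrib_right mult_1_left by linarith
        qed
        have "F N ?n = (h N * s (int ?n)) * (exp (- (c * (h N * real ?n))) * g (h N * real ?n))"
          by (simp add: F_def)
        also have "\<dots> \<le> K * (x + 1) * exp (c - c * x)"
          using x K_ge_1 g(2) by (intro mult_mono[OF 1 2]) auto
        also have "\<dots> = K * exp c * ((x + 1) * exp (- (c / 2 * x))) * exp (- (c / 2 * x))"
          by (simp add: exp_diff exp_minus field_simps flip: exp_add)
        also have "\<dots> \<le> K * exp c * (2 / c + 1) * exp (- (c / 2 * x))"
          using 3 K_ge_1 by (intro mult_right_mono mult_left_mono) auto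
        finally show ?thesis
          using x F0[of N ?n] K_ge_1 by (simp add: C_def)
      qed simp
    qed
  qed measurable
  then show ?thesis
    unfolding int_eq by (simp add: mult.assoc)
qed

end

context walk
begin

lemma init_prob_nonneg: "init_prob q \<sigma> \<rho> n \<ge> 0"
  using prob_X_0[of n] measure_nonneg[of M] by metis

lemma expectation_X_0_sums:
  fixes f :: "nat \<Rightarrow> real"
  assumes f: "\<And>n. 0 \<le> f n" "\<And>n. f n \<le> 1"
  shows "(\<lambda>n. init_prob q \<sigma> \<rho> n * f n) sums expectation (\<lambda>\<omega>. f (X 0 \<omega>))"
proof -
  have sm: "summable (\<lambda>n. init_prob q \<sigma> \<rho> n * f n)"
    using f init_prob_nonneg
    by (intro summable_comparison_test'[OF sums_summable[OF init_prob_sums]])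
       (auto simp: abs_mult mult_left_le)
  have "(\<integral>\<^sup>+ \<omega>. ennreal (f (X 0 \<omega>)) \<partial>M)
      = (\<integral>\<^sup>+ n. emeasure M {\<omega> \<in> space M. X 0 \<omega> = n} * ennreal (f n) \<partial>count_space UNIV)"
    by (rule nn_integral_countable_range[OF X_measurable])
  also have "\<dots> = (\<Sum>n. ennreal (init_prob q \<sigma> \<rho> n * f n))"
    by (simp add: nn_integral_count_space_nat emeasure_eq_measure prob_X_0 ennreal_mult init_prob_nonneg f)
  also have "\<dots> = ennreal (\<Sum>n. init_prob q \<sigma> \<rho> n * f n)"
    using f init_prob_nonneg by (intro suminf_ennreal2[OF _ sm]) auto
  finally have "expectation (\<lambda>\<omega>. f (X 0 \<omega>)) = (\<Sum>n. init_prob q \<sigma> \<rho> n * f n)"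
    using f init_prob_nonneg suminf_nonneg[OF sm] by (subst integral_eq_nn_integral) auto
  then show ?thesis using sm by (simp add: summable_sums)
qed

end

section \<open>Weak convergence from Gaussian moments\<close>

text \<open>Polynomials on the cube. At w_i = exp (- y_i^2 / 2) a monomial is a product of Gaussians
  with natural parameters, exactly the assumed moments.\<close>

inductive cube_poly :: "(real ^ 'd::finite \<Rightarrow> real) \<Rightarrow> bool" where
  monomial: "cube_poly (\<lambda>w. c * (\<Prod>i\<in>UNIV. w $ i ^ k i))"
| sum: "cube_poly f \<Longrightarrow> cube_poly g \<Longrightarrow> cube_poly (\<lambda>w. f w + g w)"

lemma cube_poly_mult:
  assumes "cube_poly f" "cube_poly g"
  shows "cube_poly (\<lambda>w. f w * g w)"
  using assms
proof (induction arbitrary: g rule: cube_poly.induct)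
  case (monomial c k)
  then show ?case
  proof (induction rule: cube_poly.induct)
    case (monomial c' k')
    have "(\<lambda>w. (c * (\<Prod>i\<in>UNIV. w $ i ^ k i)) * (c' * (\<Prod>i\<in>UNIV. w $ i ^ k' i)))
        = (\<lambda>w. (c * c') * (\<Prod>i\<in>UNIV. w $ i ^ (k i + k' i)))"
      by (simp add: power_add prod.distrib fun_eq_iff)
    then show ?case by (simp only: cube_poly.monomial)
  next
    case (sum f g)
    then show ?case using cube_poly.sum by (simp add: distrib_left)
  qed
next
  case (sum f f')
  show ?case
    unfolding distrib_right by (intro cube_poly.sum sum.IH sum.prems)
qed

lemma cube_poly_const: "cube_poly (\<lambda>w. c)"
  using cube_poly.monomial[of c "\<lambda>_. 0"] by simp

lemma cube_poly_coordinate: "cube_poly (\<lambda>w. w $ (i :: 'd::finite))"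
proof -
  have "(\<Prod>j\<in>UNIV. w $ j ^ (if j = i then 1 else 0)) = w $ i" for w :: "real ^ 'd"
    by (simp add: if_distrib prod.delta cong: if_cong)
  then show ?thesis
    using cube_poly.monomial[of 1 "\<lambda>j. if j = i then 1 else 0"] by simp
qed

lemma continuous_on_cube_poly: "cube_poly f \<Longrightarrow> continuous_on A f"
  by (induction rule: cube_poly.induct) (auto intro!: continuous_intros)

lemma continuous_on_cube_approx:
  fixes F :: "real ^ 'd::finite \<Rightarrow> real"
  assumes "continuous_on UNIV F" "e > 0"
  shows "\<exists>p. cube_poly p \<and> (\<forall>w\<in>cbox 0 1. \<bar>F w - p w\<bar> < e)"
proof (rule Stone_Weierstrass_HOL[of "cbox 0 1" cube_poly])
  show "\<exists>f. cube_poly f \<and> f x \<noteq> f y" if xy: "x \<in> cbox 0 1 \<and> y \<in> cbox 0 1 \<and> x \<noteq> y" for x y :: "real ^ 'd"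
  proof -
    obtain i where "x $ i \<noteq> y $ i" using xy by (auto simp: vec_eq_iff)
    then show ?thesis using cube_poly_coordinate[of i] by blast
  qed
  show "continuous_on (cbox 0 1) F" using assms(1) by (rule continuous_on_subset) simp
qed (use assms in \<open>auto intro: cube_poly_const continuous_on_cube_poly cube_poly.sum cube_poly_mult\<close>)

definition gauss_vec :: "real ^ 'd::finite \<Rightarrow> real ^ 'd" where
  "gauss_vec y = (\<chi> i. gauss 1 (y $ i))"

lemma gauss_power: "gauss 1 x ^ k = gauss (real k) x"
  by (simp add: gauss_def exp_of_nat_mult[symmetric])

lemma gauss_vec_in_cube: "gauss_vec y \<in> cbox 0 1"
  by (simp add: gauss_vec_def mem_box_cart less_imp_le[OF gauss_pos] gauss_le_1)

lemma continuous_on_gauss_vec: "continuous_on UNIV gauss_vec"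
  unfolding gauss_vec_def gauss_def by (intro continuous_intros) auto

lemma gauss_vec_measurable [measurable]: "gauss_vec \<in> borel_measurable borel"
  by (rule borel_measurable_continuous_onI[OF continuous_on_gauss_vec])

lemma continuous_on_cube_bounded:
  fixes F :: "real ^ 'd::finite \<Rightarrow> real"
  assumes "continuous_on UNIV F"
  obtains b where "b > 0" "\<And>y. \<bar>F (gauss_vec y)\<bar> \<le> b"
proof -
  have "bounded (F ` cbox 0 1)"
    using assms by (intro compact_imp_bounded compact_continuous_image) (auto intro: continuous_on_subset)
  then obtain b where "b > 0" "\<And>w. w \<in> cbox 0 1 \<Longrightarrow> norm (F w) \<le> b"
    unfolding bounded_pos by auto
  then show ?thesis using that[of b] gauss_vec_in_cube by (metis real_norm_def)
qed

lemma integrable_cube: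
  fixes F :: "real ^ 'd::finite \<Rightarrow> real"
  assumes "continuous_on UNIV F" "prob_space P" and [measurable]: "Y \<in> borel_measurable P"
  shows "integrable P (\<lambda>\<omega>. F (gauss_vec (Y \<omega>)))"
proof -
  interpret prob_space P by fact
  obtain b where b: "\<And>y. \<bar>F (gauss_vec y)\<bar> \<le> b" using continuous_on_cube_bounded[OF assms(1)] by blast
  have [measurable]: "F \<in> borel_measurable borel" by (rule borel_measurable_continuous_onI[OF assms(1)])
  show ?thesis by (rule integrable_const_bound[where B = b]) (use b in auto)
qed

text \<open>Linearity extends the moments to polynomials, and uniform approximation on the compact
  cube to continuous F, with the same error for every N and for the limit.\<close>

lemma tendsto_expectation_cube:
  fixes Y :: "nat \<Rightarrow> 'a \<Rightarrow> real ^ 'd::finite" and Z :: "'b \<Rightarrow> real ^ 'd"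
  assumes P: "\<And>N. prob_space (P N)" and Y: "\<And>N. Y N \<in> borel_measurable (P N)"
    and Q: "prob_space Q" and Z: "Z \<in> borel_measurable Q"
    and moments: "\<And>k :: 'd \<Rightarrow> nat. (\<lambda>N. \<integral> \<omega>. (\<Prod>i\<in>UNIV. gauss (real (k i)) (Y N \<omega> $ i)) \<partial>P N)
      \<longlonglongrightarrow> (\<integral> \<omega>. (\<Prod>i\<in>UNIV. gauss (real (k i)) (Z \<omega> $ i)) \<partial>Q)"
    and F: "continuous_on UNIV (F :: real ^ 'd \<Rightarrow> real)"
  shows "(\<lambda>N. \<integral> \<omega>. F (gauss_vec (Y N \<omega>)) \<partial>P N) \<longlonglongrightarrow> (\<integral> \<omega>. F (gauss_vec (Z \<omega>)) \<partial>Q)"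
proof -
  have poly: "(\<lambda>N. \<integral> \<omega>. p (gauss_vec (Y N \<omega>)) \<partial>P N) \<longlonglongrightarrow> (\<integral> \<omega>. p (gauss_vec (Z \<omega>)) \<partial>Q)"
    if "cube_poly p" for p
    using that
  proof (induction rule: cube_poly.induct)
    case (monomial c k)
    show ?case
      using tendsto_mult[OF tendsto_const moments[of k], of c]
      by (simp add: gauss_vec_def gauss_power)
  next
    case (sum f g)
    have "integrable (P N) (\<lambda>\<omega>. f (gauss_vec (Y N \<omega>)))" "integrable (P N) (\<lambda>\<omega>. g (gauss_vec (Y N \<omega>)))"
      "integrable Q (\<lambda>\<omega>. f (gauss_vec (Z \<omega>)))" "integrable Q (\<lambda>\<omega>. g (gauss_vec (Z \<omega>)))" for N
      using sum.hyps P Y Q Z by (auto intro!: integrable_cube continuous_on_cube_poly)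
    then show ?case using tendsto_add[OF sum.IH] by simp
  qed
  show ?thesis
  proof (rule LIMSEQ_I)
    fix e :: real assume e: "e > 0"
    then obtain p where p: "cube_poly p" "\<And>w. w \<in> cbox 0 1 \<Longrightarrow> \<bar>F w - p w\<bar> < e / 4"
      using continuous_on_cube_approx[OF F, of "e / 4"] by auto
    have close: "\<bar>(\<integral> \<omega>. F (gauss_vec (U \<omega>)) \<partial>R) - (\<integral> \<omega>. p (gauss_vec (U \<omega>)) \<partial>R)\<bar> \<le> e / 4"
      if R: "prob_space R" and U: "U \<in> borel_measurable R" for R and U :: "'c \<Rightarrow> real ^ 'd"
    proof -
      interpret prob_space R by fact
      have i: "integrable R (\<lambda>\<omega>. F (gauss_vec (U \<omega>)))" "integrable R (\<lambda>\<omega>. p (gauss_vec (U \<omega>)))"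
        using F p R U by (auto intro!: integrable_cube continuous_on_cube_poly)
      have "\<bar>(\<integral> \<omega>. F (gauss_vec (U \<omega>)) \<partial>R) - (\<integral> \<omega>. p (gauss_vec (U \<omega>)) \<partial>R)\<bar>
          \<le> (\<integral> \<omega>. \<bar>F (gauss_vec (U \<omega>)) - p (gauss_vec (U \<omega>))\<bar> \<partial>R)"
        using i integral_abs_bound[of R "\<lambda>\<omega>. F (gauss_vec (U \<omega>)) - p (gauss_vec (U \<omega>))"] by simp
      also have "\<dots> \<le> (\<integral> \<omega>. e / 4 \<partial>R)"
        using i p(2)[OF gauss_vec_in_cube] by (intro integral_mono) (auto intro: less_imp_le)
      finally show ?thesis by (simp add: prob_space)
    qed
    obtain N0 where N0: "\<And>N. N \<ge> N0 \<Longrightarrow>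
        norm ((\<integral> \<omega>. p (gauss_vec (Y N \<omega>)) \<partial>P N) - (\<integral> \<omega>. p (gauss_vec (Z \<omega>)) \<partial>Q)) < e / 4"
      using LIMSEQ_D[OF poly[OF p(1)], of "e / 4"] e by auto
    show "\<exists>N0. \<forall>N\<ge>N0. norm ((\<integral> \<omega>. F (gauss_vec (Y N \<omega>)) \<partial>P N) - (\<integral> \<omega>. F (gauss_vec (Z \<omega>)) \<partial>Q)) < e"
    proof (intro exI allI impI)
      fix N assume "N \<ge> N0"
      then show "norm ((\<integral> \<omega>. F (gauss_vec (Y N \<omega>)) \<partial>P N) - (\<integral> \<omega>. F (gauss_vec (Z \<omega>)) \<partial>Q)) < e"
        using close[OF P Y, of N] close[OF Q Z] N0[of N] e unfolding real_norm_def by linarith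
    qed
  qed
qed

text \<open>Capping at \<open>\<delta>\<close> keeps the inverse of \<open>gauss 1\<close> continuous on the closed cube; the cutoff is at
  least 1 where the capping matters.\<close>

definition inv_gauss :: "real \<Rightarrow> real \<Rightarrow> real" where
  "inv_gauss \<delta> w = sqrt (- 2 * ln (max \<delta> (min 1 w)))"

definition tail_cutoff :: "real \<Rightarrow> real ^ 'd::finite \<Rightarrow> real" where
  "tail_cutoff \<delta> w = (\<Sum>i\<in>UNIV. max 0 (min 1 (2 - w $ i / \<delta>)))"

lemma inv_gauss_gauss:
  assumes "x \<ge> 0" "gauss 1 x \<ge> \<delta>"
  shows "inv_gauss \<delta> (gauss 1 x) = x"
proof -
  have "max \<delta> (min 1 (gauss 1 x)) = gauss 1 x" using assms gauss_le_1[of 1 x] by simp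
  then show ?thesis using assms by (simp add: inv_gauss_def gauss_def)
qed

lemma tail_cutoff_nonneg: "tail_cutoff \<delta> w \<ge> 0"
  unfolding tail_cutoff_def by (intro sum_nonneg) simp

lemma continuous_on_tail_cutoff: "continuous_on UNIV (tail_cutoff \<delta>)"
  unfolding tail_cutoff_def divide_inverse by (intro continuous_intros)

lemma continuous_on_inv_gauss:
  assumes "\<delta> > 0"
  shows "continuous_on UNIV (inv_gauss \<delta>)"
proof -
  have "max \<delta> (min 1 w) \<noteq> 0" for w using assms by linarith
  then show ?thesis unfolding inv_gauss_def by (intro continuous_intros) auto
qed

text \<open>If no coordinate is capped, the inverse is exact; here y >= 0 matters, since
  \<open>gauss 1\<close> is even. Otherwise some summand of the cutoff equals 1 and the trivial
  bound 2 B suffices.\<close>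

lemma truncated_inverse_error:
  fixes f :: "real ^ 'd::finite \<Rightarrow> real"
  assumes f: "\<And>y. \<bar>f y\<bar> \<le> B" and y: "\<And>i. y $ i \<ge> 0" and \<delta>: "\<delta> > 0"
  shows "\<bar>f y - f (\<chi> i. inv_gauss \<delta> (gauss_vec y $ i))\<bar> \<le> 2 * B * tail_cutoff \<delta> (gauss_vec y)"
proof (cases "\<forall>i. gauss 1 (y $ i) \<ge> \<delta>")
  case True
  then have "(\<chi> i. inv_gauss \<delta> (gauss_vec y $ i)) = y"
    using y by (simp add: gauss_vec_def inv_gauss_gauss vec_eq_iff)
  moreover have "B \<ge> 0" using f[of y] by linarith
  ultimately show ?thesis using tail_cutoff_nonneg[of \<delta> "gauss_vec y"] by simp
next
  case False
  then obtain i where i: "gauss 1 (y $ i) < \<delta>" by (auto simp: not_le)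
  have B: "B \<ge> 0" using f[of y] by linarith
  have "gauss 1 (y $ i) / \<delta> < 1" using i \<delta> by simp
  then have "1 = max 0 (min 1 (2 - gauss_vec y $ i / \<delta>))"
    unfolding gauss_vec_def by simp
  also have "\<dots> \<le> tail_cutoff \<delta> (gauss_vec y)"
    unfolding tail_cutoff_def by (rule member_le_sum) auto
  finally have "2 * B * 1 \<le> 2 * B * tail_cutoff \<delta> (gauss_vec y)"
    using B by (intro mult_left_mono) auto
  moreover have "\<bar>f y - f (\<chi> i. inv_gauss \<delta> (gauss_vec y $ i))\<bar> \<le> 2 * B"
    using f[of y] f[of "\<chi> i. inv_gauss \<delta> (gauss_vec y $ i)"] by linarith
  ultimately show ?thesis by linarith
qed

text \<open>\<open>gauss 1\<close> never vanishes, so for each outcome the cutoff is eventually 0.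
  This is tightness of the single limit law.\<close>

lemma tail_cutoff_expectation_tendsto:
  fixes Z :: "'b \<Rightarrow> real ^ 'd::finite"
  assumes Q: "prob_space Q" and Z [measurable]: "Z \<in> borel_measurable Q"
  shows "(\<lambda>n. \<integral> \<omega>. tail_cutoff (1 / (real n + 1)) (gauss_vec (Z \<omega>)) \<partial>Q) \<longlonglongrightarrow> 0"
proof -
  interpret prob_space Q by fact
  have [measurable]: "(tail_cutoff \<delta> :: real ^ 'd \<Rightarrow> real) \<in> borel_measurable borel" for \<delta>
    by (rule borel_measurable_continuous_onI[OF continuous_on_tail_cutoff])
  have "(\<lambda>n. \<integral> \<omega>. tail_cutoff (1 / (real n + 1)) (gauss_vec (Z \<omega>)) \<partial>Q) \<longlonglongrightarrow> (\<integral> \<omega>. 0 \<partial>Q)"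
  proof (rule integral_dominated_convergence[where w = "\<lambda>_. real CARD('d)"])
    show "AE \<omega> in Q. (\<lambda>n. tail_cutoff (1 / (real n + 1)) (gauss_vec (Z \<omega>))) \<longlonglongrightarrow> 0"
    proof (rule AE_I2)
      fix \<omega>
      have "(\<lambda>n. max 0 (min 1 (2 - gauss_vec (Z \<omega>) $ i / (1 / (real n + 1))))) \<longlonglongrightarrow> 0" for i
      proof (rule tendsto_eventually)
        have pos: "gauss_vec (Z \<omega>) $ i > 0" by (simp add: gauss_vec_def gauss_pos)
        obtain n0 :: nat where n0: "2 / gauss_vec (Z \<omega>) $ i < real n0" using reals_Archimedean2 by blast
        show "\<forall>\<^sub>F n in sequentially. max 0 (min 1 (2 - gauss_vec (Z \<omega>) $ i / (1 / (real n + 1)))) = 0"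
        proof (rule eventually_sequentiallyI[of n0])
          fix n assume "n \<ge> n0"
          then have "2 / gauss_vec (Z \<omega>) $ i \<le> real n + 1" using n0 by linarith
          then have "2 \<le> gauss_vec (Z \<omega>) $ i * (real n + 1)" using pos by (simp add: field_simps)
          then show "max 0 (min 1 (2 - gauss_vec (Z \<omega>) $ i / (1 / (real n + 1)))) = 0"
            by simp
        qed
      qed
      then have "(\<lambda>n. \<Sum>i\<in>UNIV. max 0 (min 1 (2 - gauss_vec (Z \<omega>) $ i / (1 / (real n + 1))))) \<longlonglongrightarrow> (\<Sum>i\<in>(UNIV::'d set). 0)"
        by (intro tendsto_sum)
      then show "(\<lambda>n. tail_cutoff (1 / (real n + 1)) (gauss_vec (Z \<omega>))) \<longlonglongrightarrow> 0"
        by (simp add: tail_cutoff_def)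
    qed
    show "AE \<omega> in Q. norm (tail_cutoff (1 / (real n + 1)) (gauss_vec (Z \<omega>))) \<le> real CARD('d)" for n
    proof (rule AE_I2)
      fix \<omega>
      have "tail_cutoff (1 / (real n + 1)) (gauss_vec (Z \<omega>)) \<le> (\<Sum>i\<in>(UNIV::'d set). 1)"
        unfolding tail_cutoff_def by (intro sum_mono) simp
      then show "norm (tail_cutoff (1 / (real n + 1)) (gauss_vec (Z \<omega>))) \<le> real CARD('d)"
        using tail_cutoff_nonneg[of "1 / (real n + 1)" "gauss_vec (Z \<omega>)"] by simp
    qed
  qed (auto simp del: divide_divide_eq_right)
  then show ?thesis by simp
qed

text \<open>Tightness of the sequence is not assumed: the cutoff is a continuous function on the
  cube, so its expectations converge and the smallness known for Z passes to Y N for large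
  N.\<close>

lemma weak_convergence_from_gauss_moments:
  fixes Y :: "nat \<Rightarrow> 'a \<Rightarrow> real ^ 'd::finite" and Z :: "'b \<Rightarrow> real ^ 'd" and f :: "real ^ 'd \<Rightarrow> real"
  assumes P: "\<And>N. prob_space (P N)" and Y: "\<And>N. Y N \<in> borel_measurable (P N)"
    and Y0: "\<And>N \<omega> i. Y N \<omega> $ i \<ge> 0"
    and Q: "prob_space Q" and Z: "Z \<in> borel_measurable Q"
    and Z0: "AE \<omega> in Q. \<forall>i. Z \<omega> $ i \<ge> 0"
    and moments: "\<And>k :: 'd \<Rightarrow> nat. (\<lambda>N. \<integral> \<omega>. (\<Prod>i\<in>UNIV. gauss (real (k i)) (Y N \<omega> $ i)) \<partial>P N)
      \<longlonglongrightarrow> (\<integral> \<omega>. (\<Prod>i\<in>UNIV. gauss (real (k i)) (Z \<omega> $ i)) \<partial>Q)"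
    and f: "continuous_on UNIV f" "bounded (range f)"
  shows "(\<lambda>N. \<integral> \<omega>. f (Y N \<omega>) \<partial>P N) \<longlonglongrightarrow> (\<integral> \<omega>. f (Z \<omega>) \<partial>Q)"
proof (rule LIMSEQ_I)
  fix e :: real assume e: "e > 0"
  obtain B where B: "B > 0" "\<And>y. \<bar>f y\<bar> \<le> B"
    using f(2) unfolding bounded_pos by auto
  have fm [measurable]: "f \<in> borel_measurable borel" by (rule borel_measurable_continuous_onI[OF f(1)])
  define F where "F \<delta> w = f (\<chi> i. inv_gauss \<delta> (w $ i))" for \<delta> w
  have Fc: "continuous_on UNIV (F \<delta>)" if "\<delta> > 0" for \<delta>
  proof -
    have "continuous_on UNIV (\<lambda>w::real ^ 'd. inv_gauss \<delta> (w $ i))" for i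
      by (rule continuous_on_compose2[OF continuous_on_inv_gauss[OF that]]) (auto intro!: continuous_intros)
    then show ?thesis
      unfolding F_def by (intro continuous_on_compose2[OF f(1)] continuous_on_vec_lambda) auto
  qed
  have close: "\<bar>(\<integral> \<omega>. f (U \<omega>) \<partial>R) - (\<integral> \<omega>. F \<delta> (gauss_vec (U \<omega>)) \<partial>R)\<bar>
      \<le> 2 * B * (\<integral> \<omega>. tail_cutoff \<delta> (gauss_vec (U \<omega>)) \<partial>R)"
    if R: "prob_space R" and U: "U \<in> borel_measurable R" and U0: "AE \<omega> in R. \<forall>i. U \<omega> $ i \<ge> 0"
      and \<delta>: "\<delta> > 0" for R \<delta> and U :: "'c \<Rightarrow> real ^ 'd"
  proof -
    interpret prob_space R by fact
    note U [measurable]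
    have i: "integrable R (\<lambda>\<omega>. f (U \<omega>))"
      by (rule integrable_const_bound[where B = B]) (use B in auto)
    have j: "integrable R (\<lambda>\<omega>. F \<delta> (gauss_vec (U \<omega>)))" "integrable R (\<lambda>\<omega>. tail_cutoff \<delta> (gauss_vec (U \<omega>)))"
      using R U Fc[OF \<delta>] by (auto intro!: integrable_cube continuous_on_tail_cutoff)
    have "\<bar>(\<integral> \<omega>. f (U \<omega>) \<partial>R) - (\<integral> \<omega>. F \<delta> (gauss_vec (U \<omega>)) \<partial>R)\<bar>
        \<le> (\<integral> \<omega>. \<bar>f (U \<omega>) - F \<delta> (gauss_vec (U \<omega>))\<bar> \<partial>R)"
      using i j integral_abs_bound[of R "\<lambda>\<omega>. f (U \<omega>) - F \<delta> (gauss_vec (U \<omega>))"] by simp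
    also have "\<dots> \<le> (\<integral> \<omega>. 2 * B * tail_cutoff \<delta> (gauss_vec (U \<omega>)) \<partial>R)"
    proof (rule integral_mono_AE)
      show "AE \<omega> in R. \<bar>f (U \<omega>) - F \<delta> (gauss_vec (U \<omega>))\<bar> \<le> 2 * B * tail_cutoff \<delta> (gauss_vec (U \<omega>))"
        using U0
        by eventually_elim (unfold F_def, rule truncated_inverse_error[OF B(2) _ \<delta>], blast)
    qed (use i j in auto)
    finally show ?thesis by simp
  qed
  \<comment> \<open>The level is fixed from the limit law alone. With e / (12 B) the cutoff error is
    below e/6 for Z and below e/3 for Y N, leaving room for e/6 from F.\<close>
  obtain n where n: "\<bar>\<integral> \<omega>. tail_cutoff (1 / (real n + 1)) (gauss_vec (Z \<omega>)) \<partial>Q\<bar> < e / (12 * B)"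
    using LIMSEQ_D[OF tail_cutoff_expectation_tendsto[OF Q Z], of "e / (12 * B)"] e B(1) by auto
  define \<delta> where "\<delta> = 1 / (real n + 1)"
  have \<delta>: "\<delta> > 0" by (simp add: \<delta>_def)
  let ?T = "\<lambda>N. \<integral> \<omega>. tail_cutoff \<delta> (gauss_vec (Y N \<omega>)) \<partial>P N" and ?T' = "\<integral> \<omega>. tail_cutoff \<delta> (gauss_vec (Z \<omega>)) \<partial>Q"
  let ?F = "\<lambda>N. \<integral> \<omega>. F \<delta> (gauss_vec (Y N \<omega>)) \<partial>P N" and ?F' = "\<integral> \<omega>. F \<delta> (gauss_vec (Z \<omega>)) \<partial>Q"
  have T: "?T \<longlonglongrightarrow> ?T'"
    by (rule tendsto_expectation_cube[OF P Y Q Z moments continuous_on_tail_cutoff])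
  have FF: "?F \<longlonglongrightarrow> ?F'"
    by (rule tendsto_expectation_cube[OF P Y Q Z moments Fc[OF \<delta>]])
  have T'_small: "2 * B * ?T' < e / 6"
  proof -
    have "?T' < e / (12 * B)" using n unfolding \<delta>_def[symmetric] by linarith
    then show ?thesis using B(1) by (simp add: field_simps)
  qed
  obtain N1 where N1: "\<And>N. N \<ge> N1 \<Longrightarrow> \<bar>?T N - ?T'\<bar> < e / (12 * B)"
    using LIMSEQ_D[OF T, of "e / (12 * B)"] e B(1) by auto
  obtain N2 where N2: "\<And>N. N \<ge> N2 \<Longrightarrow> \<bar>?F N - ?F'\<bar> < e / 6"
    using LIMSEQ_D[OF FF, of "e / 6"] e by auto
  show "\<exists>N0. \<forall>N\<ge>N0. norm ((\<integral> \<omega>. f (Y N \<omega>) \<partial>P N) - (\<integral> \<omega>. f (Z \<omega>) \<partial>Q)) < e"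
  proof (intro exI allI impI)
    fix N assume N: "N \<ge> max N1 N2"
    have "?T N < ?T' + e / (12 * B)" using N1[of N] N by auto
    then have "2 * B * ?T N < 2 * B * (?T' + e / (12 * B))" using B(1) by (intro mult_strict_left_mono) auto
    also have "\<dots> = 2 * B * ?T' + e / 6" using B(1) by (simp add: field_simps)
    finally have "2 * B * ?T N < e / 3" using T'_small by linarith
    moreover have "\<bar>(\<integral> \<omega>. f (Y N \<omega>) \<partial>P N) - ?F N\<bar> \<le> 2 * B * ?T N"
      using Y0 by (intro close P Y \<delta>) auto
    moreover have "\<bar>(\<integral> \<omega>. f (Z \<omega>) \<partial>Q) - ?F'\<bar> \<le> 2 * B * ?T'"
      by (intro close Q Z Z0 \<delta>)
    moreover have "\<bar>?F N - ?F'\<bar> < e / 6" using N2[of N] N by auto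
    ultimately show "norm ((\<integral> \<omega>. f (Y N \<omega>) \<partial>P N) - (\<integral> \<omega>. f (Z \<omega>) \<partial>Q)) < e"
      using T'_small e unfolding real_norm_def by linarith
  qed
qed

section \<open>Convergence of finite-dimensional distributions\<close>

lemma prod_gauss_absorb:
  assumes "finite A" "m \<in> A"
  shows "(\<Prod>s\<in>A. gauss (\<alpha> s) (y s)) * gauss b (y m)
    = (\<Prod>s\<in>A. gauss ((\<alpha>(m := \<alpha> m + b)) s) (y s))"
proof -
  have "(\<Prod>s\<in>A - {m}. gauss (\<alpha> s) (y s)) = (\<Prod>s\<in>A - {m}. gauss ((\<alpha>(m := \<alpha> m + b)) s) (y s))"
    by (intro prod.cong) auto
  then show ?thesis
    using assms by (simp add: prod.remove[of A m] mult_ac flip: gauss_mult)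
qed

lemma prod_gauss_bounds:
  assumes "\<And>s. s \<in> A \<Longrightarrow> \<alpha> s \<ge> 0"
  shows "0 \<le> (\<Prod>s\<in>A. gauss (\<alpha> s) (y s))" and "(\<Prod>s\<in>A. gauss (\<alpha> s) (y s)) \<le> 1"
  using assms gauss_le_1 by (auto intro!: prod_nonneg prod_le_1 simp: less_imp_le[OF gauss_pos])

lemma gauss_sum: "finite A \<Longrightarrow> gauss (\<Sum>i\<in>A. b i) x = (\<Prod>i\<in>A. gauss (b i) x)"
  by (induction rule: finite_induct) (simp_all add: gauss_def[of 0] flip: gauss_mult)

lemma borel_measurable_vec_lambda:
  fixes f :: "'i::finite \<Rightarrow> 'a \<Rightarrow> real"
  assumes "\<And>i. f i \<in> borel_measurable M"
  shows "(\<lambda>\<omega>. \<chi> i. f i \<omega>) \<in> borel_measurable M"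
proof (subst borel_measurable_euclidean_space, rule ballI)
  fix b :: "real ^ 'i" assume "b \<in> Basis"
  then obtain i where "b = axis i 1" by (auto simp: Basis_vec_def)
  then show "(\<lambda>\<omega>. (\<chi> i. f i \<omega>) \<bullet> b) \<in> borel_measurable M"
    using assms[of i] by (simp add: inner_axis)
qed

locale scaled_walks = chain_params q \<sigma> for q \<sigma> :: real +
  fixes c :: real and M :: "nat \<Rightarrow> 'a measure" and X :: "nat \<Rightarrow> nat \<Rightarrow> 'a \<Rightarrow> nat"
    and M' :: "'b measure" and \<xi> :: "real \<Rightarrow> 'b \<Rightarrow> real"
  assumes c: "c > 0"
    and chains: "\<And>N. N \<ge> 1 \<Longrightarrow>
      markov_chain (M N) (X N) (init_prob q \<sigma> (exp (- c / sqrt (real N)))) (trans_prob q \<sigma>)"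
    and process: "markov_process M' \<xi> (bessel_init c) (bessel_trans \<sigma>)"
begin

text \<open>All indices are shifted by one: N stands for the walk with parameter
  \<open>Suc N\<close>, where the hypothesis on the chains applies and the scaling is
  nondegenerate.\<close>

definition h :: "nat \<Rightarrow> real" where "h N = 1 / sqrt (real (Suc N))"

abbreviation P :: "nat \<Rightarrow> 'a measure" where "P N \<equiv> M (Suc N)"

abbreviation rate :: "nat \<Rightarrow> real" where "rate N \<equiv> exp (- c / sqrt (real (Suc N)))"

definition clock :: "nat \<Rightarrow> real \<Rightarrow> nat" where "clock N t = nat \<lfloor>real (Suc N) * t\<rfloor>"

lemma walk: "walk q \<sigma> (P N) (X (Suc N)) (rate N)"
  by unfold_locales (use chains[of "Suc N"] c in auto)

lemma bessel: "bessel_process M' \<xi> c \<sigma>"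
  by unfold_locales (use process sigma_pos in auto)

lemma h_pos: "0 < h N" and h_le_1: "h N \<le> 1" and h_square: "(h N)\<^sup>2 * real (Suc N) = 1"
  by (simp_all add: h_def power_divide)

lemma h_tendsto: "h \<longlonglongrightarrow> 0"
proof -
  have "(\<lambda>N. sqrt (1 / real (Suc N))) \<longlonglongrightarrow> sqrt 0"
    by (intro tendsto_real_sqrt LIMSEQ_Suc lim_const_over_n)
  then show ?thesis by (simp add: h_def[abs_def] real_sqrt_divide)
qed

lemma rate_power: "rate N ^ n = exp (- (c * (h N * real n)))"
  by (simp add: h_def mult.commute flip: exp_of_nat_mult)

lemma bessel_init_integral:
  assumes [measurable]: "g \<in> borel_measurable borel"
  shows "(\<integral> \<omega>. g (\<xi> 0 \<omega>) \<partial>M') = c\<^sup>2 * (\<integral> x. x * exp (- (c * x)) * g x * indicator {0..} x \<partial>lborel)"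
proof -
  interpret bessel_process M' \<xi> c \<sigma> by (rule bessel)
  have [measurable]: "\<xi> 0 \<in> borel_measurable M'" by (rule xi_measurable) simp
  have "(\<integral> \<omega>. g (\<xi> 0 \<omega>) \<partial>M') = (\<integral> x. g x \<partial>bessel_init c)"
    unfolding distr_xi_0[symmetric] by (subst integral_distr) auto
  also have "bessel_init c = density lborel (\<lambda>x. ennreal (c\<^sup>2 * x * exp (- c * x) * indicator {0<..} x))"
    unfolding bessel_init_def by (intro arg_cong[where f = "density lborel"] ext) (auto simp: indicator_def)
  also have "(\<integral> x. g x \<partial>\<dots>) = (\<integral> x. (c\<^sup>2 * x * exp (- c * x) * indicator {0<..} x) *\<^sub>R g x \<partial>lborel)"
    by (rule integral_density) (auto simp: indicator_def)
  also have "\<dots> = (\<integral> x. c\<^sup>2 * (x * exp (- (c * x)) * g x * indicator {0..} x) \<partial>lborel)"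
    by (intro Bochner_Integration.integral_cong) (auto simp: indicator_def)
  finally show ?thesis by simp
qed

text \<open>Multiplying through by C_0 leaves a series in s_n and exp (-c h n) only; with g = 1 it
  is C_0 itself.\<close>

lemma initial_sums:
  fixes g :: "real \<Rightarrow> real"
  assumes "\<And>x. 0 \<le> g x" "\<And>x. g x \<le> 1"
  shows "(\<lambda>n. s (int n) * (exp (- (c * (h N * real n))) * g (h N * real n))) sums
    (C0 q \<sigma> (rate N) * (\<integral> \<omega>. g (h N * real (X (Suc N) 0 \<omega>)) \<partial>P N))"
proof -
  interpret walk q \<sigma> "P N" "X (Suc N)" "rate N" by (rule walk)
  have "(\<lambda>n. C0 q \<sigma> (rate N) * (init_prob q \<sigma> (rate N) n * g (h N * real n))) sums
      (C0 q \<sigma> (rate N) * (\<integral> \<omega>. g (h N * real (X (Suc N) 0 \<omega>)) \<partial>P N))"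
    using assms by (intro sums_mult expectation_X_0_sums[of "\<lambda>n. g (h N * real n)"])
  then show ?thesis
    unfolding rate_power[symmetric] using C0_pos by (simp add: init_prob_def mult_ac)
qed

lemma scaled_C0_tendsto:
  fixes g :: "real \<Rightarrow> real"
  assumes "continuous_on UNIV g" "\<And>x. 0 \<le> g x" "\<And>x. g x \<le> 1"
  shows "(\<lambda>N. (h N)\<^sup>2 * (C0 q \<sigma> (rate N) * (\<integral> \<omega>. g (h N * real (X (Suc N) 0 \<omega>)) \<partial>P N)))
    \<longlonglongrightarrow> K * (\<integral> \<omega>. g (\<xi> 0 \<omega>) \<partial>M') / c\<^sup>2"
proof -
  have "(\<lambda>N. (h N)\<^sup>2 * (\<Sum>n. s (int n) * (exp (- (c * (h N * real n))) * g (h N * real n))))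
    \<longlonglongrightarrow> K * (\<integral> x. x * exp (- (c * x)) * g x * indicator {0..} x \<partial>lborel)"
    using initial_sums[of g, OF assms(2,3)]
    by (intro weighted_riemann_sum c h_pos h_le_1 h_tendsto assms) (auto simp: sums_iff)
  also have "(\<lambda>N. (\<Sum>n. s (int n) * (exp (- (c * (h N * real n))) * g (h N * real n))))
      = (\<lambda>N. C0 q \<sigma> (rate N) * (\<integral> \<omega>. g (h N * real (X (Suc N) 0 \<omega>)) \<partial>P N))"
    using initial_sums[of g, OF assms(2,3)] by (simp add: sums_iff)
  finally show ?thesis
    using c bessel_init_integral[OF borel_measurable_continuous_onI[OF assms(1)]] by simp
qed

lemma scaled_C0: "(\<lambda>N. (h N)\<^sup>2 * C0 q \<sigma> (rate N)) \<longlonglongrightarrow> K / c\<^sup>2"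
proof -
  interpret B: bessel_process M' \<xi> c \<sigma> by (rule bessel)
  have "prob_space (P N)" for N
    using walk[of N] by (simp add: walk_def walk_axioms_def markov_chain_def)
  then have "measure (P N) (space (P N)) = 1" for N by (simp add: prob_space.prob_space)
  then show ?thesis
    using scaled_C0_tendsto[of "\<lambda>_. 1"] by (simp add: B.prob_space)
qed

text \<open>The quotient of the asymptotics for g and for g = 1, in which K, c^2 and C_0
  cancel.\<close>

lemma initial_convergence:
  fixes g :: "real \<Rightarrow> real"
  assumes "continuous_on UNIV g" "\<And>x. 0 \<le> g x" "\<And>x. g x \<le> 1"
  shows "(\<lambda>N. \<integral> \<omega>. g (h N * real (X (Suc N) 0 \<omega>)) \<partial>P N) \<longlonglongrightarrow> (\<integral> \<omega>. g (\<xi> 0 \<omega>) \<partial>M')"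
proof -
  have nz: "K / c\<^sup>2 \<noteq> 0" using K_ge_1 c by simp
  have "(\<lambda>N. (h N)\<^sup>2 * (C0 q \<sigma> (rate N) * (\<integral> \<omega>. g (h N * real (X (Suc N) 0 \<omega>)) \<partial>P N))
      / ((h N)\<^sup>2 * C0 q \<sigma> (rate N))) \<longlonglongrightarrow> (K * (\<integral> \<omega>. g (\<xi> 0 \<omega>) \<partial>M') / c\<^sup>2) / (K / c\<^sup>2)"
    by (rule tendsto_divide[OF scaled_C0_tendsto[OF assms] scaled_C0 nz])
  moreover have "C0 q \<sigma> (rate N) > 0" for N by (rule walk.C0_pos[OF walk])
  ultimately show ?thesis using h_pos nz by (simp add: less_imp_neq[symmetric])
qed

text \<open>A supremum over all times, since the error of every step between two observation times
  has to be bounded at once.\<close>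

definition \<eta> :: "nat \<Rightarrow> real" where
  "\<eta> N = (SUP j. \<integral> \<omega>. drift_error (X (Suc N) j \<omega>) \<partial>P N)"

lemma eta_upper: "(\<integral> \<omega>. drift_error (X (Suc N) j \<omega>) \<partial>P N) \<le> \<eta> N"
proof -
  obtain E where E: "E > 0" "\<And>n. drift_error n \<le> E" using drift_error_bounded by blast
  have "bdd_above (range (\<lambda>j. \<integral> \<omega>. drift_error (X (Suc N) j \<omega>) \<partial>P N))"
    using walk.expectation_drift_error[OF walk[of N], of 0 E E] E by (intro bdd_aboveI2) auto
  then show ?thesis unfolding \<eta>_def by (rule cSUP_upper[OF UNIV_I])
qed

text \<open>First R is chosen so that the drift error beyond R is below e/3, then N so large that
  C_0 outweighs the fixed total weight W of the positions below R.\<close>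

lemma eta_tendsto: "\<eta> \<longlonglongrightarrow> 0"
proof (rule LIMSEQ_I)
  fix e :: real assume e: "e > 0"
  obtain E where E: "E > 0" "\<And>n. drift_error n \<le> E" using drift_error_bounded by blast
  obtain R where R: "\<And>n. n \<ge> R \<Longrightarrow> norm (drift_error n - 0) < e / 3"
    using LIMSEQ_D[OF drift_error_tendsto, of "e / 3"] e by auto
  define W where "W = (\<Sum>n<R. weight n)"
  have C0: "C0 q \<sigma> (rate N) > 0" for N by (rule walk.C0_pos[OF walk])
  have "(\<lambda>N. E * W * ((h N)\<^sup>2 / ((h N)\<^sup>2 * C0 q \<sigma> (rate N)))) \<longlonglongrightarrow> E * W * (0\<^sup>2 / (K / c\<^sup>2))"
    using K_ge_1 c by (intro tendsto_intros h_tendsto scaled_C0) auto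
  moreover have "(h N)\<^sup>2 / ((h N)\<^sup>2 * C0 q \<sigma> (rate N)) = 1 / C0 q \<sigma> (rate N)" for N
    using h_pos[of N] by simp
  ultimately have lim: "(\<lambda>N. E * (W / C0 q \<sigma> (rate N))) \<longlonglongrightarrow> 0" by simp
  have "e / 3 > 0" using e by simp
  then obtain N0 where N0: "\<And>N. N \<ge> N0 \<Longrightarrow> norm (E * (W / C0 q \<sigma> (rate N)) - 0) < e / 3"
    using LIMSEQ_D[OF lim] by blast
  show "\<exists>N0. \<forall>N\<ge>N0. norm (\<eta> N - 0) < e"
  proof (intro exI allI impI)
    fix N assume N: "N \<ge> N0"
    have "\<eta> N \<le> e / 3 + E * (W / C0 q \<sigma> (rate N))"
      unfolding \<eta>_def
    proof (rule cSUP_least)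
      fix j
      show "(\<integral> \<omega>. drift_error (X (Suc N) j \<omega>) \<partial>P N) \<le> e / 3 + E * (W / C0 q \<sigma> (rate N))"
        unfolding W_def
      proof (rule walk.expectation_drift_error[OF walk])
        show "drift_error n \<le> e / 3" if "n \<ge> R" for n using R[OF that] by simp
      qed (use e E in auto)
    qed simp
    also have "\<dots> < e" using N0[OF N] e by (simp only: real_norm_def)
    finally have "\<eta> N < e" .
    moreover have "\<eta> N \<ge> 0"
      using eta_upper[of N 0] by (rule order_trans[rotated]) (simp add: drift_error_nonneg)
    ultimately show "norm (\<eta> N - 0) < e" by simp
  qed
qed

lemma clock_mono: "u \<le> t \<Longrightarrow> clock N u \<le> clock N t"
  unfolding clock_def by (intro nat_mono floor_mono mult_left_mono) auto

lemma clock_0 [simp]: "clock N 0 = 0"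
  by (simp add: clock_def)

lemma clock_bounds:
  assumes "t \<ge> 0"
  shows "real (clock N t) \<le> real (Suc N) * t" "real (Suc N) * t < real (clock N t) + 1"
  using assms by (simp_all add: clock_def)

text \<open>Between the clock times of m and t there are about N (t - m) steps, each with error h^2
  = 1/N times a null sequence, so the total error tends to 0.\<close>

lemma walk_increment:
  fixes z :: "nat \<Rightarrow> nat list \<Rightarrow> real"
  assumes m: "0 \<le> m" "m \<le> t" and b: "b \<ge> 0" and z: "\<And>N l. 0 \<le> z N l" "\<And>N l. z N l \<le> 1"
  shows "(\<lambda>N. (\<integral> \<omega>. z N (walk.path (X (Suc N)) (clock N m) \<omega>) * gauss b (h N * real (X (Suc N) (clock N t) \<omega>)) \<partial>P N)
    - (\<integral> \<omega>. z N (walk.path (X (Suc N)) (clock N m) \<omega>) * bgauss b (\<tau> * (t - m)) (h N * real (X (Suc N) (clock N m) \<omega>)) \<partial>P N))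
    \<longlonglongrightarrow> 0"
proof -
  \<comment> \<open>The first term is the accumulated step error over at most (t - m + 1) / h^2
    steps; the second is the Lipschitz price of rounding times to the clock.\<close>
  define D where "D N = (t - m + 1) * (step_const b * (\<eta> N + h N)) + 5 / 2 * b * (h N)\<^sup>2" for N
  have "D \<longlonglongrightarrow> (t - m + 1) * (step_const b * (0 + 0)) + 5 / 2 * b * 0\<^sup>2"
    unfolding D_def by (intro tendsto_intros eta_tendsto h_tendsto)
  then have D: "D \<longlonglongrightarrow> 0" by simp
  have "\<bar>(\<integral> \<omega>. z N (walk.path (X (Suc N)) (clock N m) \<omega>) * gauss b (h N * real (X (Suc N) (clock N t) \<omega>)) \<partial>P N)
    - (\<integral> \<omega>. z N (walk.path (X (Suc N)) (clock N m) \<omega>) * bgauss b (\<tau> * (t - m)) (h N * real (X (Suc N) (clock N m) \<omega>)) \<partial>P N)\<bar>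
    \<le> D N" for N
  proof -
    interpret walk q \<sigma> "P N" "X (Suc N)" "rate N" by (rule walk)
    define n where "n = clock N t - clock N m"
    have n: "clock N t = clock N m + n" using clock_mono[OF m(2), of N] by (simp add: n_def)
    have nr: "real n = real (clock N t) - real (clock N m)" by (simp add: n)
    \<comment> \<open>Each of the two floors loses an amount in [0, 1), so their difference is off
      by at most 1.\<close>
    have "\<bar>real n - real (Suc N) * (t - m)\<bar> \<le> 1"
      using clock_bounds[OF m(1), of N] clock_bounds[of t N] m unfolding nr
      by (simp only: right_diff_distrib) linarith
    then have "\<bar>(h N)\<^sup>2 * (real n - real (Suc N) * (t - m))\<bar> \<le> (h N)\<^sup>2 * 1"
      unfolding abs_mult by (intro mult_mono) auto
    moreover have "(h N)\<^sup>2 * (real n - real (Suc N) * (t - m)) = real n * (h N)\<^sup>2 - (h N)\<^sup>2 * real (Suc N) * (t - m)"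
      by (simp only: right_diff_distrib mult.assoc mult.commute[of "real n"])
    ultimately have nh: "\<bar>real n * (h N)\<^sup>2 - (t - m)\<bar> \<le> (h N)\<^sup>2"
      unfolding h_square by simp
    have "(h N)\<^sup>2 \<le> 1" using h_pos[of N] h_le_1[of N] by (intro power_le_one) auto
    then have nh': "real n * (h N)\<^sup>2 \<le> t - m + 1" using nh by linarith
    let ?z = "\<lambda>\<omega>. z N (path (clock N m) \<omega>)" and ?x = "\<lambda>\<omega>. h N * real (X (Suc N) (clock N m) \<omega>)"
    have eta0: "\<eta> N \<ge> 0"
      using eta_upper[of N 0] by (rule order_trans[rotated]) (simp add: drift_error_nonneg)
    have 1: "\<bar>expectation (\<lambda>\<omega>. ?z \<omega> * gauss b (h N * real (X (Suc N) (clock N t) \<omega>)))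
        - expectation (\<lambda>\<omega>. ?z \<omega> * bgauss b (real n * (\<tau> * (h N)\<^sup>2)) (?x \<omega>))\<bar>
        \<le> (t - m + 1) * (step_const b * (\<eta> N + h N))"
    proof -
      have "\<bar>expectation (\<lambda>\<omega>. ?z \<omega> * gauss b (h N * real (X (Suc N) (clock N t) \<omega>)))
        - expectation (\<lambda>\<omega>. ?z \<omega> * bgauss b (real n * (\<tau> * (h N)\<^sup>2)) (?x \<omega>))\<bar>
        \<le> real n * ((h N)\<^sup>2 * (step_const b * (\<eta> N + h N)))"
        unfolding n by (intro expectation_gauss_steps b order_refl h_pos h_le_1 z eta_upper)
      also have "\<dots> = real n * (h N)\<^sup>2 * (step_const b * (\<eta> N + h N))" by simp
      also have "\<dots> \<le> (t - m + 1) * (step_const b * (\<eta> N + h N))"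
        using nh' step_const_nonneg[OF b] eta0 h_pos[of N] by (intro mult_right_mono) auto
      finally show ?thesis .
    qed
    have zm: "(\<lambda>\<omega>. z N (path (clock N m) \<omega>)) \<in> borel_measurable (P N)"
      by (rule measurable_compose[OF path_measurable]) simp
    have int: "integrable (P N) (\<lambda>\<omega>. ?z \<omega> * bgauss b u (?x \<omega>))" if "u \<ge> 0" for u
    proof (rule integrable_const_bound[where B = 1])
      show "AE \<omega> in P N. norm (?z \<omega> * bgauss b u (?x \<omega>)) \<le> 1"
        using z bgauss_nonneg[of b u] bgauss_le_1[OF b that] by (intro AE_I2) (simp add: abs_mult mult_le_one)
      show "(\<lambda>\<omega>. ?z \<omega> * bgauss b u (?x \<omega>)) \<in> borel_measurable (P N)"
        using zm X_compose_measurable[of "\<lambda>k. bgauss b u (h N * real k)"] by (rule borel_measurable_times)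
    qed
    define u where "u = real n * (\<tau> * (h N)\<^sup>2)"
    define v where "v = \<tau> * (t - m)"
    have uv: "u \<ge> 0" "v \<ge> 0" using tau_bounds m by (auto simp: u_def v_def)
    have uv': "\<bar>u - v\<bar> \<le> (h N)\<^sup>2"
    proof -
      have "u - v = \<tau> * (real n * (h N)\<^sup>2 - (t - m))" by (simp add: u_def v_def algebra_simps)
      then have "\<bar>u - v\<bar> = \<tau> * \<bar>real n * (h N)\<^sup>2 - (t - m)\<bar>" using tau_bounds by (simp add: abs_mult)
      also have "\<dots> \<le> 1 * (h N)\<^sup>2" using tau_bounds nh by (intro mult_mono) auto
      finally show ?thesis by simp
    qed
    have 2: "\<bar>expectation (\<lambda>\<omega>. ?z \<omega> * bgauss b u (?x \<omega>)) - expectation (\<lambda>\<omega>. ?z \<omega> * bgauss b v (?x \<omega>))\<bar>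
        \<le> 5 / 2 * b * (h N)\<^sup>2"
    proof -
      have "\<bar>expectation (\<lambda>\<omega>. ?z \<omega> * bgauss b u (?x \<omega>)) - expectation (\<lambda>\<omega>. ?z \<omega> * bgauss b v (?x \<omega>))\<bar>
          \<le> expectation (\<lambda>\<omega>. \<bar>?z \<omega> * bgauss b u (?x \<omega>) - ?z \<omega> * bgauss b v (?x \<omega>)\<bar>)"
        using int[OF uv(1)] int[OF uv(2)]
          integral_abs_bound[of "P N" "\<lambda>\<omega>. ?z \<omega> * bgauss b u (?x \<omega>) - ?z \<omega> * bgauss b v (?x \<omega>)"] by simp
      also have "\<dots> \<le> expectation (\<lambda>\<omega>. 5 / 2 * b * (h N)\<^sup>2)"
      proof (rule integral_mono)
        show "integrable (P N) (\<lambda>\<omega>. \<bar>?z \<omega> * bgauss b u (?x \<omega>) - ?z \<omega> * bgauss b v (?x \<omega>)\<bar>)"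
          using int[OF uv(1)] int[OF uv(2)] by auto
        fix \<omega>
        have "\<bar>?z \<omega> * bgauss b u (?x \<omega>) - ?z \<omega> * bgauss b v (?x \<omega>)\<bar>
            = ?z \<omega> * \<bar>bgauss b u (?x \<omega>) - bgauss b v (?x \<omega>)\<bar>"
          using z by (simp add: abs_mult flip: right_diff_distrib)
        also have "\<dots> \<le> 1 * (5 / 2 * b * \<bar>u - v\<bar>)"
          using z bgauss_lipschitz_time[OF b uv(2) uv(1)] by (intro mult_mono) auto
        also have "\<dots> \<le> 5 / 2 * b * (h N)\<^sup>2"
          using uv' b by (simp add: mult_left_mono)
        finally show "\<bar>?z \<omega> * bgauss b u (?x \<omega>) - ?z \<omega> * bgauss b v (?x \<omega>)\<bar> \<le> 5 / 2 * b * (h N)\<^sup>2" .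
      qed simp
      finally show ?thesis by (simp add: prob_space)
    qed
    show ?thesis
      using 1 2 unfolding D_def u_def v_def by linarith
  qed
  then show ?thesis
    by (intro Lim_null_comparison[OF _ D] always_eventually allI) (simp only: real_norm_def)
qed

text \<open>Induction on the largest time: on both sides its Gaussian moves to the preceding time m,
  changing \<alpha> there. The exponents are real because b / (1 + b v) leaves the integers, and
  time 0 is always present so that a preceding time exists and the base case is the initial
  law.\<close>

lemma gauss_moments_tendsto:
  assumes "finite A" and "\<forall>a\<in>A. a > 0" and "\<And>s. \<alpha> s \<ge> 0"
  shows "(\<lambda>N. \<integral> \<omega>. (\<Prod>s\<in>insert 0 A. gauss (\<alpha> s) (h N * real (X (Suc N) (clock N s) \<omega>))) \<partial>P N)
    \<longlonglongrightarrow> (\<integral> \<omega>. (\<Prod>s\<in>insert 0 A. gauss (\<alpha> s) (\<xi> s \<omega>)) \<partial>M')"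
  using assms
proof (induction A arbitrary: \<alpha> rule: finite_linorder_max_induct)
  case empty
  have "continuous_on UNIV (gauss (\<alpha> 0))" unfolding gauss_def by (intro continuous_intros) auto
  then show ?case
    using initial_convergence[of "gauss (\<alpha> 0)"] empty gauss_le_1 less_imp_le[OF gauss_pos] by simp
next
  case (insert t A)
  define A0 where "A0 = insert 0 A"
  define m where "m = Max A0"
  have A0_fin: "finite A0" "A0 \<noteq> {}" using insert.hyps by (auto simp: A0_def)
  have A0: "finite A0" "m \<in> A0" "\<And>s. s \<in> A0 \<Longrightarrow> s \<le> m" "\<And>s. s \<in> A0 \<Longrightarrow> 0 \<le> s"
    using A0_fin insert.prems(1) Max_in[OF A0_fin] Max_ge[OF A0_fin(1)]
    by (auto simp: m_def A0_def intro: less_imp_le)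
  have t: "t > 0" "t \<notin> A0" "m < t" "0 \<le> m"
    using insert.hyps insert.prems(1) A0 by (auto simp: A0_def)
  define b where "b = \<alpha> t"
  have b: "b \<ge> 0" using insert.prems(2) by (simp add: b_def)
  define v where "v = \<tau> * (t - m)"
  have v: "v \<ge> 0" using t tau_bounds by (simp add: v_def)
  define a where "a = exp (- (3 / 2 * ln (1 + b * v)))"
  define \<alpha>' where "\<alpha>' = \<alpha>(m := \<alpha> m + b / (1 + b * v))"
  have \<alpha>': "\<alpha>' s \<ge> 0" for s using insert.prems(2) b v by (simp add: \<alpha>'_def)
  have absorb: "(\<Prod>s\<in>A0. gauss (\<alpha> s) (y s)) * bgauss b v (y m) = a * (\<Prod>s\<in>A0. gauss (\<alpha>' s) (y s))" for y
    unfolding bgauss_def a_def \<alpha>'_def prod_gauss_absorb[OF A0(1,2), symmetric] by simp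
  have IH: "(\<lambda>N. \<integral> \<omega>. (\<Prod>s\<in>A0. gauss (\<alpha>' s) (h N * real (X (Suc N) (clock N s) \<omega>))) \<partial>P N)
    \<longlonglongrightarrow> (\<integral> \<omega>. (\<Prod>s\<in>A0. gauss (\<alpha>' s) (\<xi> s \<omega>)) \<partial>M')"
    unfolding A0_def using insert.prems \<alpha>' by (intro insert.IH) auto
  define z where "z N l = (\<Prod>s\<in>A0. gauss (\<alpha> s) (h N * real (l ! clock N s)))" for N l
  have z: "0 \<le> z N l" "z N l \<le> 1" for N l
    using prod_gauss_bounds[of A0 \<alpha>] insert.prems(2) by (auto simp: z_def)
  have zp: "z N (walk.path (X (Suc N)) (clock N m) \<omega>)
      = (\<Prod>s\<in>A0. gauss (\<alpha> s) (h N * real (X (Suc N) (clock N s) \<omega>)))" for N \<omega>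
    unfolding z_def using A0(3) by (intro prod.cong refl) (simp add: walk.nth_path[OF walk] clock_mono)
  have ins: "(\<Prod>s\<in>insert 0 (insert t A). gauss (\<alpha> s) (y s)) = (\<Prod>s\<in>A0. gauss (\<alpha> s) (y s)) * gauss b (y t)" for y
  proof -
    have "insert 0 (insert t A) = insert t A0" by (auto simp: A0_def)
    then show ?thesis using prod.insert[OF A0(1) t(2)] by (simp add: b_def mult.commute)
  qed
  have "(\<lambda>N. (\<integral> \<omega>. (\<Prod>s\<in>A0. gauss (\<alpha> s) (h N * real (X (Suc N) (clock N s) \<omega>))) * gauss b (h N * real (X (Suc N) (clock N t) \<omega>)) \<partial>P N)
    - (\<integral> \<omega>. (\<Prod>s\<in>A0. gauss (\<alpha> s) (h N * real (X (Suc N) (clock N s) \<omega>))) * bgauss b v (h N * real (X (Suc N) (clock N m) \<omega>)) \<partial>P N))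
    \<longlonglongrightarrow> 0"
    unfolding zp[symmetric] v_def using t by (intro walk_increment b z) auto
  then have "(\<lambda>N. (\<integral> \<omega>. (\<Prod>s\<in>insert 0 (insert t A). gauss (\<alpha> s) (h N * real (X (Suc N) (clock N s) \<omega>))) \<partial>P N)
    - a * (\<integral> \<omega>. (\<Prod>s\<in>A0. gauss (\<alpha>' s) (h N * real (X (Suc N) (clock N s) \<omega>))) \<partial>P N)) \<longlonglongrightarrow> 0"
    unfolding ins using absorb[of "\<lambda>s. h _ * real (X (Suc _) (clock _ s) _)"] by simp
  from tendsto_add[OF this tendsto_mult[OF tendsto_const IH, of a]]
  have lim: "(\<lambda>N. \<integral> \<omega>. (\<Prod>s\<in>insert 0 (insert t A). gauss (\<alpha> s) (h N * real (X (Suc N) (clock N s) \<omega>))) \<partial>P N)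
    \<longlonglongrightarrow> a * (\<integral> \<omega>. (\<Prod>s\<in>A0. gauss (\<alpha>' s) (\<xi> s \<omega>)) \<partial>M')"
    by simp
  interpret B: bessel_process M' \<xi> c \<sigma> by (rule bessel)
  have "(\<integral> \<omega>. (\<Prod>s\<in>insert 0 (insert t A). gauss (\<alpha> s) (\<xi> s \<omega>)) \<partial>M')
      = (\<integral> \<omega>. (\<Prod>s\<in>A0. gauss (\<alpha> s) (\<xi> s \<omega>)) * gauss b (\<xi> (m + (t - m)) \<omega>) \<partial>M')"
    unfolding ins by simp
  also have "\<dots> = (\<integral> \<omega>. (\<Prod>s\<in>A0. gauss (\<alpha> s) (\<xi> s \<omega>)) * bgauss b ((t - m) / (1 + \<sigma>)) (\<xi> m \<omega>) \<partial>M')"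
  proof (rule B.expectation_gauss_future)
    show "(\<lambda>\<omega>. \<Prod>s\<in>A0. gauss (\<alpha> s) (\<xi> s \<omega>)) \<in> borel_measurable (past M' \<xi> m)"
      using A0 by (intro borel_measurable_prod measurable_compose[OF measurable_past gauss_measurable]) auto
  qed (use t b prod_gauss_bounds[of A0 \<alpha>] insert.prems(2) in auto)
  also have "\<dots> = (\<integral> \<omega>. a * (\<Prod>s\<in>A0. gauss (\<alpha>' s) (\<xi> s \<omega>)) \<partial>M')"
    unfolding absorb[symmetric] by (simp add: v_def \<tau>_def)
  finally show ?case using lim by simp
qed

lemma fdd_convergence:
  fixes t :: "'d::finite \<Rightarrow> real" and f :: "real ^ 'd \<Rightarrow> real"
  assumes t: "\<And>i. t i \<ge> 0" and f: "continuous_on UNIV f" "bounded (range f)"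
  shows "(\<lambda>N. \<integral> \<omega>. f (\<chi> i. h N * real (X (Suc N) (clock N (t i)) \<omega>)) \<partial>P N)
    \<longlonglongrightarrow> (\<integral> \<omega>. f (\<chi> i. \<xi> (t i) \<omega>) \<partial>M')"
proof (rule weak_convergence_from_gauss_moments[OF _ _ _ _ _ _ _ f])
  interpret B: bessel_process M' \<xi> c \<sigma> by (rule bessel)
  show "prob_space (P N)" for N
    using walk[of N] by (simp add: walk_def walk_axioms_def markov_chain_def)
  show "(\<lambda>\<omega>. \<chi> i. h N * real (X (Suc N) (clock N (t i)) \<omega>)) \<in> borel_measurable (P N)" for N
    by (intro borel_measurable_vec_lambda walk.X_compose_measurable[OF walk])
  show "(\<chi> i. h N * real (X (Suc N) (clock N (t i)) \<omega>)) $ i \<ge> 0" for N \<omega> i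
    using h_pos[of N] by simp
  show "prob_space M'" by unfold_locales
  show "(\<lambda>\<omega>. \<chi> i. \<xi> (t i) \<omega>) \<in> borel_measurable M'"
    using t by (intro borel_measurable_vec_lambda B.xi_measurable)
  have "AE \<omega> in M'. \<forall>i\<in>UNIV. \<xi> (t i) \<omega> > 0"
    using t by (intro AE_finite_allI B.AE_xi_pos) auto
  then show "AE \<omega> in M'. \<forall>i. (\<chi> i. \<xi> (t i) \<omega>) $ i \<ge> 0"
    by eventually_elim (auto intro: less_imp_le)
  fix k :: "'d \<Rightarrow> nat"
  define A where "A = range t - {0}"
  \<comment> \<open>The times t i may coincide or be 0, so the coordinates are grouped by time and
    their exponents added.\<close>
  define \<alpha> where "\<alpha> s = (\<Sum>i | t i = s. real (k i))" for s
  have A: "finite A" "\<forall>a\<in>A. a > 0" using t by (auto simp: A_def order_less_le)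
  have \<alpha>: "\<alpha> s \<ge> 0" for s by (simp add: \<alpha>_def sum_nonneg)
  have prod: "(\<Prod>i\<in>UNIV. gauss (real (k i)) (y (t i))) = (\<Prod>s\<in>insert 0 A. gauss (\<alpha> s) (y s))" for y :: "real \<Rightarrow> real"
  proof -
    have "(\<Prod>s\<in>insert 0 A. gauss (\<alpha> s) (y s))
        = (\<Prod>s\<in>insert 0 A. \<Prod>i\<in>{i \<in> UNIV. t i = s}. gauss (real (k i)) (y (t i)))"
      by (intro prod.cong refl) (simp add: \<alpha>_def gauss_sum)
    also have "\<dots> = (\<Prod>i\<in>UNIV. gauss (real (k i)) (y (t i)))"
      by (rule prod.group) (auto simp: A_def)
    finally show ?thesis ..
  qed
  show "(\<lambda>N. \<integral> \<omega>. (\<Prod>i\<in>UNIV. gauss (real (k i)) ((\<chi> i. h N * real (X (Suc N) (clock N (t i)) \<omega>)) $ i)) \<partial>P N)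
      \<longlonglongrightarrow> (\<integral> \<omega>. (\<Prod>i\<in>UNIV. gauss (real (k i)) ((\<chi> i. \<xi> (t i) \<omega>) $ i)) \<partial>M')"
    using gauss_moments_tendsto[OF A, of \<alpha>] \<alpha>
    by (simp only: vec_lambda_beta prod[of "\<lambda>s. \<xi> s _"] prod[of "\<lambda>s. h _ * real (X (Suc _) (clock _ s) _)"])
qed

end

theorem theorem1p2:
  fixes q \<sigma> c :: real
    and M :: "nat \<Rightarrow> 'a measure" and X :: "nat \<Rightarrow> nat \<Rightarrow> 'a \<Rightarrow> nat"
    and M' :: "'b measure" and \<xi> :: "real \<Rightarrow> 'b \<Rightarrow> real"
    and t :: "'d::finite \<Rightarrow> real"
  assumes "0 \<le> q" and "q < 1" and "0 < \<sigma>" and "\<sigma> \<le> 1" and "c > 0"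
    and "\<And>N. N \<ge> 1 \<Longrightarrow>
      markov_chain (M N) (X N) (init_prob q \<sigma> (exp (- c / sqrt (real N)))) (trans_prob q \<sigma>)"
    and "markov_process M' \<xi> (bessel_init c) (bessel_trans \<sigma>)"
    and "\<And>i. t i \<ge> 0"
  shows "weakly_converges
      (\<lambda>N. distr (M N) borel
         (\<lambda>\<omega>. (\<chi> i. 1 / sqrt (real N) * real (X N (nat \<lfloor>real N * t i\<rfloor>) \<omega>)) :: real ^ 'd))
      (distr M' borel (\<lambda>\<omega>. (\<chi> i. \<xi> (t i) \<omega>) :: real ^ 'd))"
proof -
  interpret scaled_walks q \<sigma> c M X M' \<xi>
    by unfold_locales (use assms in auto)
  interpret B: bessel_process M' \<xi> c \<sigma> by (rule bessel)
  show ?thesis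
    unfolding weakly_converges_def
  proof (intro allI impI, elim conjE)
    fix f :: "real ^ 'd \<Rightarrow> real"
    assume f: "continuous_on UNIV f" "bounded (range f)"
    have fm: "f \<in> borel_measurable borel" by (rule borel_measurable_continuous_onI[OF f(1)])
    have Xm: "(\<lambda>\<omega>. \<chi> i. 1 / sqrt (real (Suc N)) * real (X (Suc N) (nat \<lfloor>real (Suc N) * t i\<rfloor>) \<omega>))
        \<in> borel_measurable (M (Suc N))" for N
      by (intro borel_measurable_vec_lambda walk.X_compose_measurable[OF walk])
    have xm: "(\<lambda>\<omega>. \<chi> i. \<xi> (t i) \<omega>) \<in> borel_measurable M'"
      using assms(8) by (intro borel_measurable_vec_lambda B.xi_measurable)
    show "(\<lambda>N. integral\<^sup>L (distr (M N) borel
         (\<lambda>\<omega>. (\<chi> i. 1 / sqrt (real N) * real (X N (nat \<lfloor>real N * t i\<rfloor>) \<omega>)) :: real ^ 'd)) f)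
      \<longlonglongrightarrow> integral\<^sup>L (distr M' borel (\<lambda>\<omega>. (\<chi> i. \<xi> (t i) \<omega>) :: real ^ 'd)) f"
    \<comment> \<open>Dropping the index N = 0 does not change the limit and matches the shifted
      indices.\<close>
    proof (rule LIMSEQ_imp_Suc)
      show "(\<lambda>N. integral\<^sup>L (distr (M (Suc N)) borel
         (\<lambda>\<omega>. (\<chi> i. 1 / sqrt (real (Suc N)) * real (X (Suc N) (nat \<lfloor>real (Suc N) * t i\<rfloor>) \<omega>)) :: real ^ 'd)) f)
      \<longlonglongrightarrow> integral\<^sup>L (distr M' borel (\<lambda>\<omega>. (\<chi> i. \<xi> (t i) \<omega>) :: real ^ 'd)) f"
        unfolding integral_distr[OF Xm fm] integral_distr[OF xm fm]
        using fdd_convergence[OF assms(8) f] unfolding h_def clock_def .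
    qed
  qed
qed

end
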